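(* For any ordinal $\delta$, the category $\mathcal E_\delta$ contains no subcategory isomorphic to the ordinal $\delta^+$. Moreover, if $T$ is a $\delta^+$-tree isomorphic to a subcategory of $\mathcal E_\delta$, then forcing with $T$ collapses $\delta^+$.
   Context: $\mathcal E_\delta$ is the category whose objects are all transitive models of $\mathrm{ZFC}$ of height $\delta$ and whose arrows are all elementary embeddings between them. A partial order (such as an ordinal or a tree) is regarded as a category with exactly one arrow $x \to y$ when $x \leq y$ and none otherwise. A $\delta^+$-tree is a tree of height $\delta^+$ all of whose levels have cardinality at most $\delta$.
   Formalization: The collapse of δ⁺ is claimed only below nodes all of whose extensions have extensions of arbitrarily large height below δ⁺ (so everywhere, if T is pruned); with a terminal node, forcing with T need not collapse δ⁺. *)

theory Defs
  imports Main "HOL-Library.FuncSet"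
begin

section \<open>First-order set theory\<close>

text \<open>Formulas of the language of set theory, with named variables.\<close>

datatype fm =
    Mem nat nat
  | Eq nat nat
  | Neg fm
  | And fm fm
  | Forall nat fm

abbreviation Or :: "fm \<Rightarrow> fm \<Rightarrow> fm" where
  "Or \<phi> \<psi> \<equiv> Neg (And (Neg \<phi>) (Neg \<psi>))"

abbreviation Imp :: "fm \<Rightarrow> fm \<Rightarrow> fm" where
  "Imp \<phi> \<psi> \<equiv> Neg (And \<phi> (Neg \<psi>))"

abbreviation Iff :: "fm \<Rightarrow> fm \<Rightarrow> fm" where
  "Iff \<phi> \<psi> \<equiv> And (Imp \<phi> \<psi>) (Imp \<psi> \<phi>)"

abbreviation Exists :: "nat \<Rightarrow> fm \<Rightarrow> fm" where
  "Exists n \<phi> \<equiv> Neg (Forall n (Neg \<phi>))"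

primrec fv :: "fm \<Rightarrow> nat set" where
  "fv (Mem i j) = {i, j}"
| "fv (Eq i j) = {i, j}"
| "fv (Neg \<phi>) = fv \<phi>"
| "fv (And \<phi> \<psi>) = fv \<phi> \<union> fv \<psi>"
| "fv (Forall n \<phi>) = fv \<phi> - {n}"

text \<open>Satisfaction in the structure with domain \<open>M\<close> and membership relation \<open>mem\<close>.\<close>

primrec sat :: "('v \<Rightarrow> 'v \<Rightarrow> bool) \<Rightarrow> 'v set \<Rightarrow> (nat \<Rightarrow> 'v) \<Rightarrow> fm \<Rightarrow> bool" where
  "sat mem M s (Mem i j) \<longleftrightarrow> mem (s i) (s j)"
| "sat mem M s (Eq i j) \<longleftrightarrow> s i = s j"
| "sat mem M s (Neg \<phi>) \<longleftrightarrow> \<not> sat mem M s \<phi>"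
| "sat mem M s (And \<phi> \<psi>) \<longleftrightarrow> sat mem M s \<phi> \<and> sat mem M s \<psi>"
| "sat mem M s (Forall n \<phi>) \<longleftrightarrow> (\<forall>x\<in>M. sat mem M (s(n := x)) \<phi>)"

definition extensionality_fm :: fm where
  "extensionality_fm = Forall 0 (Forall 1 (Imp (Forall 2 (Iff (Mem 2 0) (Mem 2 1))) (Eq 0 1)))"

definition foundation_fm :: fm where
  "foundation_fm =
     Forall 0 (Imp (Exists 1 (Mem 1 0)) (Exists 1 (And (Mem 1 0) (Neg (Exists 2 (And (Mem 2 1) (Mem 2 0)))))))"

definition pairing_fm :: fm where
  "pairing_fm = Forall 0 (Forall 1 (Exists 2 (Forall 3 (Iff (Mem 3 2) (Or (Eq 3 0) (Eq 3 1))))))"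

definition union_fm :: fm where
  "union_fm = Forall 0 (Exists 1 (Forall 2 (Iff (Mem 2 1) (Exists 3 (And (Mem 3 0) (Mem 2 3))))))"

definition powerset_fm :: fm where
  "powerset_fm = Forall 0 (Exists 1 (Forall 2 (Iff (Mem 2 1) (Forall 3 (Imp (Mem 3 2) (Mem 3 0))))))"

definition infinity_fm :: fm where
  "infinity_fm =
     Exists 0 (And
       (Exists 1 (And (Mem 1 0) (Neg (Exists 2 (Mem 2 1)))))
       (Forall 1 (Imp (Mem 1 0)
          (Exists 2 (And (Mem 2 0) (Forall 3 (Iff (Mem 3 2) (Or (Mem 3 1) (Eq 3 1)))))))))"

text \<open>Choice: every family \<open>x\<^sub>0\<close> of nonempty pairwise disjoint sets has a transversal \<open>x\<^sub>4\<close>.\<close>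

definition choice_fm :: fm where
  "choice_fm =
     Forall 0 (Imp
       (And
         (Forall 1 (Imp (Mem 1 0) (Exists 2 (Mem 2 1))))
         (Forall 1 (Forall 2 (Imp (And (And (Mem 1 0) (Mem 2 0)) (Neg (Eq 1 2)))
            (Neg (Exists 3 (And (Mem 3 1) (Mem 3 2))))))))
       (Exists 4 (Forall 1 (Imp (Mem 1 0)
          (Exists 5 (Forall 6 (Iff (And (Mem 6 1) (Mem 6 4)) (Eq 6 5))))))))"

text \<open>In both schemas all free variables of \<open>\<phi>\<close> other than the displayed ones are parameters.
  For Separation \<open>\<phi>\<close> is read as \<open>\<phi>(x\<^sub>0)\<close>; for Replacement it is read as \<open>\<phi>(x\<^sub>0, x\<^sub>3)\<close>, with
  \<open>x\<^sub>3\<close> the value at \<open>x\<^sub>0\<close>. The given set is \<open>x\<^sub>1\<close>, and the set asserted to exist is \<open>x\<^sub>2\<close>.\<close>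

definition separation_fm :: "fm \<Rightarrow> fm" where
  "separation_fm \<phi> = Forall 1 (Exists 2 (Forall 0 (Iff (Mem 0 2) (And (Mem 0 1) \<phi>))))"

definition replacement_fm :: "fm \<Rightarrow> fm" where
  "replacement_fm \<phi> =
     Forall 1 (Imp
       (Forall 0 (Imp (Mem 0 1) (Exists 4 (Forall 3 (Iff \<phi> (Eq 3 4))))))
       (Exists 2 (Forall 3 (Iff (Mem 3 2) (Exists 0 (And (Mem 0 1) \<phi>))))))"

definition ZFC :: "fm set" where
  "ZFC =
     {extensionality_fm, foundation_fm, pairing_fm, union_fm, powerset_fm, infinity_fm, choice_fm}
     \<union> {separation_fm \<phi> | \<phi>. 2 \<notin> fv \<phi>}
     \<union> {replacement_fm \<phi> | \<phi>. 2 \<notin> fv \<phi> \<and> 4 \<notin> fv \<phi>}"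

text \<open>Truth of the universal closure. Structures are nonempty; the empty set would vacuously
  satisfy everything.\<close>

definition models :: "('v \<Rightarrow> 'v \<Rightarrow> bool) \<Rightarrow> 'v set \<Rightarrow> fm set \<Rightarrow> bool" where
  "models mem M \<Phi> \<longleftrightarrow> M \<noteq> {} \<and> (\<forall>\<phi>\<in>\<Phi>. \<forall>s. range s \<subseteq> M \<longrightarrow> sat mem M s \<phi>)"

definition elementary_embedding ::
    "('v \<Rightarrow> 'v \<Rightarrow> bool) \<Rightarrow> 'v set \<Rightarrow> 'v set \<Rightarrow> ('v \<Rightarrow> 'v) \<Rightarrow> bool" where
  "elementary_embedding mem M N j \<longleftrightarrow>
     j \<in> M \<rightarrow>\<^sub>E N \<and> (\<forall>\<phi> s. range s \<subseteq> M \<longrightarrow> (sat mem M s \<phi> \<longleftrightarrow> sat mem N (j \<circ> s) \<phi>))"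


section \<open>Transitive models and their heights\<close>

text \<open>The sets live in a type \<open>'v\<close> with a well-founded extensional relation \<open>mem\<close>. By Mostowski's
  theorem these are, up to isomorphism, exactly the transitive collections of sets with their
  membership relation. A model is a set \<open>M :: 'v set\<close>, which need not be coded by an element of
  \<open>'v\<close>, and no closure property of \<open>'v\<close> is needed. A transitive model of height \<open>\<delta>\<close> consists of
  sets of hereditary cardinality at most that of \<open>\<delta>\<close>, so as soon as \<open>'v\<close> contains all of these,
  all transitive models of height \<open>\<delta>\<close> are subsets of \<open>'v\<close>.\<close>

definition set_universe :: "('v \<Rightarrow> 'v \<Rightarrow> bool) \<Rightarrow> bool" where
  "set_universe mem \<longleftrightarrow> wfp mem \<and> (\<forall>x y. (\<forall>z. mem z x \<longleftrightarrow> mem z y) \<longrightarrow> x = y)"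

definition transitive_set :: "('v \<Rightarrow> 'v \<Rightarrow> bool) \<Rightarrow> 'v set \<Rightarrow> bool" where
  "transitive_set mem M \<longleftrightarrow> (\<forall>x\<in>M. \<forall>y. mem y x \<longrightarrow> y \<in> M)"

definition ordinals :: "('v \<Rightarrow> 'v \<Rightarrow> bool) \<Rightarrow> 'v set" where
  "ordinals mem =
     {x. transitive_set mem {y. mem y x} \<and> (\<forall>y. mem y x \<longrightarrow> transitive_set mem {z. mem z y})}"

text \<open>An arbitrary ordinal is represented by a well-order \<open>\<delta> :: 'd rel\<close> (reflexive on its field,
  as usual in the HOL cardinal library), two well-orders being the same ordinal iff they are related
  by \<^const>\<open>ordIso\<close>. The height of a transitive model is the order type of its ordinals.\<close>

definition height :: "('v \<Rightarrow> 'v \<Rightarrow> bool) \<Rightarrow> 'v set \<Rightarrow> 'v rel" where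
  "height mem M = {(x, y). x \<in> M \<inter> ordinals mem \<and> y \<in> M \<inter> ordinals mem \<and> (mem x y \<or> x = y)}"

definition transitive_ZFC_model :: "('v \<Rightarrow> 'v \<Rightarrow> bool) \<Rightarrow> 'd rel \<Rightarrow> 'v set \<Rightarrow> bool" where
  "transitive_ZFC_model mem \<delta> M \<longleftrightarrow>
     transitive_set mem M \<and> models mem M ZFC \<and> (height mem M, \<delta>) \<in> ordIso"

text \<open>The cardinal \<open>\<delta>\<^sup>+\<close>: the least cardinal greater than the cardinality of \<open>\<delta>\<close>.\<close>

definition succ_card :: "'d rel \<Rightarrow> 'd set rel" where
  "succ_card \<delta> = cardSuc (card_of (Field \<delta>))"


section \<open>Categories\<close>

text \<open>\<open>Comp C g f\<close> is the composite ``\<open>g\<close> after \<open>f\<close>'', meaningful when \<open>Cod C f = Dom C g\<close>.\<close>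

record ('o, 'a) cat =
  Obj :: "'o set"
  Arr :: "'a set"
  Dom :: "'a \<Rightarrow> 'o"
  Cod :: "'a \<Rightarrow> 'o"
  Ident :: "'o \<Rightarrow> 'a"
  Comp :: "'a \<Rightarrow> 'a \<Rightarrow> 'a"

definition category :: "('o, 'a) cat \<Rightarrow> bool" where
  "category C \<longleftrightarrow>
     (\<forall>f\<in>Arr C. Dom C f \<in> Obj C \<and> Cod C f \<in> Obj C) \<and>
     (\<forall>x\<in>Obj C. Ident C x \<in> Arr C \<and> Dom C (Ident C x) = x \<and> Cod C (Ident C x) = x) \<and>
     (\<forall>f\<in>Arr C. \<forall>g\<in>Arr C. Cod C f = Dom C g \<longrightarrow>
        Comp C g f \<in> Arr C \<and> Dom C (Comp C g f) = Dom C f \<and> Cod C (Comp C g f) = Cod C g) \<and>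
     (\<forall>f\<in>Arr C. Comp C f (Ident C (Dom C f)) = f \<and> Comp C (Ident C (Cod C f)) f = f) \<and>
     (\<forall>f\<in>Arr C. \<forall>g\<in>Arr C. \<forall>h\<in>Arr C. Cod C f = Dom C g \<longrightarrow> Cod C g = Dom C h \<longrightarrow>
        Comp C h (Comp C g f) = Comp C (Comp C h g) f)"

definition subcategory :: "('o, 'a) cat \<Rightarrow> ('o, 'a) cat \<Rightarrow> bool" where
  "subcategory S C \<longleftrightarrow>
     category S \<and> Obj S \<subseteq> Obj C \<and> Arr S \<subseteq> Arr C \<and>
     (\<forall>f\<in>Arr S. Dom S f = Dom C f \<and> Cod S f = Cod C f) \<and>
     (\<forall>x\<in>Obj S. Ident S x = Ident C x) \<and>
     (\<forall>f\<in>Arr S. \<forall>g\<in>Arr S. Cod S f = Dom S g \<longrightarrow> Comp S g f = Comp C g f)"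

definition isomorphic_cat :: "('o, 'a) cat \<Rightarrow> ('p, 'b) cat \<Rightarrow> bool" where
  "isomorphic_cat C D \<longleftrightarrow>
     (\<exists>F G. bij_betw F (Obj C) (Obj D) \<and> bij_betw G (Arr C) (Arr D) \<and>
        (\<forall>f\<in>Arr C. Dom D (G f) = F (Dom C f) \<and> Cod D (G f) = F (Cod C f)) \<and>
        (\<forall>x\<in>Obj C. G (Ident C x) = Ident D (F x)) \<and>
        (\<forall>f\<in>Arr C. \<forall>g\<in>Arr C. Cod C f = Dom C g \<longrightarrow> G (Comp C g f) = Comp D (G g) (G f)))"

text \<open>A partial order is given by its reflexive order relation \<open>r\<close>, with underlying set \<open>Field r\<close>.\<close>

definition poset_cat :: "'p rel \<Rightarrow> ('p, 'p \<times> 'p) cat" where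
  "poset_cat r =
     \<lparr>Obj = Field r, Arr = r, Dom = fst, Cod = snd,
      Ident = (\<lambda>x. (x, x)), Comp = (\<lambda>g f. (fst f, snd g))\<rparr>"

text \<open>The category \<open>\<E>\<^sub>\<delta>\<close>. An arrow is an elementary embedding together with its domain and
  codomain.\<close>

definition elementary_cat ::
    "('v \<Rightarrow> 'v \<Rightarrow> bool) \<Rightarrow> 'd rel \<Rightarrow> ('v set, 'v set \<times> ('v \<Rightarrow> 'v) \<times> 'v set) cat" where
  "elementary_cat mem \<delta> =
     \<lparr>Obj = {M. transitive_ZFC_model mem \<delta> M},
      Arr = {(M, j, N). transitive_ZFC_model mem \<delta> M \<and> transitive_ZFC_model mem \<delta> N \<and>
                        elementary_embedding mem M N j},
      Dom = (\<lambda>(M, j, N). M),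
      Cod = (\<lambda>(M, j, N). N),
      Ident = (\<lambda>M. (M, restrict id M, M)),
      Comp = (\<lambda>(M', k, N') (M, j, N). (M, compose M k j, N'))\<rparr>"

lemma category_poset_cat:
  assumes "Partial_order r"
  shows "category (poset_cat r)"
  using assms
  by (auto simp: category_def poset_cat_def Field_def partial_order_on_def preorder_on_def
      refl_on_def dest: transD)

lemma elementary_embedding_id: "elementary_embedding mem M M (restrict id M)"
proof -
  have "restrict id M \<circ> s = s" if "range s \<subseteq> M" for s :: "nat \<Rightarrow> 'a"
    using that by (auto simp: fun_eq_iff)
  then show ?thesis
    by (auto simp: elementary_embedding_def)
qed

lemma elementary_embedding_compose:
  assumes "elementary_embedding mem M N j" "elementary_embedding mem N P k"
  shows "elementary_embedding mem M P (compose M k j)"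
  unfolding elementary_embedding_def
proof (intro conjI allI impI)
  show "compose M k j \<in> M \<rightarrow>\<^sub>E P"
    using assms by (auto simp: elementary_embedding_def compose_def)
  fix \<phi> and s :: "nat \<Rightarrow> 'a"
  assume s: "range s \<subseteq> M"
  then have "compose M k j \<circ> s = k \<circ> (j \<circ> s)" "range (j \<circ> s) \<subseteq> N"
    using assms by (auto simp: elementary_embedding_def compose_def fun_eq_iff)
  with s assms show "sat mem M s \<phi> \<longleftrightarrow> sat mem P (compose M k j \<circ> s) \<phi>"
    by (simp add: elementary_embedding_def)
qed

lemma category_elementary_cat: "category (elementary_cat mem \<delta>)"
proof -
  have 1: "compose M j (restrict id M) = j" "compose M (restrict id N) j = j"
    if "elementary_embedding mem M N j" for M N j
    using that by (auto simp: elementary_embedding_def compose_def fun_eq_iff PiE_def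
        extensional_def Pi_def)
  have 2: "compose M l (compose M k j) = compose M (compose N l k) j"
    if "elementary_embedding mem M N j" for M N j k l
    using that by (auto simp: elementary_embedding_def compose_def fun_eq_iff PiE_def Pi_def)
  show ?thesis
    by (auto simp: category_def elementary_cat_def elementary_embedding_id 1 2
        intro: elementary_embedding_compose)
qed


section \<open>Trees\<close>

definition is_tree :: "'t rel \<Rightarrow> bool" where
  "is_tree T \<longleftrightarrow> Partial_order T \<and> (\<forall>x\<in>Field T. Well_order (Restr T (underS T x)))"

text \<open>For a well-order \<open>\<kappa>\<close> and \<open>\<alpha> \<in> Field \<kappa>\<close>, the ordinal represented by \<open>\<alpha>\<close> is the order type of
  its set of strict predecessors; the height of a tree node is defined in the same way.\<close>

definition tree_level :: "'t rel \<Rightarrow> 'k rel \<Rightarrow> 'k \<Rightarrow> 't set" where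
  "tree_level T \<kappa> \<alpha> =
     {x \<in> Field T. (Restr T (underS T x), Restr \<kappa> (underS \<kappa> \<alpha>)) \<in> ordIso}"

definition tree_of_height :: "'t rel \<Rightarrow> 'k rel \<Rightarrow> bool" where
  "tree_of_height T \<kappa> \<longleftrightarrow>
     is_tree T \<and>
     (\<forall>x\<in>Field T. \<exists>\<alpha>\<in>Field \<kappa>. x \<in> tree_level T \<kappa> \<alpha>) \<and>
     (\<forall>\<alpha>\<in>Field \<kappa>. tree_level T \<kappa> \<alpha> \<noteq> {})"

definition succ_card_tree :: "'d rel \<Rightarrow> 't rel \<Rightarrow> bool" where
  "succ_card_tree \<delta> T \<longleftrightarrow>
     tree_of_height T (succ_card \<delta>) \<and>
     (\<forall>\<alpha>\<in>Field (succ_card \<delta>).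
        (card_of (tree_level T (succ_card \<delta>) \<alpha>), card_of (Field \<delta>)) \<in> ordLeq)"

text \<open>\<open>T\<close> is pruned above \<open>p\<close>: every extension of \<open>p\<close> has extensions of arbitrarily large height
  below \<open>\<kappa>\<close>. For \<open>T\<close> of height \<open>\<kappa>\<close> this says that \<open>p\<close> forces the generic branch of \<open>T\<close> to be
  cofinal. Only such \<open>p\<close> can force that \<open>\<kappa>\<close> is collapsed when \<open>T\<close> is a \<open>\<delta>\<^sup>+\<close>-tree and
  \<open>\<kappa> = \<delta>\<^sup>+\<close> is infinite: otherwise some extension of \<open>p\<close> has at most \<open>\<delta>\<close> many extensions (a
  terminal node, for instance, has none), and forcing below it preserves \<open>\<delta>\<^sup>+\<close>.\<close>

definition pruned_above :: "'t rel \<Rightarrow> 'k rel \<Rightarrow> 't \<Rightarrow> bool" where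
  "pruned_above T \<kappa> p \<longleftrightarrow>
     (\<forall>q. (p, q) \<in> T \<longrightarrow>
        (\<forall>\<alpha>\<in>Field \<kappa>. \<exists>\<beta> x. (\<alpha>, \<beta>) \<in> \<kappa> \<and> x \<in> tree_level T \<kappa> \<beta> \<and> (q, x) \<in> T))"


section \<open>Forcing\<close>

text \<open>A forcing notion is a preorder \<open>r\<close>, where \<open>(q, p) \<in> r\<close> means that \<open>q\<close> is stronger than \<open>p\<close>; it
  need not have a weakest condition. A name is a set of pairs of a name and a condition, indexed
  by \<open>'i \<times> 'p\<close>; so these are all names of hereditary cardinality at most that of \<open>'i \<times> 'p\<close>.\<close>

datatype ('i, 'p) pname = Name "'i \<times> 'p \<Rightarrow> (('i, 'p) pname \<times> 'p) option"

primrec elts :: "('i, 'p) pname \<Rightarrow> (('i, 'p) pname \<times> 'p) set" where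
  "elts (Name f) = ran f"

definition name_rel :: "('i, 'p) pname rel" where
  "name_rel = {(x, y). \<exists>p. (x, p) \<in> elts y}"

lemma wf_name_rel: "wf name_rel"
proof (rule wfUNIVI)
  fix P :: "('i, 'p) pname \<Rightarrow> bool" and x
  assume step: "\<forall>x. (\<forall>y. (y, x) \<in> name_rel \<longrightarrow> P y) \<longrightarrow> P x"
  show "P x"
  proof (induction x)
    case (Name f)
    have "P y" if yp: "(y, p) \<in> ran f" for y p
    proof -
      from yp have "Some (y, p) \<in> range f"
        by (simp add: ran_def image_iff) metis
      then show ?thesis
        by (rule Name) auto
    qed
    then have "\<forall>y. (y, Name f) \<in> name_rel \<longrightarrow> P y"
      unfolding name_rel_def by auto
    with step show ?case
      by blast
  qed
qed

definition dense_below :: "'p rel \<Rightarrow> 'p \<Rightarrow> ('p \<Rightarrow> bool) \<Rightarrow> bool" where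
  "dense_below r p D \<longleftrightarrow> (\<forall>q. (q, p) \<in> r \<longrightarrow> (\<exists>q'. (q', q) \<in> r \<and> D q'))"

lemma dense_below_cong [fundef_cong]:
  "r = r' \<Longrightarrow> p = p' \<Longrightarrow> (\<And>q. D q = D' q) \<Longrightarrow> dense_below r p D = dense_below r' p' D'"
  by (simp add: dense_below_def)

text \<open>The usual recursion: \<open>p\<close> forces \<open>x = y\<close> iff whenever \<open>(c, s) \<in> x\<close> and \<open>q\<close> is a common
  extension of \<open>p\<close> and \<open>s\<close>, then \<open>q\<close> forces \<open>c \<in> y\<close>, and symmetrically; and \<open>q\<close> forces \<open>c \<in> y\<close> iff
  below \<open>q\<close> there are densely many \<open>q'\<close> such that, for some \<open>(d, t) \<in> y\<close>, \<open>q'\<close> extends \<open>t\<close> and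
  forces \<open>c = d\<close>. The membership clause is inlined below and appears separately as
  \<open>forces_mem\<close>.\<close>

function forces_eq :: "'p rel \<Rightarrow> 'p \<Rightarrow> ('i, 'p) pname \<Rightarrow> ('i, 'p) pname \<Rightarrow> bool" where
  "forces_eq r p x y \<longleftrightarrow>
     (\<forall>c\<in>elts x. \<forall>q. (q, p) \<in> r \<and> (q, snd c) \<in> r \<longrightarrow>
        dense_below r q (\<lambda>q'. \<exists>d\<in>elts y. (q', snd d) \<in> r \<and> forces_eq r q' (fst c) (fst d))) \<and>
     (\<forall>d\<in>elts y. \<forall>q. (q, p) \<in> r \<and> (q, snd d) \<in> r \<longrightarrow>
        dense_below r q (\<lambda>q'. \<exists>c\<in>elts x. (q', snd c) \<in> r \<and> forces_eq r q' (fst c) (fst d)))"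
  by pat_completeness auto
termination
  by (relation "inv_image name_rel (\<lambda>(r, p, x, y). x)")
     (use wf_name_rel in \<open>auto simp: name_rel_def\<close>)

declare forces_eq.simps [simp del]

definition forces_mem :: "'p rel \<Rightarrow> 'p \<Rightarrow> ('i, 'p) pname \<Rightarrow> ('i, 'p) pname \<Rightarrow> bool" where
  "forces_mem r p x y \<longleftrightarrow>
     dense_below r p (\<lambda>q. \<exists>d\<in>elts y. (q, snd d) \<in> r \<and> forces_eq r q x (fst d))"

primrec forces :: "'p rel \<Rightarrow> 'p \<Rightarrow> (nat \<Rightarrow> ('i, 'p) pname) \<Rightarrow> fm \<Rightarrow> bool" where
  "forces r p s (Mem i j) \<longleftrightarrow> forces_mem r p (s i) (s j)"
| "forces r p s (Eq i j) \<longleftrightarrow> forces_eq r p (s i) (s j)"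
| "forces r p s (Neg \<phi>) \<longleftrightarrow> (\<forall>q. (q, p) \<in> r \<longrightarrow> \<not> forces r q s \<phi>)"
| "forces r p s (And \<phi> \<psi>) \<longleftrightarrow> forces r p s \<phi> \<and> forces r p s \<psi>"
| "forces r p s (Forall n \<phi>) \<longleftrightarrow> (\<forall>x. forces r p (s(n := x)) \<phi>)"

text \<open>Canonical names for the elements of a well-order \<open>\<kappa>\<close> (as von Neumann ordinals) and for the
  ordinal \<open>\<kappa>\<close> itself. In the absence of a weakest condition, every condition is attached to every
  element.\<close>

definition check_elt :: "'p rel \<Rightarrow> 'k rel \<Rightarrow> 'k \<Rightarrow> ('k, 'p) pname" where
  "check_elt r \<kappa> = wfrec (\<kappa> - Id)
     (\<lambda>check \<alpha>. Name (\<lambda>(\<beta>, p).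
        if (\<beta>, \<alpha>) \<in> \<kappa> - Id \<and> p \<in> Field r then Some (check \<beta>, p) else None))"

lemma check_elt_unfold:
  assumes "Well_order \<kappa>"
  shows "check_elt r \<kappa> \<alpha> = Name (\<lambda>(\<beta>, p).
    if (\<beta>, \<alpha>) \<in> \<kappa> - Id \<and> p \<in> Field r then Some (check_elt r \<kappa> \<beta>, p) else None)"
proof -
  have "wf (\<kappa> - Id)"
    using assms by (simp add: well_order_on_def)
  then show ?thesis
    unfolding check_elt_def by (subst wfrec) (auto simp: fun_eq_iff cut_apply)
qed

definition check_ord :: "'p rel \<Rightarrow> 'k rel \<Rightarrow> ('k, 'p) pname" where
  "check_ord r \<kappa> = Name (\<lambda>(\<beta>, p).
     if \<beta> \<in> Field \<kappa> \<and> p \<in> Field r then Some (check_elt r \<kappa> \<beta>, p) else None)"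

text \<open>\<open>x\<^sub>w = {x\<^sub>x, x\<^sub>y}\<close>; \<open>x\<^sub>z = (x\<^sub>x, x\<^sub>y)\<close> (Kuratowski pair); and \<open>(x\<^sub>x, x\<^sub>y) \<in> x\<^sub>f\<close>. The variables
  5, 6, 7 are used as bound variables and must differ from the arguments.\<close>

definition upair_fm :: "nat \<Rightarrow> nat \<Rightarrow> nat \<Rightarrow> fm" where
  "upair_fm w x y = Forall 7 (Iff (Mem 7 w) (Or (Eq 7 x) (Eq 7 y)))"

definition pair_fm :: "nat \<Rightarrow> nat \<Rightarrow> nat \<Rightarrow> fm" where
  "pair_fm z x y = Forall 6 (Iff (Mem 6 z) (Or (upair_fm 6 x x) (upair_fm 6 x y)))"

definition app_fm :: "nat \<Rightarrow> nat \<Rightarrow> nat \<Rightarrow> fm" where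
  "app_fm f x y = Exists 5 (And (Mem 5 f) (pair_fm 5 x y))"

text \<open>\<open>x\<^sub>2\<close> is a function from \<open>x\<^sub>1\<close> onto \<open>x\<^sub>0\<close>.\<close>

definition surjection_fm :: fm where
  "surjection_fm =
     And (Forall 5 (Imp (Mem 5 2)
           (Exists 3 (And (Mem 3 1) (Exists 4 (And (Mem 4 0) (pair_fm 5 3 4)))))))
    (And (Forall 3 (Imp (Mem 3 1)
           (Exists 4 (And (app_fm 2 3 4) (Forall 8 (Imp (app_fm 2 3 8) (Eq 8 4)))))))
         (Forall 4 (Imp (Mem 4 0) (Exists 3 (And (Mem 3 1) (app_fm 2 3 4))))))"

text \<open>The ordinal \<open>x\<^sub>0\<close> is not a cardinal: some smaller ordinal is mapped onto it.\<close>

definition not_cardinal_fm :: fm where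
  "not_cardinal_fm = Exists 1 (And (Mem 1 0) (Exists 2 surjection_fm))"

text \<open>Forcing with a tree, the condition \<open>p\<close> forces that \<open>\<kappa>\<close> is collapsed, i.e. is no longer a
  cardinal. Conditions are the nodes of the tree, larger nodes being stronger, so the forcing
  order is the converse of the tree order. Restricting to names of bounded hereditary size is
  harmless: \<open>not_cardinal_fm\<close> is a \<open>\<Sigma>\<^sub>1\<close> statement about \<open>\<kappa>\<close>, and any function from a smaller
  ordinal onto \<open>\<kappa>\<close> in the extension has a name among the names considered here.\<close>

definition tree_forces_collapse :: "'t rel \<Rightarrow> 't \<Rightarrow> 'k rel \<Rightarrow> bool" where
  "tree_forces_collapse T p \<kappa> \<longleftrightarrow>
     forces (T\<inverse>) p (\<lambda>_. check_ord (T\<inverse>) \<kappa>) not_cardinal_fm"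

end

(* An elementary embedding between transitive models of ZFC of the same height that fixes every
   ordinal is the identity, since each set is enumerated by an ordinal inside the model, and it is
   onto, since the models then have the same cumulative hierarchy. Hence in a subcategory isomorphic
   to a partial order every arrow x < y moves some ordinal below delta.

   Such a system of ordinal maps yields, above any node, a node q and upward closed sets E(xi) of
   nodes, for xi < delta, such that above every r >= q some E(xi) is entered that does not contain r.
   Along a chain the points of entry are cofinal, so the chain cannot have the order type of the
   regular cardinal delta^+. Along a generic branch of the tree they are cofinal as well, and since
   every ordinal below delta^+ is an image of delta, they code a surjection from delta x delta
   onto delta^+ in the forcing extension. *)

theory Submission
  imports Defs
begin

section \<open>Definable predicates over transitive models\<close>

text \<open>The obstacle is that each proper arrow moves some ordinal, but different arrows may move
  different ones, so no single ordinal need have images that grow forever. Hence a dichotomy. If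
  above some node the images of one ordinal never come to rest, \<open>E \<xi>\<close> consists of
  the nodes at which its image exceeds \<open>\<xi>\<close>. Otherwise every ordinal is, densely
  often, fixed for good from some node on, and \<open>E \<xi>\<close> consists of the nodes from
  which \<open>\<xi>\<close> is fixed; an ordinal moved above \<open>r\<close> witnesses that
  \<open>r\<close> has not yet entered its set. The embeddings are external to the models, so only
  first-order statements travel along them; therefore definability is tracked throughout and
  recursion is carried out inside transitive models. In the tree, (\<open>\<xi>\<close>,
  \<open>\<zeta>\<close>) is sent to the \<open>\<zeta>\<close>-th ordinal below the level at which
  the branch enters \<open>E \<xi>\<close>: one factor delta names the entry, the other lists the
  ordinals below its level. No generic filter appears; the forcing relation is handled directly.
  That delta is infinite follows from the existence of a model.\<close>

lemma finite_fv: "finite (fv \<phi>)"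
  by (induction \<phi>) auto

lemma sat_cong_fv:
  "(\<And>i. i \<in> fv \<phi> \<Longrightarrow> s i = t i) \<Longrightarrow> sat mem M s \<phi> \<longleftrightarrow> sat mem M t \<phi>"
proof (induction \<phi> arbitrary: s t)
  case (Forall n \<phi>)
  have "sat mem M (s(n := x)) \<phi> \<longleftrightarrow> sat mem M (t(n := x)) \<phi>" for x
    by (rule Forall.IH) (use Forall.prems in auto)
  then show ?case by simp
next
  case (And \<phi> \<psi>)
  have "sat mem M s \<phi> \<longleftrightarrow> sat mem M t \<phi>" by (rule And.IH(1)) (use And.prems in auto)
  moreover have "sat mem M s \<psi> \<longleftrightarrow> sat mem M t \<psi>" by (rule And.IH(2)) (use And.prems in auto)
  ultimately show ?case by simp
next
  case (Neg \<phi>)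
  have "sat mem M s \<phi> \<longleftrightarrow> sat mem M t \<phi>" by (rule Neg.IH) (use Neg.prems in auto)
  then show ?case by simp
qed auto

lemma sat_connectives:
  "sat mem M s (Imp \<phi> \<psi>) \<longleftrightarrow> (sat mem M s \<phi> \<longrightarrow> sat mem M s \<psi>)"
  "sat mem M s (Or \<phi> \<psi>) \<longleftrightarrow> sat mem M s \<phi> \<or> sat mem M s \<psi>"
  "sat mem M s (Exists n \<phi>) \<longleftrightarrow> (\<exists>x\<in>M. sat mem M (s(n := x)) \<phi>)"
  "sat mem M s (Iff \<phi> \<psi>) \<longleftrightarrow> (sat mem M s \<phi> \<longleftrightarrow> sat mem M s \<psi>)"
  by auto

lemmas sat_eval = fun_upd_apply zero_neq_one one_neq_zero zero_neq_numeral numeral_neq_zero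
  numeral_eq_iff one_eq_numeral_iff numeral_eq_one_iff num.distinct num.inject if_True if_False
  simp_thms

text \<open>Variables are named, so a renaming of the environment must be matched by a rewritten
  formula, with bound variables changed to avoid capture.\<close>

lemma sat_rename:
  "\<exists>\<psi>. fv \<psi> \<subseteq> \<rho> ` fv \<phi> \<and> (\<forall>mem (M :: 'v set) s. sat mem M s \<psi> \<longleftrightarrow> sat mem M (s \<circ> \<rho>) \<phi>)"
proof (induction \<phi> arbitrary: \<rho>)
  case (Mem i j)
  show ?case by (rule exI[of _ "Mem (\<rho> i) (\<rho> j)"]) auto
next
  case (Eq i j)
  show ?case by (rule exI[of _ "Eq (\<rho> i) (\<rho> j)"]) auto
next
  case (Neg \<phi>)
  then obtain \<psi> where "fv \<psi> \<subseteq> \<rho> ` fv \<phi>"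
      "\<forall>mem (M :: 'v set) s. sat mem M s \<psi> \<longleftrightarrow> sat mem M (s \<circ> \<rho>) \<phi>"
    by blast
  then show ?case by (intro exI[of _ "Neg \<psi>"]) (simp add: comp_def)
next
  case (And \<phi>1 \<phi>2)
  from And.IH(1)[of \<rho>] And.IH(2)[of \<rho>] obtain \<psi>1 \<psi>2 where
    "fv \<psi>1 \<subseteq> \<rho> ` fv \<phi>1" "\<forall>mem (M :: 'v set) s. sat mem M s \<psi>1 \<longleftrightarrow> sat mem M (s \<circ> \<rho>) \<phi>1"
    "fv \<psi>2 \<subseteq> \<rho> ` fv \<phi>2" "\<forall>mem (M :: 'v set) s. sat mem M s \<psi>2 \<longleftrightarrow> sat mem M (s \<circ> \<rho>) \<phi>2"
    by blast
  then show ?case by (intro exI[of _ "And \<psi>1 \<psi>2"]) (auto simp only: sat.simps fv.simps)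
next
  case (Forall n \<phi>)
  have "finite (\<rho> ` (fv \<phi> - {n}))" using finite_fv by blast
  \<comment> \<open>A fresh bound variable: it captures none of the renamed free variables.\<close>
  then obtain m where m: "m \<notin> \<rho> ` (fv \<phi> - {n})"
    using ex_new_if_finite infinite_UNIV_nat by blast
  obtain \<psi> where \<psi>: "fv \<psi> \<subseteq> \<rho>(n := m) ` fv \<phi>"
    "\<forall>mem (M :: 'v set) s. sat mem M s \<psi> \<longleftrightarrow> sat mem M (s \<circ> \<rho>(n := m)) \<phi>"
    using Forall.IH by blast
  have eq: "sat mem M (s(m := x) \<circ> \<rho>(n := m)) \<phi> \<longleftrightarrow> sat mem M ((s \<circ> \<rho>)(n := x)) \<phi>"
    for mem s x and M :: "'v set"
    by (rule sat_cong_fv) (use m in auto)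
  have "sat mem M s (Forall m \<psi>) \<longleftrightarrow> sat mem M (s \<circ> \<rho>) (Forall n \<phi>)" for mem s and M :: "'v set"
    using \<psi>(2) eq by simp
  moreover have "fv (Forall m \<psi>) \<subseteq> \<rho> ` fv (Forall n \<phi>)"
    using \<psi>(1) by auto
  ultimately show ?case by blast
qed

locale set_univ =
  fixes mem :: "'v \<Rightarrow> 'v \<Rightarrow> bool"
  assumes set_universe: "set_universe mem"
begin

lemma mem_wf: "wfp mem"
  using set_universe by (simp add: set_universe_def)

lemma mem_ext: "(\<And>z. mem z x \<longleftrightarrow> mem z y) \<Longrightarrow> x = y"
  using set_universe by (simp add: set_universe_def)

lemma mem_irrefl: "\<not> mem x x"
  using mem_wf by (metis wfp_imp_irreflp irreflpD)

lemma mem_induct: "(\<And>x. (\<And>y. mem y x \<Longrightarrow> P y) \<Longrightarrow> P x) \<Longrightarrow> P x"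
  using mem_wf by (metis wfp_induct_rule)

lemma mem_minimal: "P x \<Longrightarrow> \<exists>m. P m \<and> (\<forall>y. mem y m \<longrightarrow> \<not> P y)"
  using mem_induct[of "\<lambda>x. \<not> P x"] by blast

definition zmodel :: "'v set \<Rightarrow> bool" where
  "zmodel M \<longleftrightarrow> transitive_set mem M \<and> models mem M ZFC"

lemma zmodel_trans: "zmodel M \<Longrightarrow> x \<in> M \<Longrightarrow> mem y x \<Longrightarrow> y \<in> M"
  by (auto simp: zmodel_def transitive_set_def)

text \<open>The formula is required to be the same for all models, so that definable predicates are
  preserved by elementary embeddings. In the quantifier rules below the environment is shifted as
  for de Bruijn indices, so that formulas never have to be written down.\<close>

definition dfn :: "('v set \<Rightarrow> (nat \<Rightarrow> 'v) \<Rightarrow> bool) \<Rightarrow> bool" where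
  "dfn P \<longleftrightarrow> (\<exists>\<phi>. \<forall>M s. zmodel M \<longrightarrow> range s \<subseteq> M \<longrightarrow> (sat mem M s \<phi> \<longleftrightarrow> P M s))"

lemma dfn_mem: "dfn (\<lambda>M e. mem (e i) (e j))"
  unfolding dfn_def by (rule exI[of _ "Mem i j"]) auto

lemma dfn_eq: "dfn (\<lambda>M e. e i = e j)"
  unfolding dfn_def by (rule exI[of _ "Eq i j"]) auto

lemma dfn_not: assumes "dfn P" shows "dfn (\<lambda>M e. \<not> P M e)"
proof -
  obtain \<phi> where "\<forall>M s. zmodel M \<longrightarrow> range s \<subseteq> M \<longrightarrow> (sat mem M s \<phi> \<longleftrightarrow> P M s)"
    using assms unfolding dfn_def by blast
  then show ?thesis unfolding dfn_def by (intro exI[of _ "Neg \<phi>"]) auto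
qed

lemma dfn_conj: assumes "dfn P" "dfn Q" shows "dfn (\<lambda>M e. P M e \<and> Q M e)"
proof -
  obtain \<phi> \<psi> where "\<forall>M s. zmodel M \<longrightarrow> range s \<subseteq> M \<longrightarrow> (sat mem M s \<phi> \<longleftrightarrow> P M s)"
    "\<forall>M s. zmodel M \<longrightarrow> range s \<subseteq> M \<longrightarrow> (sat mem M s \<psi> \<longleftrightarrow> Q M s)"
    using assms unfolding dfn_def by blast
  then show ?thesis unfolding dfn_def by (intro exI[of _ "And \<phi> \<psi>"]) auto
qed

lemma dfn_disj: assumes "dfn P" "dfn Q" shows "dfn (\<lambda>M e. P M e \<or> Q M e)"
  using dfn_not[OF dfn_conj[OF dfn_not[OF assms(1)] dfn_not[OF assms(2)]]] by simp

lemma dfn_imp: assumes "dfn P" "dfn Q" shows "dfn (\<lambda>M e. P M e \<longrightarrow> Q M e)"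
  using dfn_not[OF dfn_conj[OF assms(1) dfn_not[OF assms(2)]]] by simp

lemma dfn_iff: assumes "dfn P" "dfn Q" shows "dfn (\<lambda>M e. P M e \<longleftrightarrow> Q M e)"
  using dfn_conj[OF dfn_imp[OF assms] dfn_imp[OF assms(2,1)]]
  by (simp add: iff_conv_conj_imp)

text \<open>The bound on the free variables is the point: it shows that the variables reserved by
  the separation and replacement schemas do not occur once the parameters have been moved
  away.\<close>

lemma dfn_rename_formula:
  assumes "dfn P"
  shows "\<exists>\<phi>. fv \<phi> \<subseteq> range \<rho> \<and>
    (\<forall>M s. zmodel M \<longrightarrow> range s \<subseteq> M \<longrightarrow> (sat mem M s \<phi> \<longleftrightarrow> P M (\<lambda>n. s (\<rho> n))))"
proof -
  obtain \<phi> where \<phi>: "\<And>M s. zmodel M \<Longrightarrow> range s \<subseteq> M \<Longrightarrow> sat mem M s \<phi> \<longleftrightarrow> P M s"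
    using assms unfolding dfn_def by blast
  obtain \<psi> where \<psi>: "fv \<psi> \<subseteq> \<rho> ` fv \<phi>"
      "\<forall>mem (M :: 'v set) s. sat mem M s \<psi> \<longleftrightarrow> sat mem M (s \<circ> \<rho>) \<phi>"
    using sat_rename by blast
  have "sat mem M s \<psi> \<longleftrightarrow> P M (\<lambda>n. s (\<rho> n))" if "zmodel M" "range s \<subseteq> M" for M s
  proof -
    have "range (s \<circ> \<rho>) \<subseteq> M" using that by auto
    then have "sat mem M (s \<circ> \<rho>) \<phi> \<longleftrightarrow> P M (s \<circ> \<rho>)" using \<phi> that by blast
    then show ?thesis using \<psi>(2) by (simp add: comp_def)
  qed
  then show ?thesis using \<psi>(1) by blast
qed

lemma dfn_rename: assumes "dfn P" shows "dfn (\<lambda>M e. P M (\<lambda>n. e (\<rho> n)))"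
  using dfn_rename_formula[OF assms, of \<rho>] unfolding dfn_def by blast

lemma dfn_ex:
  assumes "dfn (\<lambda>M e. Q M (e 0) (\<lambda>n. e (Suc n)))"
  shows "dfn (\<lambda>M e. \<exists>x\<in>M. Q M x e)"
proof -
  obtain \<phi> where \<phi>: "\<And>M s. zmodel M \<Longrightarrow> range s \<subseteq> M \<Longrightarrow>
      sat mem M s \<phi> \<longleftrightarrow> Q M (s 0) (\<lambda>n. s (Suc n))"
    using assms unfolding dfn_def by blast
  have "finite (Suc -` fv \<phi>)" by (simp add: finite_fv finite_vimageI)
  then obtain m where m: "m \<notin> Suc -` fv \<phi>"
    using ex_new_if_finite infinite_UNIV_nat by blast
  \<comment> \<open>This undoes the shift: position 0 becomes the bound variable \<open>m\<close>,
    and position \<open>Suc n\<close> becomes \<open>n\<close>. Position \<open>Suc m\<close> would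
    clash with the bound variable, but it is not free in \<open>\<phi>\<close>.\<close>
  define \<rho> where "\<rho> = case_nat m id"
  obtain \<psi> where \<psi>: "\<forall>mem (M :: 'v set) s. sat mem M s \<psi> \<longleftrightarrow> sat mem M (s \<circ> \<rho>) \<phi>"
    using sat_rename by blast
  have "sat mem M s (Exists m \<psi>) \<longleftrightarrow> (\<exists>x\<in>M. Q M x s)" if "zmodel M" "range s \<subseteq> M" for M s
  proof -
    have "sat mem M (s(m := x) \<circ> \<rho>) \<phi> \<longleftrightarrow> Q M x s" if x: "x \<in> M" for x
    proof -
      have "sat mem M (s(m := x) \<circ> \<rho>) \<phi> \<longleftrightarrow> sat mem M (case_nat x s) \<phi>"
        by (rule sat_cong_fv) (use m in \<open>auto simp: \<rho>_def split: nat.split\<close>)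
      also have "\<dots> \<longleftrightarrow> Q M x s"
      proof -
        have "range (case_nat x s) \<subseteq> M" using x \<open>range s \<subseteq> M\<close> by (auto simp: image_subset_iff split: nat.splits)
        then show ?thesis using \<phi>[OF \<open>zmodel M\<close>, of "case_nat x s"] by simp
      qed
      finally show ?thesis .
    qed
    then show ?thesis using \<psi> by simp
  qed
  then show ?thesis unfolding dfn_def by blast
qed

lemma dfn_all:
  assumes "dfn (\<lambda>M e. Q M (e 0) (\<lambda>n. e (Suc n)))"
  shows "dfn (\<lambda>M e. \<forall>x\<in>M. Q M x e)"
  using dfn_not[OF dfn_ex[where Q = "\<lambda>M x e. \<not> Q M x e", OF dfn_not[OF assms]]] by simp

lemma dfn_cong:
  assumes "dfn P" "\<And>M s. zmodel M \<Longrightarrow> range s \<subseteq> M \<Longrightarrow> P M s \<longleftrightarrow> Q M s"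
  shows "dfn Q"
  using assms unfolding dfn_def by metis

text \<open>By transitivity, a quantifier bounded by an element of the model ranges over the same
  sets inside and outside the model. Bounded predicates can thus be written without reference to
  \<open>M\<close>.\<close>

lemma dfn_bex:
  assumes "dfn (\<lambda>M e. Q M (e 0) (\<lambda>n. e (Suc n)))"
  shows "dfn (\<lambda>M e. \<exists>x. mem x (e i) \<and> Q M x e)"
proof (rule dfn_cong)
  show "dfn (\<lambda>M e. \<exists>x\<in>M. mem x (e i) \<and> Q M x e)"
    by (intro dfn_ex dfn_conj dfn_mem assms)
  show "(\<exists>x\<in>M. mem x (s i) \<and> Q M x s) \<longleftrightarrow> (\<exists>x. mem x (s i) \<and> Q M x s)"
    if "zmodel M" "range s \<subseteq> M" for M s
    using zmodel_trans[OF that(1), of "s i"] that(2) by blast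
qed

lemma dfn_ball:
  assumes "dfn (\<lambda>M e. Q M (e 0) (\<lambda>n. e (Suc n)))"
  shows "dfn (\<lambda>M e. \<forall>x. mem x (e i) \<longrightarrow> Q M x e)"
  using dfn_not[OF dfn_bex[where Q = "\<lambda>M x e. \<not> Q M x e" and i = i, OF dfn_not[OF assms]]] by simp

lemmas dfn_intros = dfn_mem dfn_eq dfn_not dfn_conj dfn_disj dfn_imp dfn_iff dfn_ex dfn_all dfn_bex dfn_ball

text \<open>The form in which elementarity is applied below. It works because \<open>dfn\<close>
  supplies one formula that serves both \<open>M\<close> and \<open>N\<close>.\<close>

lemma dfn_elementary:
  assumes "dfn P" "zmodel M" "zmodel N" "elementary_embedding mem M N j" "range s \<subseteq> M"
  shows "P M s \<longleftrightarrow> P N (\<lambda>n. j (s n))"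
proof -
  obtain \<phi> where \<phi>: "\<And>M s. zmodel M \<Longrightarrow> range s \<subseteq> M \<Longrightarrow> sat mem M s \<phi> \<longleftrightarrow> P M s"
    using assms(1) unfolding dfn_def by blast
  have *: "range (j \<circ> s) \<subseteq> N" using assms by (auto simp: elementary_embedding_def)
  have "sat mem M s \<phi> \<longleftrightarrow> sat mem N (j \<circ> s) \<phi>"
    using assms(4,5) unfolding elementary_embedding_def by blast
  then show ?thesis using \<phi>[OF assms(2,5)] \<phi>[OF assms(3) *] by (simp add: comp_def)
qed

section \<open>The axioms of set theory in transitive models\<close>

lemma zmodel_axiom: "zmodel M \<Longrightarrow> \<phi> \<in> ZFC \<Longrightarrow> range s \<subseteq> M \<Longrightarrow> sat mem M s \<phi>"
  by (auto simp: zmodel_def models_def)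

lemma zmodel_nonempty: "zmodel M \<Longrightarrow> M \<noteq> {}"
  by (auto simp: zmodel_def models_def)

lemma separation:
  assumes M: "zmodel M" and P: "dfn P" and s: "range s \<subseteq> M" and a: "a \<in> M"
  obtains b where "b \<in> M" "\<And>x. mem x b \<longleftrightarrow> mem x a \<and> P M (case_nat x s)"
proof -
  \<comment> \<open>The parameters move to the variables from 5 on, clear of those that the axiom
    quantifies. The gap is filled in \<open>\<sigma>\<close> with \<open>a\<close>, merely to stay
    inside \<open>M\<close>.\<close>
  define \<rho> where "\<rho> n = (case n of 0 \<Rightarrow> 0 | Suc n \<Rightarrow> n + 5)" for n :: nat
  define \<sigma> where "\<sigma> n = (if n < 5 then a else s (n - 5))" for n
  obtain \<phi> where \<phi>: "fv \<phi> \<subseteq> range \<rho>"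
    "\<And>M s. zmodel M \<Longrightarrow> range s \<subseteq> M \<Longrightarrow> sat mem M s \<phi> \<longleftrightarrow> P M (\<lambda>n. s (\<rho> n))"
    using dfn_rename_formula[OF P, of \<rho>] by blast
  have "2 \<notin> range \<rho>" by (auto simp: \<rho>_def split: nat.splits)
  then have "separation_fm \<phi> \<in> ZFC" using \<phi>(1) by (auto simp: ZFC_def)
  moreover have \<sigma>: "range \<sigma> \<subseteq> M" using s a by (auto simp: \<sigma>_def)
  ultimately have "sat mem M \<sigma> (separation_fm \<phi>)" using zmodel_axiom M by blast
  then have "\<forall>a\<in>M. \<exists>b\<in>M. \<forall>x\<in>M. mem x b \<longleftrightarrow> mem x a \<and> sat mem M (\<sigma>(1 := a, 2 := b, 0 := x)) \<phi>"
    unfolding separation_fm_def sat_connectives sat.simps(1,2,4,5) iff_conv_conj_imp[symmetric]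
    by (simp only: sat_eval)
  from bspec[OF this a] obtain b where b: "b \<in> M"
    and b': "\<forall>x\<in>M. mem x b \<longleftrightarrow> mem x a \<and> sat mem M (\<sigma>(1 := a, 2 := b, 0 := x)) \<phi>" ..
  have "sat mem M (\<sigma>(1 := a, 2 := b, 0 := x)) \<phi> \<longleftrightarrow> P M (case_nat x s)" if "x \<in> M" for x
  proof -
    have "range (\<sigma>(1 := a, 2 := b, 0 := x)) \<subseteq> M" using \<sigma> a b that by auto
    moreover have "(\<lambda>n. (\<sigma>(1 := a, 2 := b, 0 := x)) (\<rho> n)) = case_nat x s"
      by (auto simp: \<rho>_def \<sigma>_def fun_eq_iff split: nat.splits)
    ultimately show ?thesis using \<phi>(2)[OF M] by simp
  qed
  then have "mem x b \<longleftrightarrow> mem x a \<and> P M (case_nat x s)" for x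
    using bspec[OF b', of x] zmodel_trans[OF M a, of x] zmodel_trans[OF M b, of x] by blast
  then show ?thesis using that b by blast
qed

lemma replacement:
  assumes M: "zmodel M" and P: "dfn P" and s: "range s \<subseteq> M" and a: "a \<in> M"
    and fn: "\<And>x. mem x a \<Longrightarrow> \<exists>!y. y \<in> M \<and> P M (case_nat x (case_nat y s))"
  obtains b where "b \<in> M"
    "\<And>y. mem y b \<longleftrightarrow> y \<in> M \<and> (\<exists>x. mem x a \<and> P M (case_nat x (case_nat y s)))"
proof -
  \<comment> \<open>The schema reads argument and value in the variables 0 and 3, so positions 0 and
    1 go there; the parameters again move to 5 and beyond.\<close>
  define \<rho> where "\<rho> n = (case n of 0 \<Rightarrow> 0 | Suc n \<Rightarrow> (case n of 0 \<Rightarrow> 3 | Suc n \<Rightarrow> n + 5))" for n :: nat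
  define \<sigma> where "\<sigma> n = (if n < 5 then a else s (n - 5))" for n
  obtain \<phi> where \<phi>: "fv \<phi> \<subseteq> range \<rho>"
    "\<And>M s. zmodel M \<Longrightarrow> range s \<subseteq> M \<Longrightarrow> sat mem M s \<phi> \<longleftrightarrow> P M (\<lambda>n. s (\<rho> n))"
    using dfn_rename_formula[OF P, of \<rho>] by blast
  have "2 \<notin> range \<rho>" "4 \<notin> range \<rho>" by (auto simp: \<rho>_def split: nat.splits)
  then have "replacement_fm \<phi> \<in> ZFC" using \<phi>(1) by (auto simp: ZFC_def)
  moreover have \<sigma>: "range \<sigma> \<subseteq> M" using s a by (auto simp: \<sigma>_def)
  ultimately have ax: "sat mem M \<sigma> (replacement_fm \<phi>)" using zmodel_axiom M by blast
  have eq: "sat mem M t \<phi> \<longleftrightarrow> P M (case_nat x (case_nat y s))"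
    if "range t \<subseteq> M" "t 0 = x" "t 3 = y" "\<And>n. t (n + 5) = s n" for x y t
  proof -
    have "(\<lambda>n. t (\<rho> n)) = case_nat x (case_nat y s)"
      using that by (auto simp: \<rho>_def fun_eq_iff split: nat.splits)
    then show ?thesis using \<phi>(2)[OF M that(1)] by simp
  qed
  have \<sigma>5: "\<sigma> (n + 5) = s n" for n by (simp add: \<sigma>_def)
  have fun_ok: "\<exists>z\<in>M. \<forall>y\<in>M. sat mem M (\<sigma>(1 := a, 0 := x, 4 := z, 3 := y)) \<phi> \<longleftrightarrow> y = z"
    if x: "mem x a" for x
  proof -
    obtain z where z: "z \<in> M" "\<And>y. y \<in> M \<Longrightarrow> P M (case_nat x (case_nat y s)) \<longleftrightarrow> y = z"
      using fn[OF x] by blast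
    have "x \<in> M" using zmodel_trans[OF M a x] .
    have "sat mem M (\<sigma>(1 := a, 0 := x, 4 := z, 3 := y)) \<phi> \<longleftrightarrow> P M (case_nat x (case_nat y s))" if "y \<in> M" for y
      by (rule eq) (use \<sigma> \<sigma>5 a z that \<open>x \<in> M\<close> in auto)
    then show ?thesis using z by blast
  qed
  have "\<forall>a\<in>M. (\<forall>x\<in>M. mem x a \<longrightarrow>
        (\<exists>z\<in>M. \<forall>y\<in>M. sat mem M (\<sigma>(1 := a, 0 := x, 4 := z, 3 := y)) \<phi> \<longleftrightarrow> y = z)) \<longrightarrow>
      (\<exists>b\<in>M. \<forall>y\<in>M. mem y b \<longleftrightarrow>
        (\<exists>x\<in>M. mem x a \<and> sat mem M (\<sigma>(1 := a, 2 := b, 3 := y, 0 := x)) \<phi>))"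
    using ax
    unfolding replacement_fm_def sat_connectives sat.simps(1,2,4,5) iff_conv_conj_imp[symmetric]
    by (simp only: sat_eval)
  from bspec[OF this a] have "\<exists>b\<in>M. \<forall>y\<in>M. mem y b \<longleftrightarrow>
      (\<exists>x\<in>M. mem x a \<and> sat mem M (\<sigma>(1 := a, 2 := b, 3 := y, 0 := x)) \<phi>)"
    by (rule mp) (use fun_ok in blast)
  then obtain b where b: "b \<in> M" and b': "\<forall>y\<in>M. mem y b \<longleftrightarrow>
      (\<exists>x\<in>M. mem x a \<and> sat mem M (\<sigma>(1 := a, 2 := b, 3 := y, 0 := x)) \<phi>)" ..
  have "sat mem M (\<sigma>(1 := a, 2 := b, 3 := y, 0 := x)) \<phi> \<longleftrightarrow> P M (case_nat x (case_nat y s))"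
    if "x \<in> M" "y \<in> M" for x y
    by (rule eq) (use \<sigma> \<sigma>5 a b that in auto)
  then have "mem y b \<longleftrightarrow> y \<in> M \<and> (\<exists>x. mem x a \<and> P M (case_nat x (case_nat y s)))" for y
    using b' zmodel_trans[OF M b, of y] zmodel_trans[OF M a] by blast
  then show ?thesis using that b by blast
qed

lemma pairing:
  assumes M: "zmodel M" and a: "a \<in> M" and b: "b \<in> M"
  shows "\<exists>c\<in>M. \<forall>x. mem x c \<longleftrightarrow> x = a \<or> x = b"
proof -
  have "sat mem M (\<lambda>_. a) pairing_fm" using assms by (intro zmodel_axiom) (auto simp: ZFC_def)
  then have "\<forall>a\<in>M. \<forall>b\<in>M. \<exists>c\<in>M. \<forall>x\<in>M. mem x c \<longleftrightarrow> (x \<noteq> a \<longrightarrow> x = b)"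
    unfolding pairing_fm_def sat_connectives sat.simps(1,2,4,5) iff_conv_conj_imp[symmetric]
    by (simp only: sat.simps sat_eval)
  from bspec[OF bspec[OF this a] b] show ?thesis
    using zmodel_trans[OF M] a b by metis
qed

lemma union:
  assumes M: "zmodel M" and a: "a \<in> M"
  shows "\<exists>c\<in>M. \<forall>x. mem x c \<longleftrightarrow> (\<exists>y. mem x y \<and> mem y a)"
proof -
  have "sat mem M (\<lambda>_. a) union_fm" using assms by (intro zmodel_axiom) (auto simp: ZFC_def)
  then have "\<forall>a\<in>M. \<exists>c\<in>M. \<forall>x\<in>M. mem x c \<longleftrightarrow> (\<exists>y\<in>M. mem y a \<and> mem x y)"
    unfolding union_fm_def sat_connectives sat.simps(1,2,4,5) iff_conv_conj_imp[symmetric]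
    by (simp only: sat_eval)
  from bspec[OF this a] show ?thesis
    using zmodel_trans[OF M] a by metis
qed

lemma powerset:
  assumes M: "zmodel M" and a: "a \<in> M"
  shows "\<exists>c\<in>M. \<forall>x. mem x c \<longleftrightarrow> x \<in> M \<and> (\<forall>y. mem y x \<longrightarrow> mem y a)"
proof -
  have "sat mem M (\<lambda>_. a) powerset_fm" using assms by (intro zmodel_axiom) (auto simp: ZFC_def)
  then have "\<forall>a\<in>M. \<exists>c\<in>M. \<forall>x\<in>M. mem x c \<longleftrightarrow> (\<forall>y\<in>M. mem y x \<longrightarrow> mem y a)"
    unfolding powerset_fm_def sat_connectives sat.simps(1,2,4,5) iff_conv_conj_imp[symmetric]
    by (simp only: sat_eval)
  from bspec[OF this a] show ?thesis
    using zmodel_trans[OF M] by metis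
qed

text \<open>The required set is the union of {a, {b}}.\<close>

lemma insertion:
  assumes M: "zmodel M" and a: "a \<in> M" and b: "b \<in> M"
  shows "\<exists>c\<in>M. \<forall>x. mem x c \<longleftrightarrow> mem x a \<or> x = b"
proof -
  obtain d where d: "d \<in> M" "\<And>x. mem x d \<longleftrightarrow> x = b" using pairing[OF M b b] by auto
  obtain e where e: "e \<in> M" "\<And>x. mem x e \<longleftrightarrow> x = a \<or> x = d" using pairing[OF M a d(1)] by auto
  obtain c where "c \<in> M" "\<And>x. mem x c \<longleftrightarrow> (\<exists>y. mem x y \<and> mem y e)" using union[OF M e(1)] by auto
  then show ?thesis using d e by metis
qed

lemma transversal:
  assumes M: "zmodel M" and a: "a \<in> M"
    and ne: "\<And>x. mem x a \<Longrightarrow> \<exists>y. mem y x"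
    and disj: "\<And>x y z. mem x a \<Longrightarrow> mem y a \<Longrightarrow> mem z x \<Longrightarrow> mem z y \<Longrightarrow> x = y"
  obtains c where "c \<in> M" "\<And>x. mem x a \<Longrightarrow> \<exists>!y. mem y x \<and> mem y c"
proof -
  have "sat mem M (\<lambda>_. a) choice_fm" using assms by (intro zmodel_axiom) (auto simp: ZFC_def)
  then have ax: "\<forall>a\<in>M. (\<forall>x\<in>M. mem x a \<longrightarrow> (\<exists>y\<in>M. mem y x)) \<and>
      (\<forall>x\<in>M. \<forall>y\<in>M. (mem x a \<and> mem y a) \<and> x \<noteq> y \<longrightarrow> (\<forall>z\<in>M. \<not> (mem z x \<and> mem z y))) \<longrightarrow>
      (\<exists>c\<in>M. \<forall>x\<in>M. mem x a \<longrightarrow> (\<exists>y\<in>M. \<forall>z\<in>M. mem z x \<and> mem z c \<longleftrightarrow> z = y))"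
    unfolding choice_fm_def sat_connectives sat.simps(1,2,4,5) iff_conv_conj_imp[symmetric]
    by (simp only: sat.simps(3) sat_connectives(3) sat.simps(1,2,4,5) sat_eval)
  have "\<forall>x\<in>M. mem x a \<longrightarrow> (\<exists>y\<in>M. mem y x)" using ne zmodel_trans[OF M] by blast
  moreover have "\<forall>x\<in>M. \<forall>y\<in>M. (mem x a \<and> mem y a) \<and> x \<noteq> y \<longrightarrow> (\<forall>z\<in>M. \<not> (mem z x \<and> mem z y))"
    using disj by blast
  ultimately have "\<exists>c\<in>M. \<forall>x\<in>M. mem x a \<longrightarrow> (\<exists>y\<in>M. \<forall>z\<in>M. mem z x \<and> mem z c \<longleftrightarrow> z = y)"
    using bspec[OF ax a] by (simp only: simp_thms)
  then obtain c where c: "c \<in> M" "\<forall>x\<in>M. mem x a \<longrightarrow> (\<exists>y\<in>M. \<forall>z\<in>M. mem z x \<and> mem z c \<longleftrightarrow> z = y)" ..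
  have "\<exists>!y. mem y x \<and> mem y c" if x: "mem x a" for x
  proof -
    have "x \<in> M" using zmodel_trans[OF M a x] .
    then obtain y where "y \<in> M" "\<forall>z\<in>M. mem z x \<and> mem z c \<longleftrightarrow> z = y" using c x by blast
    then show ?thesis using zmodel_trans[OF M \<open>x \<in> M\<close>] by metis
  qed
  then show ?thesis using that c by blast
qed

end

section \<open>Ordinals and recursion in transitive models\<close>

context set_univ
begin

lemma separation_ex:
  assumes "zmodel M" "dfn P" "range s \<subseteq> M" "a \<in> M" "\<And>x. Q x \<longleftrightarrow> P M (case_nat x s)"
  shows "\<exists>b\<in>M. \<forall>x. mem x b \<longleftrightarrow> mem x a \<and> Q x"
  unfolding assms(5) by (rule separation[OF assms(1-4)]) auto

lemma replacement_ex:
  assumes "zmodel M" "dfn P" "range s \<subseteq> M" "a \<in> M"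
    "\<And>x y. Q x y \<longleftrightarrow> P M (case_nat x (case_nat y s))"
    "\<And>x. mem x a \<Longrightarrow> \<exists>!y. y \<in> M \<and> Q x y"
  shows "\<exists>b\<in>M. \<forall>y. mem y b \<longleftrightarrow> y \<in> M \<and> (\<exists>x. mem x a \<and> Q x y)"
  unfolding assms(5)
  by (rule replacement[OF assms(1-4)]) (use assms(6) in \<open>auto simp only: assms(5)\<close>)

text \<open>In this form only bounded quantifiers occur, so being an ordinal is definable over
  transitive models and means the same in each of them.\<close>

lemma ordinals_iff:
  "x \<in> ordinals mem \<longleftrightarrow> (\<forall>y. mem y x \<longrightarrow> (\<forall>z. mem z y \<longrightarrow> mem z x)) \<and>
     (\<forall>y. mem y x \<longrightarrow> (\<forall>z. mem z y \<longrightarrow> (\<forall>w. mem w z \<longrightarrow> mem w y)))"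
  unfolding ordinals_def transitive_set_def by auto

lemma ordinal_trans: "x \<in> ordinals mem \<Longrightarrow> mem y x \<Longrightarrow> mem z y \<Longrightarrow> mem z x"
  unfolding ordinals_iff by blast

lemma ordinal_mem: "x \<in> ordinals mem \<Longrightarrow> mem y x \<Longrightarrow> y \<in> ordinals mem"
  unfolding ordinals_iff by blast

lemma ordinalI:
  "(\<And>y. mem y x \<Longrightarrow> y \<in> ordinals mem) \<Longrightarrow> (\<And>y z. mem y x \<Longrightarrow> mem z y \<Longrightarrow> mem z x) \<Longrightarrow>
    x \<in> ordinals mem"
  unfolding ordinals_iff by blast

text \<open>Double induction: if \<open>x\<close> and \<open>y\<close> were incomparable, the two
  induction hypotheses would put each element of \<open>x\<close> into \<open>y\<close> and
  conversely, and extensionality would identify them.\<close>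

lemma ordinal_trichotomy:
  "x \<in> ordinals mem \<Longrightarrow> y \<in> ordinals mem \<Longrightarrow> mem x y \<or> x = y \<or> mem y x"
proof (induction x arbitrary: y rule: mem_induct)
  case (1 x)
  note IHx = 1
  from \<open>y \<in> ordinals mem\<close> show ?case
  proof (induction y rule: mem_induct)
    case (1 y)
    note IHy = 1
    show ?case
    proof (rule ccontr)
      assume neg: "\<not> ?thesis"
      have "mem u y" if u: "mem u x" for u
        using IHx(1)[OF u ordinal_mem[OF IHx(2) u] IHy(2)] neg u ordinal_trans[OF IHx(2) u] by blast
      moreover have "mem u x" if u: "mem u y" for u
        using IHy(1)[OF u ordinal_mem[OF IHy(2) u]] neg u ordinal_trans[OF IHy(2) u] by blast
      ultimately have "x = y" using mem_ext by blast
      then show False using neg by blast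
    qed
  qed
qed

lemma dfn_ordinal: "dfn (\<lambda>M e. e i \<in> ordinals mem)"
  unfolding ordinals_iff by (intro dfn_intros)

lemma ordinal_succ:
  assumes M: "zmodel M" and a: "a \<in> M" "a \<in> ordinals mem"
  shows "\<exists>b\<in>M. b \<in> ordinals mem \<and> (\<forall>x. mem x b \<longleftrightarrow> mem x a \<or> x = a)"
proof -
  from insertion[OF M a(1) a(1)] obtain b where b: "b \<in> M" "\<forall>x. mem x b \<longleftrightarrow> mem x a \<or> x = a" ..
  have "b \<in> ordinals mem"
  proof (rule ordinalI)
    show "y \<in> ordinals mem" if "mem y b" for y
      using b(2) a(2) ordinal_mem[OF a(2), of y] that by metis
    show "mem z b" if "mem y b" "mem z y" for y z
      using b(2) ordinal_trans[OF a(2), of y z] that by metis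
  qed
  then show ?thesis using b by blast
qed

section \<open>Ordered pairs, and recursion along the ordinals of a model\<close>

definition is_pair :: "'v \<Rightarrow> 'v \<Rightarrow> 'v \<Rightarrow> bool" where
  "is_pair p x y \<longleftrightarrow> (\<exists>u. mem u p \<and> (\<exists>v. mem v p \<and> (\<forall>w. mem w p \<longrightarrow> w = u \<or> w = v) \<and>
     mem x u \<and> (\<forall>w. mem w u \<longrightarrow> w = x) \<and> mem x v \<and> mem y v \<and> (\<forall>w. mem w v \<longrightarrow> w = x \<or> w = y)))"

text \<open>The Kuratowski pair {{x}, {x, y}} is described with bounded quantifiers only,
  \<open>u\<close> and \<open>v\<close> being its two elements, so the description is
  absolute.\<close>

lemma dfn_is_pair: "dfn (\<lambda>M e. is_pair (e i) (e j) (e k))"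
  unfolding is_pair_def by (intro dfn_intros)

lemma is_pair_inject: "is_pair p x y \<Longrightarrow> is_pair p x' y' \<Longrightarrow> x = x' \<and> y = y'"
  unfolding is_pair_def by metis

lemma is_pair_unique: assumes "is_pair p x y" "is_pair q x y" shows "p = q"
proof -
  obtain u v where p: "mem u p" "mem v p" "\<forall>w. mem w p \<longrightarrow> w = u \<or> w = v"
    "mem x u" "\<forall>w. mem w u \<longrightarrow> w = x" "mem x v" "mem y v" "\<forall>w. mem w v \<longrightarrow> w = x \<or> w = y"
    using assms(1) unfolding is_pair_def by blast
  obtain u' v' where q: "mem u' q" "mem v' q" "\<forall>w. mem w q \<longrightarrow> w = u' \<or> w = v'"
    "mem x u'" "\<forall>w. mem w u' \<longrightarrow> w = x" "mem x v'" "mem y v'" "\<forall>w. mem w v' \<longrightarrow> w = x \<or> w = y"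
    using assms(2) unfolding is_pair_def by blast
  have "u = u'" by (rule mem_ext) (use p q in blast)
  moreover have "v = v'" by (rule mem_ext) (use p q in blast)
  ultimately show ?thesis using p q by (intro mem_ext) blast
qed

lemma is_pair_in_model: "zmodel M \<Longrightarrow> p \<in> M \<Longrightarrow> is_pair p x y \<Longrightarrow> x \<in> M \<and> y \<in> M"
  unfolding is_pair_def by (meson zmodel_trans)

lemma is_pair_ex:
  assumes M: "zmodel M" and x: "x \<in> M" and y: "y \<in> M"
  shows "\<exists>p\<in>M. is_pair p x y"
proof -
  from pairing[OF M x x] obtain u where u: "u \<in> M" "\<forall>w. mem w u \<longleftrightarrow> w = x \<or> w = x" ..
  from pairing[OF M x y] obtain v where v: "v \<in> M" "\<forall>w. mem w v \<longleftrightarrow> w = x \<or> w = y" ..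
  from pairing[OF M u(1) v(1)] obtain p where p: "p \<in> M" "\<forall>w. mem w p \<longleftrightarrow> w = u \<or> w = v" ..
  have "is_pair p x y"
    unfolding is_pair_def
    by (rule exI[of _ u], rule conjI, use p in blast, rule exI[of _ v]) (use u v p in blast)
  then show ?thesis using p by blast
qed

definition in_rel :: "'v \<Rightarrow> 'v \<Rightarrow> 'v \<Rightarrow> bool" where
  "in_rel f x y \<longleftrightarrow> (\<exists>p. mem p f \<and> is_pair p x y)"

lemma dfn_in_rel: "dfn (\<lambda>M e. in_rel (e i) (e j) (e k))"
  unfolding in_rel_def by (intro dfn_intros dfn_is_pair)

lemma in_rel_in_model: "zmodel M \<Longrightarrow> f \<in> M \<Longrightarrow> in_rel f x y \<Longrightarrow> x \<in> M \<and> y \<in> M"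
  unfolding in_rel_def by (meson zmodel_trans is_pair_in_model)

text \<open>Recursion \<open>F(b) = H(F[b])\<close> along an ordinal, where \<open>h\<close> is the graph of \<open>H\<close> and the
  environment \<open>s\<close> holds parameters; \<open>f\<close> is a partial solution.\<close>

definition approx :: "('v set \<Rightarrow> (nat \<Rightarrow> 'v) \<Rightarrow> 'v \<Rightarrow> 'v \<Rightarrow> bool) \<Rightarrow> 'v set \<Rightarrow> (nat \<Rightarrow> 'v) \<Rightarrow> 'v \<Rightarrow> bool" where
  "approx h M s f \<longleftrightarrow> (\<forall>c\<in>M. \<forall>z\<in>M. in_rel f c z \<longrightarrow>
     (\<forall>d. mem d c \<longrightarrow> (\<exists>v\<in>M. in_rel f d v)) \<and>
     (\<exists>w\<in>M. (\<forall>v\<in>M. mem v w \<longleftrightarrow> (\<exists>d. mem d c \<and> in_rel f d v)) \<and> h M s w z))"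

definition recfun :: "('v set \<Rightarrow> (nat \<Rightarrow> 'v) \<Rightarrow> 'v \<Rightarrow> 'v \<Rightarrow> bool) \<Rightarrow> 'v set \<Rightarrow> (nat \<Rightarrow> 'v) \<Rightarrow> 'v \<Rightarrow> 'v \<Rightarrow> bool" where
  "recfun h M s b y \<longleftrightarrow> (\<exists>f\<in>M. approx h M s f \<and> in_rel f b y)"

text \<open>The step predicate is given in a fixed layout, with argument and value in positions 0
  and 1 before the parameters. Under the quantifiers of \<open>approx\<close> these sit elsewhere,
  so the layout has to be moved.\<close>

lemma dfn_step_rename:
  assumes "dfn (\<lambda>M e. h M (\<lambda>n. e (Suc (Suc n))) (e 0) (e (Suc 0)))"
  shows "dfn (\<lambda>M e. h M (\<lambda>n. e (\<rho> n)) (e i) (e j))"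
  using dfn_rename[OF assms, of "case_nat i (case_nat j \<rho>)"] by simp

lemma dfn_recfun:
  assumes "dfn (\<lambda>M e. h M (\<lambda>n. e (Suc (Suc n))) (e 0) (e (Suc 0)))"
  shows "dfn (\<lambda>M e. recfun h M (\<lambda>n. e (\<rho> n)) (e i) (e j))"
  unfolding recfun_def approx_def by (intro dfn_intros dfn_in_rel dfn_step_rename[where h = h, OF assms])

context
  fixes h :: "'v set \<Rightarrow> (nat \<Rightarrow> 'v) \<Rightarrow> 'v \<Rightarrow> 'v \<Rightarrow> bool" and M s
  assumes h: "dfn (\<lambda>M e. h M (\<lambda>n. e (Suc (Suc n))) (e 0) (e (Suc 0)))"
    and M: "zmodel M" and s: "range s \<subseteq> M"
    and functional: "\<And>w. w \<in> M \<Longrightarrow> \<exists>!z. z \<in> M \<and> h M s w z"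
begin

text \<open>Everything that \<open>f\<close> relates already lies in \<open>M\<close>, so the
  relativized clauses of \<open>approx\<close> become absolute ones.\<close>

lemma approxD:
  assumes f: "approx h M s f" "f \<in> M" "in_rel f c z"
  shows "mem d c \<Longrightarrow> \<exists>v. in_rel f d v"
    and "\<exists>w\<in>M. (\<forall>v. mem v w \<longleftrightarrow> (\<exists>d. mem d c \<and> in_rel f d v)) \<and> h M s w z"
proof -
  have in_M: "c \<in> M" "z \<in> M" using in_rel_in_model[OF M f(2,3)] by auto
  note * = f(1)[unfolded approx_def, rule_format, OF in_M f(3)]
  show "\<exists>v. in_rel f d v" if "mem d c" using conjunct1[OF *] that by blast
  from conjunct2[OF *] obtain w where w: "w \<in> M"
    "\<forall>v\<in>M. mem v w \<longleftrightarrow> (\<exists>d. mem d c \<and> in_rel f d v)" "h M s w z" by auto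
  have "mem v w \<longleftrightarrow> (\<exists>d. mem d c \<and> in_rel f d v)" for v
    using bspec[OF w(2), of v] zmodel_trans[OF M w(1), of v] in_rel_in_model[OF M f(2), of _ v] by blast
  then show "\<exists>w\<in>M. (\<forall>v. mem v w \<longleftrightarrow> (\<exists>d. mem d c \<and> in_rel f d v)) \<and> h M s w z"
    using w by blast
qed

text \<open>By induction both partial solutions agree below \<open>c\<close>; hence they feed the
  same set to the step, which is functional.\<close>

lemma approx_unique:
  assumes f: "f \<in> M" "approx h M s f" and g: "g \<in> M" "approx h M s g"
  shows "in_rel f c y \<Longrightarrow> in_rel g c z \<Longrightarrow> y = z"
proof (induction c arbitrary: y z rule: mem_induct)
  case (1 c)
  have in_M: "c \<in> M" "y \<in> M" "z \<in> M"
    using in_rel_in_model[OF M f(1) 1(2)] in_rel_in_model[OF M g(1) 1(3)] by auto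
  note F = approxD[OF f(2,1) 1(2)] and G = approxD[OF g(2,1) 1(3)]
  from F(2) obtain w where w: "w \<in> M" "\<forall>v. mem v w \<longleftrightarrow> (\<exists>d. mem d c \<and> in_rel f d v)" "h M s w y"
    by auto
  from G(2) obtain x where x: "x \<in> M" "\<forall>v. mem v x \<longleftrightarrow> (\<exists>d. mem d c \<and> in_rel g d v)" "h M s x z"
    by auto
  have "in_rel f d v \<longleftrightarrow> in_rel g d v" if d: "mem d c" for d v
  proof -
    from F(1)[OF d] obtain a where "in_rel f d a" ..
    moreover from G(1)[OF d] obtain b where "in_rel g d b" ..
    ultimately show ?thesis using 1(1)[OF d] by blast
  qed
  then have "mem v w \<longleftrightarrow> mem v x" for v
    unfolding w(2)[rule_format] x(2)[rule_format] by blast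
  then have "w = x" by (rule mem_ext)
  then show "y = z" using functional[OF w(1)] w(3) x(3) in_M by blast
qed

lemma recfun_unique: "recfun h M s b y \<Longrightarrow> recfun h M s b z \<Longrightarrow> y = z"
  unfolding recfun_def using approx_unique by blast

lemma recfun_in_model: "recfun h M s b y \<Longrightarrow> b \<in> M \<and> y \<in> M"
  unfolding recfun_def using in_rel_in_model[OF M] by blast

lemma recfun_eq:
  assumes "recfun h M s b y"
  shows "\<exists>w\<in>M. (\<forall>v. mem v w \<longleftrightarrow> (\<exists>d. mem d b \<and> recfun h M s d v)) \<and> h M s w y"
proof -
  from assms obtain f where f: "f \<in> M" "approx h M s f" "in_rel f b y"
    unfolding recfun_def by blast
  from approxD(2)[OF f(2,1,3)] obtain w where w: "w \<in> M"
    "\<forall>v. mem v w \<longleftrightarrow> (\<exists>d. mem d b \<and> in_rel f d v)" "h M s w y"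
    by auto
  have "in_rel f d v \<longleftrightarrow> recfun h M s d v" if d: "mem d b" for d v
  proof -
    from approxD(1)[OF f(2,1,3) d] obtain a where a: "in_rel f d a" ..
    then have "recfun h M s d a" unfolding recfun_def using f by blast
    then show ?thesis using a recfun_unique approx_unique[OF f(1,2) f(1,2)] by blast
  qed
  then have "mem v w \<longleftrightarrow> (\<exists>d. mem d b \<and> recfun h M s d v)" for v
    unfolding w(2)[rule_format] by blast
  then show ?thesis using w by blast
qed

text \<open>Replacement makes the solution below \<open>b\<close> a set of pairs \<open>U\<close>
  and its values a set \<open>W\<close>. The step applied to \<open>W\<close> gives the value at
  \<open>b\<close>, and adjoining one pair to \<open>U\<close> yields an approximation defined at
  \<open>b\<close>.\<close>

lemma recfun_ex: "b \<in> M \<Longrightarrow> b \<in> ordinals mem \<Longrightarrow> \<exists>y. recfun h M s b y"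
proof (induction b rule: mem_induct)
  case (1 b)
  have ex: "\<exists>y. recfun h M s c y" if "mem c b" for c
    using 1(1)[OF that] zmodel_trans[OF M 1(2) that] ordinal_mem[OF 1(3) that] by blast
  have D: "dfn (\<lambda>M e. \<exists>z\<in>M. recfun h M (\<lambda>n. e (Suc (Suc n))) (e 0) z \<and> is_pair (e (Suc 0)) (e 0) z)"
    by (intro dfn_intros dfn_recfun[where h = h, OF h] dfn_is_pair)
  have "\<exists>U\<in>M. \<forall>p. mem p U \<longleftrightarrow> p \<in> M \<and> (\<exists>c. mem c b \<and> (\<exists>z\<in>M. recfun h M s c z \<and> is_pair p c z))"
  proof (rule replacement_ex[OF M D s 1(2)], simp)
    fix c assume c: "mem c b"
    from ex[OF c] obtain y where y: "recfun h M s c y" ..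
    obtain p where "p \<in> M" "is_pair p c y"
      using is_pair_ex[OF M, of c y] recfun_in_model[OF y] by blast
    then show "\<exists>!p. p \<in> M \<and> (\<exists>z\<in>M. recfun h M s c z \<and> is_pair p c z)"
      using y recfun_in_model[OF y] recfun_unique[OF y] is_pair_unique by blast
  qed
  then obtain U where U: "U \<in> M"
    "\<And>p. mem p U \<longleftrightarrow> p \<in> M \<and> (\<exists>c. mem c b \<and> (\<exists>z\<in>M. recfun h M s c z \<and> is_pair p c z))"
    by auto
  have D: "dfn (\<lambda>M e. recfun h M (\<lambda>n. e (Suc (Suc n))) (e 0) (e (Suc 0)))"
    by (intro dfn_recfun[where h = h, OF h])
  have "\<exists>W\<in>M. \<forall>z. mem z W \<longleftrightarrow> z \<in> M \<and> (\<exists>c. mem c b \<and> recfun h M s c z)"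
  proof (rule replacement_ex[OF M D s 1(2)], simp)
    fix c assume "mem c b"
    from ex[OF this] obtain y where "recfun h M s c y" ..
    then show "\<exists>!z. z \<in> M \<and> recfun h M s c z"
      using recfun_in_model recfun_unique by blast
  qed
  then obtain W where W: "W \<in> M" "\<And>z. mem z W \<longleftrightarrow> z \<in> M \<and> (\<exists>c. mem c b \<and> recfun h M s c z)"
    by auto
  obtain y where y: "y \<in> M" "h M s W y" using functional[OF W(1)] by blast
  from is_pair_ex[OF M 1(2) y(1)] obtain p where p: "p \<in> M" "is_pair p b y" ..
  from insertion[OF M U(1) p(1)] obtain f where f: "f \<in> M" "\<forall>x. mem x f \<longleftrightarrow> mem x U \<or> x = p" ..
  have rel: "in_rel f c z \<longleftrightarrow> (mem c b \<and> recfun h M s c z) \<or> (c = b \<and> z = y)" for c z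
  proof
    assume "in_rel f c z"
    then show "(mem c b \<and> recfun h M s c z) \<or> (c = b \<and> z = y)"
      unfolding in_rel_def using f(2) U(2) is_pair_inject p(2) by metis
  next
    assume "(mem c b \<and> recfun h M s c z) \<or> (c = b \<and> z = y)"
    then show "in_rel f c z"
    proof
      assume *: "mem c b \<and> recfun h M s c z"
      then obtain q where "q \<in> M" "is_pair q c z"
        using is_pair_ex[OF M] recfun_in_model by blast
      then show ?thesis
        using * U(2) f(2) recfun_in_model unfolding in_rel_def by blast
    next
      assume "c = b \<and> z = y"
      then show ?thesis using p(2) f(2) unfolding in_rel_def by blast
    qed
  qed
  have below: "in_rel f d v \<longleftrightarrow> recfun h M s d v" if "mem d b" for d v
    using rel that mem_irrefl by blast
  have "approx h M s f"
    unfolding approx_def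
  proof (intro ballI impI conjI allI)
    fix c z d assume "in_rel f c z" "mem d c"
    then have "mem d b" using rel ordinal_trans[OF 1(3)] by blast
    then show "\<exists>v\<in>M. in_rel f d v" using below ex recfun_in_model by blast
  next
    fix c z assume "in_rel f c z"
    then consider "mem c b" "recfun h M s c z" | "c = b" "z = y" using rel by blast
    then show "\<exists>w\<in>M. (\<forall>v\<in>M. mem v w \<longleftrightarrow> (\<exists>d. mem d c \<and> in_rel f d v)) \<and> h M s w z"
    proof cases
      case 1
      from recfun_eq[OF 1(2)] obtain w where w: "w \<in> M"
        "\<forall>v. mem v w \<longleftrightarrow> (\<exists>d. mem d c \<and> recfun h M s d v)" "h M s w z" by blast
      have "mem d b" if "mem d c" for d using ordinal_trans[OF \<open>b \<in> ordinals mem\<close> 1(1) that] .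
      then have "\<forall>v\<in>M. mem v w \<longleftrightarrow> (\<exists>d. mem d c \<and> in_rel f d v)" using w(2) below by blast
      then show ?thesis using w by blast
    next
      case 2
      then show ?thesis using W y below by blast
    qed
  qed
  then have "recfun h M s b y" unfolding recfun_def using f(1) rel by blast
  then show ?case ..
qed

end

end

section \<open>Embeddings that fix the ordinals\<close>

context set_univ
begin

section \<open>The cumulative hierarchy of a model\<close>

definition level_step :: "'v set \<Rightarrow> (nat \<Rightarrow> 'v) \<Rightarrow> 'v \<Rightarrow> 'v \<Rightarrow> bool" where
  "level_step M s w z \<longleftrightarrow> (\<forall>t\<in>M. mem t z \<longleftrightarrow> (\<exists>v. mem v w \<and> (\<forall>u. mem u t \<longrightarrow> mem u v)))"

lemma dfn_level_step: "dfn (\<lambda>M e. level_step M (\<lambda>n. e (Suc (Suc n))) (e 0) (e (Suc 0)))"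
  unfolding level_step_def by (intro dfn_intros)

text \<open>The value is the union of the power sets of the members of \<open>w\<close>, cut out of
  the power set of their union. Iterated along the ordinals, it produces the levels V_b as computed
  in the model.\<close>

lemma level_step_functional:
  assumes M: "zmodel M" and w: "w \<in> M"
  shows "\<exists>!z. z \<in> M \<and> level_step M s w z"
proof -
  from union[OF M w] obtain U where U: "U \<in> M" "\<forall>x. mem x U \<longleftrightarrow> (\<exists>y. mem x y \<and> mem y w)" ..
  from powerset[OF M U(1)] obtain P where P: "P \<in> M"
    "\<forall>x. mem x P \<longleftrightarrow> x \<in> M \<and> (\<forall>y. mem y x \<longrightarrow> mem y U)" ..
  have D: "dfn (\<lambda>M e. \<exists>v. mem v (e (Suc 0)) \<and> (\<forall>u. mem u (e 0) \<longrightarrow> mem u v))"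
    by (intro dfn_intros)
  have "range (\<lambda>_ :: nat. w) \<subseteq> M" using w by auto
  from separation[OF M D this P(1)]
  obtain z where z: "z \<in> M" "\<And>x. mem x z \<longleftrightarrow> mem x P \<and> (\<exists>v. mem v w \<and> (\<forall>u. mem u x \<longrightarrow> mem u v))"
    by auto
  have "level_step M s w z"
    unfolding level_step_def z(2) P(2)[rule_format] U(2)[rule_format] by blast
  moreover have "y = z" if "y \<in> M" "level_step M s w y" for y
  proof (rule mem_ext)
    fix t show "mem t y \<longleftrightarrow> mem t z"
      using zmodel_trans[OF M that(1), of t] zmodel_trans[OF M z(1), of t]
        that(2) \<open>level_step M s w z\<close> unfolding level_step_def by metis
  qed
  ultimately show ?thesis using z(1) by blast
qed

text \<open>The step ignores its environment, so \<open>undefined\<close> does no harm. By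
  \<open>level_env\<close> it may be exchanged for an environment inside \<open>M\<close>, which the
  recursion lemmas demand.\<close>

definition level :: "'v set \<Rightarrow> 'v \<Rightarrow> 'v \<Rightarrow> bool" where
  "level M b y \<longleftrightarrow> recfun level_step M undefined b y"

lemma level_env: "recfun level_step M s b y \<longleftrightarrow> level M b y"
  unfolding level_def recfun_def approx_def level_step_def by (rule refl)

lemma dfn_level: "dfn (\<lambda>M e. level M (e i) (e j))"
  using dfn_recfun[where h = level_step, OF dfn_level_step, of "\<lambda>n. n" i j] unfolding level_env .

lemma const_env: "a \<in> M \<Longrightarrow> range (\<lambda>_ :: nat. a) \<subseteq> M"
  by auto

context
  fixes M assumes M: "zmodel M"
begin

lemma level_unique: "b \<in> M \<Longrightarrow> level M b y \<Longrightarrow> level M b z \<Longrightarrow> y = z"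
  using recfun_unique[where h = level_step, OF dfn_level_step M const_env level_step_functional[OF M]]
  unfolding level_env by blast

lemma level_in_model: "b \<in> M \<Longrightarrow> level M b y \<Longrightarrow> y \<in> M"
  using recfun_in_model[where h = level_step, OF dfn_level_step M const_env level_step_functional[OF M]]
  unfolding level_env by blast

lemma level_ex: "b \<in> M \<Longrightarrow> b \<in> ordinals mem \<Longrightarrow> \<exists>y. level M b y"
  using recfun_ex[where h = level_step, OF dfn_level_step M const_env level_step_functional[OF M]]
  unfolding level_env by blast

lemma mem_level_iff:
  assumes b: "b \<in> M" "level M b y" and t: "t \<in> M"
  shows "mem t y \<longleftrightarrow> (\<exists>c v. mem c b \<and> level M c v \<and> (\<forall>u. mem u t \<longrightarrow> mem u v))"
proof -
  have "recfun level_step M (\<lambda>_. b) b y" using b(2) level_env by blast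
  from recfun_eq[where h = level_step, OF dfn_level_step M const_env[OF b(1)] level_step_functional[OF M] this]
  obtain w where w: "w \<in> M" "\<And>v. mem v w \<longleftrightarrow> (\<exists>d. mem d b \<and> level M d v)" "level_step M (\<lambda>_. b) w y"
    unfolding level_env by auto
  then show ?thesis using t unfolding level_step_def by metis
qed

text \<open>Induction along membership: replacement collects the least levels containing the
  elements of \<open>x\<close>. With \<open>U\<close> the supremum of these ordinals,
  \<open>x\<close> is a subset of V_U and thus an element of the next level.\<close>

lemma ex_level: "x \<in> M \<Longrightarrow> \<exists>b\<in>M. b \<in> ordinals mem \<and> (\<exists>v. level M b v \<and> mem x v)"
proof (induction x rule: mem_induct)
  case (1 x)
  define Q where "Q y b \<longleftrightarrow> b \<in> ordinals mem \<and> (\<exists>v\<in>M. level M b v \<and> mem y v) \<and>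
    (\<forall>c. mem c b \<longrightarrow> \<not> (\<exists>v\<in>M. level M c v \<and> mem y v))" for y b
  have D: "dfn (\<lambda>M e. e (Suc 0) \<in> ordinals mem \<and> (\<exists>v\<in>M. level M (e (Suc 0)) v \<and> mem (e 0) v) \<and>
    (\<forall>c. mem c (e (Suc 0)) \<longrightarrow> \<not> (\<exists>v\<in>M. level M c v \<and> mem (e 0) v)))"
    by (intro dfn_intros dfn_ordinal dfn_level)
  have Q: "\<exists>!b. b \<in> M \<and> Q y b" if y: "mem y x" for y
  proof -
    let ?R = "\<lambda>b. b \<in> M \<and> b \<in> ordinals mem \<and> (\<exists>v\<in>M. level M b v \<and> mem y v)"
    have "\<exists>b. ?R b"
      using 1(1)[OF y zmodel_trans[OF M 1(2) y]] level_in_model by blast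
    then obtain b where b: "?R b" "\<forall>c. mem c b \<longrightarrow> \<not> ?R c"
      using mem_minimal[of ?R] by blast
    have "Q y b" unfolding Q_def
      using b zmodel_trans[OF M] ordinal_mem by blast
    moreover have "c = b" if c: "c \<in> M" "Q y c" for c
      using ordinal_trichotomy[of c b] c b \<open>Q y b\<close> unfolding Q_def by blast
    ultimately show ?thesis using b(1) by blast
  qed
  have "\<exists>B\<in>M. \<forall>b. mem b B \<longleftrightarrow> b \<in> M \<and> (\<exists>y. mem y x \<and> Q y b)"
    by (rule replacement_ex[OF M D const_env[OF 1(2)] 1(2)]) (simp add: Q_def, use Q in blast)
  then obtain B where B: "B \<in> M" "\<And>b. mem b B \<longleftrightarrow> b \<in> M \<and> (\<exists>y. mem y x \<and> Q y b)" by auto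
  from union[OF M B(1)] obtain U where U: "U \<in> M" "\<forall>z. mem z U \<longleftrightarrow> (\<exists>b. mem z b \<and> mem b B)" ..
  have B_ord: "b \<in> ordinals mem" if "mem b B" for b using that B(2) Q_def by blast
  have "U \<in> ordinals mem"
  proof (rule ordinalI)
    show "y \<in> ordinals mem" if "mem y U" for y
      using that U(2) B_ord ordinal_mem by blast
    show "mem z U" if "mem y U" "mem z y" for y z
      using that U(2) B_ord ordinal_trans by blast
  qed
  from ordinal_succ[OF M U(1) this] obtain S where
    S: "S \<in> M" "S \<in> ordinals mem" "\<forall>z. mem z S \<longleftrightarrow> mem z U \<or> z = U" by blast
  from level_ex[OF U(1) \<open>U \<in> ordinals mem\<close>] obtain v where v: "level M U v" ..
  from level_ex[OF S(1,2)] obtain v' where v': "level M S v'" ..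
  \<comment> \<open>The element \<open>y\<close> is a subset of some V_c with \<open>c\<close> below
    its least level \<open>b\<close>; as \<open>c\<close> belongs to \<open>U\<close>, this puts
    \<open>y\<close> directly into V_U.\<close>
  have "mem y v" if y: "mem y x" for y
  proof -
    obtain b where b: "b \<in> M" "Q y b" using Q[OF y] by blast
    then obtain w where w: "level M b w" "mem y w" unfolding Q_def by blast
    obtain c u where cu: "mem c b" "level M c u" "\<forall>z. mem z y \<longrightarrow> mem z u"
      using mem_level_iff[OF b(1) w(1) zmodel_trans[OF M 1(2) y]] w(2) by blast
    have "mem c U" using U(2) B(2) b y cu(1) by blast
    then show ?thesis using mem_level_iff[OF U(1) v zmodel_trans[OF M 1(2) y]] cu by blast
  qed
  then have "mem x v'" using mem_level_iff[OF S(1) v' 1(2)] S(3) v by blast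
  then show ?case using S v' by blast
qed

section \<open>Choice functions and well-ordered enumerations inside a model\<close>

lemma choice_relation:
  assumes x: "x \<in> M"
  shows "\<exists>T\<in>M. \<forall>u\<in>M. (\<forall>v. mem v u \<longrightarrow> mem v x) \<longrightarrow> (\<exists>v. mem v u) \<longrightarrow> (\<exists>!v. mem v u \<and> in_rel T u v)"
proof -
  from powerset[OF M x] obtain P where P: "P \<in> M"
    "\<forall>u. mem u P \<longleftrightarrow> u \<in> M \<and> (\<forall>y. mem y u \<longrightarrow> mem y x)" ..
  have "\<exists>P'\<in>M. \<forall>u. mem u P' \<longleftrightarrow> mem u P \<and> (\<exists>v\<in>M. mem v u)"
    by (rule separation_ex[where P = "\<lambda>M e. \<exists>v\<in>M. mem v (e 0)", OF M _ const_env[OF x] P(1)])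
      (intro dfn_intros, simp)
  then obtain P' where P': "P' \<in> M" "\<And>u. mem u P' \<longleftrightarrow> mem u P \<and> (\<exists>v\<in>M. mem v u)" by auto
  \<comment> \<open>The axiom of choice speaks of disjoint families, so each nonempty subset
    \<open>u\<close> is replaced by {u} x u. A transversal of these products is a choice function,
    read as a relation.\<close>
  define Q where "Q u a \<longleftrightarrow> (\<forall>p\<in>M. mem p a \<longleftrightarrow> (\<exists>v. mem v u \<and> is_pair p u v))" for u a
  have DQ: "dfn (\<lambda>M e. \<forall>p\<in>M. mem p (e (Suc 0)) \<longleftrightarrow> (\<exists>v. mem v (e 0) \<and> is_pair p (e 0) v))"
    by (intro dfn_intros dfn_is_pair)
  have Q: "\<exists>!a. a \<in> M \<and> Q u a" if u: "mem u P'" for u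
  proof -
    have uM: "u \<in> M" using zmodel_trans[OF M P'(1) u] .
    have D: "dfn (\<lambda>M e. is_pair (e (Suc 0)) (e (Suc (Suc 0))) (e 0))" by (rule dfn_is_pair)
    have "\<exists>a\<in>M. \<forall>p. mem p a \<longleftrightarrow> p \<in> M \<and> (\<exists>v. mem v u \<and> is_pair p u v)"
    proof (rule replacement_ex[OF M D const_env[OF uM] uM], simp)
      show "\<exists>!p. p \<in> M \<and> is_pair p u v" if "mem v u" for v
        using is_pair_ex[OF M uM zmodel_trans[OF M uM that]] is_pair_unique by blast
    qed
    then obtain a where a: "a \<in> M" "\<And>p. mem p a \<longleftrightarrow> p \<in> M \<and> (\<exists>v. mem v u \<and> is_pair p u v)" by auto
    have "Q u a" unfolding Q_def a(2) by blast
    moreover have "b = a" if "b \<in> M" "Q u b" for b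
      by (rule mem_ext) (use that a(2) zmodel_trans[OF M that(1)] in \<open>unfold Q_def, metis\<close>)
    ultimately show ?thesis using a(1) by blast
  qed
  have "\<exists>A\<in>M. \<forall>a. mem a A \<longleftrightarrow> a \<in> M \<and> (\<exists>u. mem u P' \<and> Q u a)"
    by (rule replacement_ex[OF M DQ const_env[OF x] P'(1)]) (simp add: Q_def, use Q in blast)
  then obtain A where A: "A \<in> M" "\<And>a. mem a A \<longleftrightarrow> a \<in> M \<and> (\<exists>u. mem u P' \<and> Q u a)" by auto
  have QD: "\<exists>v. mem v u \<and> is_pair p u v" if "Q u a" "a \<in> M" "mem p a" for u a p
    using that zmodel_trans[OF M that(2,3)] unfolding Q_def by blast
  have QI: "mem p a" if "Q u a" "p \<in> M" "mem v u" "is_pair p u v" for u a p v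
    using that unfolding Q_def by blast
  obtain T where T: "T \<in> M" "\<And>a. mem a A \<Longrightarrow> \<exists>!p. mem p a \<and> mem p T"
  proof (rule transversal[OF M A(1)])
    fix a assume "mem a A"
    then obtain u where u: "mem u P'" "Q u a" using A(2) by blast
    then obtain v where v: "v \<in> M" "mem v u" using P'(2) by blast
    from is_pair_ex[OF M zmodel_trans[OF M P'(1) u(1)] v(1)] obtain p where "p \<in> M" "is_pair p u v" ..
    then show "\<exists>y. mem y a" using QI u(2) v(2) by blast
  next
    fix a b p assume *: "mem a A" "mem b A" "mem p a" "mem p b"
    then obtain u u' where u: "mem u P'" "Q u a" "a \<in> M" "mem u' P'" "Q u' b" "b \<in> M"
      using A(2) by blast
    from QD[OF u(2,3) *(3)] obtain v where "is_pair p u v" by blast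
    moreover from QD[OF u(5,6) *(4)] obtain v' where "is_pair p u' v'" by blast
    ultimately have "u = u'" using is_pair_inject by blast
    then show "a = b" using Q[OF u(1)] u by blast
  qed (erule that, blast)
  have "\<exists>!v. mem v u \<and> in_rel T u v"
    if u: "u \<in> M" "\<forall>v. mem v u \<longrightarrow> mem v x" "\<exists>v. mem v u" for u
  proof -
    have uP': "mem u P'" using u P(2) P'(2) zmodel_trans[OF M u(1)] by blast
    obtain a where a: "a \<in> M" "Q u a" using Q[OF uP'] by blast
    then have "mem a A" using A(2) uP' by blast
    from T(2)[OF this] obtain p where p: "mem p a" "mem p T" "\<And>q. mem q a \<Longrightarrow> mem q T \<Longrightarrow> q = p"
      by blast
    from QD[OF a(2,1) p(1)] obtain v where v: "mem v u" "is_pair p u v" by blast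
    have "w = v" if w: "mem w u" "in_rel T u w" for w
    proof -
      from w(2) obtain q where q: "mem q T" "is_pair q u w" unfolding in_rel_def by blast
      have "mem q a" by (rule QI[OF a(2) _ w(1) q(2)]) (rule zmodel_trans[OF M T(1) q(1)])
      then have "q = p" using p(3) q(1) by blast
      then show ?thesis using is_pair_inject q(2) v(2) by blast
    qed
    then show ?thesis using v p(2) unfolding in_rel_def by blast
  qed
  then show ?thesis using T(1) by blast
qed

end

text \<open>Position 0 holds the set to be enumerated, position 1 a choice relation, and
  \<open>w\<close> is the set of earlier values. The next value is chosen from what remains; after
  exhaustion the set itself is a default that keeps the step total.\<close>

definition enum_step :: "'v set \<Rightarrow> (nat \<Rightarrow> 'v) \<Rightarrow> 'v \<Rightarrow> 'v \<Rightarrow> bool" where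
  "enum_step M s w z \<longleftrightarrow>
     (\<exists>u\<in>M. (\<forall>v\<in>M. mem v u \<longleftrightarrow> mem v (s 0) \<and> \<not> mem v w) \<and> mem z u \<and> in_rel (s (Suc 0)) u z) \<or>
     ((\<forall>v. mem v (s 0) \<longrightarrow> mem v w) \<and> z = s 0)"

lemma dfn_enum_step: "dfn (\<lambda>M e. enum_step M (\<lambda>n. e (Suc (Suc n))) (e 0) (e (Suc 0)))"
  unfolding enum_step_def by (intro dfn_intros dfn_in_rel)

lemma enum_step_functional:
  assumes M: "zmodel M" and s: "range s \<subseteq> M" and w: "w \<in> M"
    and T: "\<forall>u\<in>M. (\<forall>v. mem v u \<longrightarrow> mem v (s 0)) \<longrightarrow> (\<exists>v. mem v u) \<longrightarrow> (\<exists>!v. mem v u \<and> in_rel (s (Suc 0)) u v)"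
  shows "\<exists>!z. z \<in> M \<and> enum_step M s w z"
proof -
  have s0: "s 0 \<in> M" using s by auto
  have D: "dfn (\<lambda>M e. \<not> mem (e 0) (e (Suc 0)))" by (intro dfn_intros)
  have "\<exists>u\<in>M. \<forall>v. mem v u \<longleftrightarrow> mem v (s 0) \<and> \<not> mem v w"
    by (rule separation_ex[OF M D const_env[OF w] s0]) simp
  then obtain u where u: "u \<in> M" "\<And>v. mem v u \<longleftrightarrow> mem v (s 0) \<and> \<not> mem v w" by auto
  have u_unique: "u' = u" if "u' \<in> M" "\<forall>v\<in>M. mem v u' \<longleftrightarrow> mem v (s 0) \<and> \<not> mem v w" for u'
    by (rule mem_ext) (use that u zmodel_trans[OF M that(1)] zmodel_trans[OF M s0] in metis)
  show ?thesis
  proof (cases "\<exists>v. mem v u")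
    case True
    have "\<exists>!v. mem v u \<and> in_rel (s (Suc 0)) u v"
      using T[rule_format, OF u(1) _ True] u(2) by blast
    then obtain z where z: "mem z u" "in_rel (s (Suc 0)) u z"
      "\<And>y. mem y u \<Longrightarrow> in_rel (s (Suc 0)) u y \<Longrightarrow> y = z" by blast
    have "enum_step M s w z" unfolding enum_step_def using u z by blast
    moreover have "y = z" if "enum_step M s w y" for y
      using that u_unique z True u(2) unfolding enum_step_def by blast
    ultimately show ?thesis using zmodel_trans[OF M u(1) z(1)] by blast
  next
    case False
    have "enum_step M s w (s 0)" unfolding enum_step_def using False u(2) by blast
    moreover have "y = s 0" if "enum_step M s w y" for y
      using that u_unique False unfolding enum_step_def by blast
    ultimately show ?thesis using s0 by blast
  qed
qed

text \<open>A Hartogs argument inside \<open>M\<close>: if \<open>x\<close> were never exhausted,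
  distinct ordinals would get distinct elements of \<open>x\<close>, and replacement along the
  inverse would make the ordinals of \<open>M\<close> an element of \<open>M\<close>. The
  environment is returned because embeddings will transport it.\<close>

lemma ex_enumeration:
  assumes M: "zmodel M" and x: "x \<in> M"
  obtains s where "range s \<subseteq> M" "s 0 = x"
    "\<And>c. c \<in> M \<Longrightarrow> c \<in> ordinals mem \<Longrightarrow> \<exists>!y. y \<in> M \<and> recfun enum_step M s c y"
    "\<exists>b\<in>M. b \<in> ordinals mem \<and> (\<forall>y. mem y x \<longrightarrow> (\<exists>c. mem c b \<and> recfun enum_step M s c y))"
proof -
  from choice_relation[OF M x] obtain T where T: "T \<in> M"
    "\<forall>u\<in>M. (\<forall>v. mem v u \<longrightarrow> mem v x) \<longrightarrow> (\<exists>v. mem v u) \<longrightarrow> (\<exists>!v. mem v u \<and> in_rel T u v)" ..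
  define s where "s = case_nat x (\<lambda>_ :: nat. T)"
  have s: "range s \<subseteq> M" using x T(1) by (auto simp: s_def split: nat.splits)
  have fn: "\<exists>!z. z \<in> M \<and> enum_step M s w z" if "w \<in> M" for w
    by (rule enum_step_functional[OF M s that]) (use T(2) in \<open>simp add: s_def\<close>)
  let ?E = "recfun enum_step M s"
  note unique = recfun_unique[where h = enum_step, OF dfn_enum_step M s fn]
  note inM = recfun_in_model[where h = enum_step, OF dfn_enum_step M s fn]
  note ex = recfun_ex[where h = enum_step, OF dfn_enum_step M s fn]
  note eqn = recfun_eq[where h = enum_step, OF dfn_enum_step M s fn]
  have "\<exists>b\<in>M. b \<in> ordinals mem \<and> (\<forall>y. mem y x \<longrightarrow> (\<exists>c. mem c b \<and> ?E c y))"
  proof (rule ccontr)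
    assume neg: "\<not> ?thesis"
    have new: "mem z x \<and> (\<forall>c. mem c b \<longrightarrow> \<not> ?E c z)" if b: "b \<in> M" "b \<in> ordinals mem" "?E b z" for b z
    proof -
      from eqn[OF _ b(3)] obtain w where w: "w \<in> M" "\<forall>v. mem v w \<longleftrightarrow> (\<exists>d. mem d b \<and> ?E d v)"
        "enum_step M s w z" by auto
      have "\<not> (\<forall>v. mem v (s 0) \<longrightarrow> mem v w)" using neg b w(2) by (auto simp: s_def)
      then obtain u where u: "u \<in> M" "\<forall>v\<in>M. mem v u \<longleftrightarrow> mem v (s 0) \<and> \<not> mem v w" "mem z u"
        using w(3) unfolding enum_step_def by blast
      then have "mem z (s 0) \<and> \<not> mem z w" using zmodel_trans[OF M u(1,3)] by blast
      then show ?thesis using w(2) by (auto simp: s_def)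
    qed
    have inj: "b = c" if "b \<in> M" "b \<in> ordinals mem" "?E b z" "c \<in> M" "c \<in> ordinals mem" "?E c z" for b c z
      using ordinal_trichotomy[of b c] new[OF that(1-3)] new[OF that(4-6)] that by blast
    have "dfn (\<lambda>M e. \<exists>b\<in>M. b \<in> ordinals mem \<and> recfun enum_step M (\<lambda>n. e (Suc n)) b (e 0))"
      by (intro dfn_intros dfn_ordinal dfn_recfun[where h = enum_step, OF dfn_enum_step])
    from separation[OF M this s x] obtain R where R: "R \<in> M"
      "\<And>y. mem y R \<longleftrightarrow> mem y x \<and> (\<exists>b\<in>M. b \<in> ordinals mem \<and> ?E b y)" by auto
    have D: "dfn (\<lambda>M e. e (Suc 0) \<in> ordinals mem \<and> recfun enum_step M (\<lambda>n. e (Suc (Suc n))) (e (Suc 0)) (e 0))"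
      by (intro dfn_intros dfn_ordinal dfn_recfun[where h = enum_step, OF dfn_enum_step])
    have "\<exists>B\<in>M. \<forall>b. mem b B \<longleftrightarrow> b \<in> M \<and> (\<exists>y. mem y R \<and> b \<in> ordinals mem \<and> ?E b y)"
    proof (rule replacement_ex[OF M D s R(1)], simp)
      show "\<exists>!b. b \<in> M \<and> b \<in> ordinals mem \<and> ?E b y" if "mem y R" for y
        using that R(2) inj by blast
    qed
    then obtain B where B: "B \<in> M" "\<And>b. mem b B \<longleftrightarrow> b \<in> M \<and> (\<exists>y. mem y R \<and> b \<in> ordinals mem \<and> ?E b y)"
      by auto
    have all: "mem b B \<longleftrightarrow> b \<in> M \<and> b \<in> ordinals mem" for b
    proof
      assume b: "b \<in> M \<and> b \<in> ordinals mem"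
      then obtain y where "?E b y" using ex by blast
      then show "mem b B" using B(2) R(2) new b by blast
    qed (use B(2) in blast)
    have "B \<in> ordinals mem"
    proof (rule ordinalI)
      show "mem z B" if "mem y B" "mem z y" for y z
        using that all zmodel_trans[OF M, of y z] ordinal_mem by blast
    qed (use all in blast)
    then have "mem B B" using all B(1) by blast
    then show False using mem_irrefl by blast
  qed
  moreover have "\<exists>!y. y \<in> M \<and> ?E c y" if "c \<in> M" "c \<in> ordinals mem" for c
    using ex[OF _ that] inM unique by blast
  ultimately show ?thesis using that[OF s] by (simp add: s_def)
qed

text \<open>The difficulty is that an element of \<open>j x\<close> need not be a value of
  \<open>j\<close>. An enumeration of \<open>x\<close> in \<open>M\<close> along \<open>b\<close> is
  carried to one of \<open>j x\<close> in \<open>N\<close> along \<open>j b = b\<close>. Since each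
  position \<open>c\<close> is fixed too, the element of \<open>j x\<close> at \<open>c\<close> is
  the image of the element of \<open>x\<close> at \<open>c\<close>.\<close>

theorem elementary_embedding_fix_ordinals:
  assumes M: "zmodel M" and N: "zmodel N" and j: "elementary_embedding mem M N j"
    and ords: "M \<inter> ordinals mem = N \<inter> ordinals mem"
    and fixed: "\<And>a. a \<in> M \<Longrightarrow> a \<in> ordinals mem \<Longrightarrow> j a = a"
  shows "M = N"
proof -
  have jN: "j y \<in> N" if "y \<in> M" for y using j that by (auto simp: elementary_embedding_def)
  have j_mem: "mem a b \<longleftrightarrow> mem (j a) (j b)" if "a \<in> M" "b \<in> M" for a b
    using dfn_elementary[OF dfn_mem[of 0 "Suc 0"] M N j, of "case_nat a (\<lambda>_. b)"] that
    by (auto simp: image_subset_iff split: nat.splits)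
  have j_id: "x \<in> M \<Longrightarrow> j x = x" for x
  proof (induction x rule: mem_induct)
    case (1 x)
    note x = 1(2)
    have IH: "j y = y" if "mem y x" for y using 1(1)[OF that zmodel_trans[OF M x that]] .
    obtain s b where s: "range s \<subseteq> M" "s 0 = x"
      and fn: "\<And>c. c \<in> M \<Longrightarrow> c \<in> ordinals mem \<Longrightarrow> \<exists>!y. y \<in> M \<and> recfun enum_step M s c y"
      and b: "b \<in> M" "b \<in> ordinals mem" "\<forall>y. mem y x \<longrightarrow> (\<exists>c. mem c b \<and> recfun enum_step M s c y)"
      using ex_enumeration[OF M x] by metis
    let ?s = "\<lambda>n. j (s n)"
    have js: "(\<lambda>n. j (case_nat a t n)) = case_nat (j a) (\<lambda>n. j (t n))" for a t
      by (auto simp: fun_eq_iff split: nat.splits)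
    have env: "range (case_nat a t) \<subseteq> M" if "a \<in> M" "range t \<subseteq> M" for a t
      using that by (auto simp: image_subset_iff split: nat.splits)
    have sub: "mem y x" if y: "mem y (j x)" for y
    proof -
      have "dfn (\<lambda>M e. \<forall>y. mem y (e (Suc 0)) \<longrightarrow> (\<exists>c. mem c (e 0) \<and> recfun enum_step M (\<lambda>n. e (Suc n)) c y))"
        by (intro dfn_intros dfn_recfun[where h = enum_step, OF dfn_enum_step])
      from dfn_elementary[OF this M N j env[OF b(1) s(1)]]
      have "\<forall>y. mem y (j x) \<longrightarrow> (\<exists>c. mem c (j b) \<and> recfun enum_step N ?s c y)"
        using b(3) by (simp add: js s(2))
      then obtain c where c: "mem c b" "recfun enum_step N ?s c y" using y fixed[OF b(1,2)] by auto
      have cM: "c \<in> M" "c \<in> ordinals mem" using zmodel_trans[OF M b(1) c(1)] ordinal_mem[OF b(2) c(1)] .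
      from fn[OF cM] obtain y0 where y0: "y0 \<in> M" "recfun enum_step M s c y0"
        "\<And>z. z \<in> M \<Longrightarrow> recfun enum_step M s c z \<Longrightarrow> z = y0" by blast
      have "dfn (\<lambda>M e. \<forall>z\<in>M. recfun enum_step M (\<lambda>n. e (Suc (Suc n))) (e 0) z \<longrightarrow> z = e (Suc 0))"
        by (intro dfn_intros dfn_recfun[where h = enum_step, OF dfn_enum_step])
      from dfn_elementary[OF this M N j env[OF cM(1) env[OF y0(1) s(1)]]]
      have "\<forall>z\<in>N. recfun enum_step N ?s (j c) z \<longrightarrow> z = j y0"
        using y0(3) by (simp add: js)
      then have "y = j y0"
        using c(2) fixed[OF cM] zmodel_trans[OF N jN[OF x] y] by auto
      then have "mem y0 x" using j_mem[OF y0(1) x] y by blast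
      then show ?thesis using IH \<open>y = j y0\<close> by simp
    qed
    have sup: "mem y (j x)" if "mem y x" for y
      using j_mem[OF zmodel_trans[OF M x that] x] IH[OF that] that by simp
    show ?case by (rule mem_ext) (use sub sup in blast)
  qed
  show "M = N"
  proof
    show "M \<subseteq> N" using j_id jN by force
    show "N \<subseteq> M"
    proof
      fix y assume y: "y \<in> N"
      from ex_level[OF N y] obtain b v where b: "b \<in> N" "b \<in> ordinals mem" "level N b v" "mem y v"
        by blast
      then have bM: "b \<in> M" using ords by blast
      from level_ex[OF M bM b(2)] obtain u where u: "level M b u" ..
      have uM: "u \<in> M" using level_in_model[OF M bM u] .
      \<comment> \<open>Elementarity carries V_b of \<open>M\<close> to V_b of \<open>N\<close>,
        while \<open>j\<close> is already known to be the identity. So this level of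
        \<open>N\<close> is an element of \<open>M\<close>, and transitivity brings its elements
        into \<open>M\<close>.\<close>
      from dfn_elementary[OF dfn_level[of 0 "Suc 0"] M N j, of "case_nat b (\<lambda>_. u)"]
      have "level N (j b) (j u)"
        using u bM uM by (auto simp: image_subset_iff split: nat.splits)
      then have "level N b u" using j_id bM uM by simp
      then have "u = v" using level_unique[OF N b(1) _ b(3)] by blast
      then show "y \<in> M" using zmodel_trans[OF M uM] b(4) by blast
    qed
  qed
qed

text \<open>A successor has exactly one more predecessor than the ordinal it succeeds, so among
  finitely many ordinals the number of predecessors could have no maximum.\<close>

lemma infinite_ordinals:
  assumes M: "zmodel M"
  shows "infinite (M \<inter> ordinals mem)"
proof
  let ?O = "M \<inter> ordinals mem" and ?f = "\<lambda>b. card {a. mem a b}"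
  assume fin: "finite ?O"
  obtain x where "x \<in> M" using zmodel_nonempty[OF M] by blast
  then have ne: "?O \<noteq> {}" using ex_level[OF M] by blast
  from fin ne have "Max (?f ` ?O) \<in> ?f ` ?O" by (intro Max_in) auto
  then obtain b where b: "b \<in> ?O" "?f b = Max (?f ` ?O)" by auto
  from ordinal_succ[OF M, of b] b obtain c where
    c: "c \<in> ?O" "\<forall>x. mem x c \<longleftrightarrow> mem x b \<or> x = b" by blast
  have "{a. mem a b} \<subseteq> ?O" using b zmodel_trans[OF M] ordinal_mem by blast
  then have "finite {a. mem a b}" using fin finite_subset by blast
  moreover have "{a. mem a c} = insert b {a. mem a b}" using c(2) by auto
  ultimately have "?f c = Suc (?f b)" using mem_irrefl by simp
  moreover have "?f c \<le> Max (?f ` ?O)" using fin c(1) by (intro Max_ge) auto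
  ultimately show False using b(2) by simp
qed

end

section \<open>Drifting systems of ordinal maps\<close>

context set_univ
begin

text \<open>Either some ordinal is moved again and again along the extensions of some \<open>q\<close>, and then its
  images grow; or the ordinals fixed from a node on grow with the node, every ordinal being fixed
  from densely many nodes on.\<close>

lemma drifting_system:
  assumes W: "W \<subseteq> ordinals mem" and T: "Partial_order T" and p: "p \<in> Field T"
    and f_in: "\<And>x y a. (x, y) \<in> T \<Longrightarrow> a \<in> W \<Longrightarrow> f x y a \<in> W"
    and f_mono: "\<And>x y a b. (x, y) \<in> T \<Longrightarrow> a \<in> W \<Longrightarrow> b \<in> W \<Longrightarrow> mem a b \<Longrightarrow> mem (f x y a) (f x y b)"
    and f_comp: "\<And>x y z a. (x, y) \<in> T \<Longrightarrow> (y, z) \<in> T \<Longrightarrow> a \<in> W \<Longrightarrow> f y z (f x y a) = f x z a"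
    and moved: "\<And>q. (p, q) \<in> T \<Longrightarrow> \<exists>r. (q, r) \<in> T \<and> (\<exists>a\<in>W. f q r a \<noteq> a)"
  obtains q E where "(p, q) \<in> T"
    and "\<And>\<xi> s t. s \<in> E \<xi> \<Longrightarrow> (s, t) \<in> T \<Longrightarrow> t \<in> E \<xi>"
    and "\<And>r. (q, r) \<in> T \<Longrightarrow> \<exists>\<xi>\<in>W. \<exists>s. (r, s) \<in> T \<and> s \<in> E \<xi> \<and> r \<notin> E \<xi>"
proof -
  have T_refl: "(x, x) \<in> T" if "x \<in> Field T" for x
    using T that by (simp add: partial_order_on_def preorder_on_def refl_on_def)
  have T_trans: "(x, z) \<in> T" if "(x, y) \<in> T" "(y, z) \<in> T" for x y z
    using T that unfolding partial_order_on_def preorder_on_def by (meson transD)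
  \<comment> \<open>An order-preserving map of ordinals never decreases: at the least point sent
    below itself, the image would be a smaller such point.\<close>
  have f_ge: "f x y a = a \<or> mem a (f x y a)" if xy: "(x, y) \<in> T" and a: "a \<in> W" for x y a
  proof -
    have "\<not> (a \<in> W \<and> mem (f x y a) a)"
    proof
      assume *: "a \<in> W \<and> mem (f x y a) a"
      from mem_minimal[of "\<lambda>a. a \<in> W \<and> mem (f x y a) a", OF *] obtain m where
        m: "m \<in> W" "mem (f x y m) m" "\<forall>b. mem b m \<longrightarrow> \<not> (b \<in> W \<and> mem (f x y b) b)" by blast
      show False using m(3)[rule_format, OF m(2)] f_in[OF xy m(1)] f_mono[OF xy f_in[OF xy m(1)] m(1,2)] by simp
    qed
    then show ?thesis using ordinal_trichotomy[OF subsetD[OF W a] subsetD[OF W f_in[OF xy a]]] a by auto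
  qed
  define Fix where "Fix r = {g. \<forall>s. (r, s) \<in> T \<longrightarrow> f r s g = g}" for r
  show ?thesis
  proof (cases "\<exists>q g. (p, q) \<in> T \<and> g \<in> W \<and> (\<forall>r. (q, r) \<in> T \<longrightarrow> f q r g \<notin> Fix r)")
    case True
    then obtain q g where q: "(p, q) \<in> T" and g: "g \<in> W"
      and drift: "\<And>r. (q, r) \<in> T \<Longrightarrow> f q r g \<notin> Fix r" by blast
    define E where "E \<xi> = {s. (q, s) \<in> T \<and> mem \<xi> (f q s g)}" for \<xi>
    show ?thesis
    proof (rule that[OF q])
      fix \<xi> s t assume s: "s \<in> E \<xi>" and st: "(s, t) \<in> T"
      then have qs: "(q, s) \<in> T" "mem \<xi> (f q s g)" by (auto simp: E_def)
      have "f q t g = f q s g \<or> mem (f q s g) (f q t g)"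
        using f_ge[OF st f_in[OF qs(1) g]] f_comp[OF qs(1) st g] by simp
      then have "mem \<xi> (f q t g)"
        using qs(2) ordinal_trans[OF subsetD[OF W f_in[OF T_trans[OF qs(1) st] g]]] by metis
      then show "t \<in> E \<xi>" using T_trans[OF qs(1) st] by (simp add: E_def)
    next
      fix r assume r: "(q, r) \<in> T"
      from drift[OF r] obtain s where s: "(r, s) \<in> T" "f r s (f q r g) \<noteq> f q r g"
        by (auto simp: Fix_def)
      then have "mem (f q r g) (f q s g)"
        using f_ge[OF s(1) f_in[OF r g]] f_comp[OF r s(1) g] by auto
      then have "s \<in> E (f q r g)" "r \<notin> E (f q r g)"
        using T_trans[OF r s(1)] mem_irrefl by (simp_all add: E_def)
      then show "\<exists>\<xi>\<in>W. \<exists>s. (r, s) \<in> T \<and> s \<in> E \<xi> \<and> r \<notin> E \<xi>"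
        using s(1) f_in[OF r g] by blast
    qed
  next
    case False
    have stabilizes: "\<exists>r. (q, r) \<in> T \<and> f q r g \<in> Fix r" if "(p, q) \<in> T" "g \<in> W" for q g
      using False that by blast
    have dense: "\<exists>r. (q, r) \<in> T \<and> g \<in> Fix r" if q: "(p, q) \<in> T" and g: "g \<in> W" for q g
    proof -
      \<comment> \<open>These are the eventual resting places of \<open>g\<close> above
        \<open>q\<close>. If the least one were above \<open>g\<close>, restarting \<open>g\<close>
        at a node where that ordinal is at rest would keep the images of \<open>g\<close> strictly
        below it and lead to a smaller resting place.\<close>
      let ?B = "\<lambda>\<beta>. \<exists>q' r. (q, q') \<in> T \<and> (q', r) \<in> T \<and> \<beta> = f q' r g \<and> \<beta> \<in> Fix r"
      have "q \<in> Field T" using q by (auto simp: Field_def)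
      then have "\<exists>\<beta>. ?B \<beta>" using stabilizes[OF q g] T_refl by blast
      then obtain \<beta> where "?B \<beta>" and min: "\<And>\<gamma>. mem \<gamma> \<beta> \<Longrightarrow> \<not> ?B \<gamma>"
        using mem_minimal[of ?B] by blast
      then obtain q' r where r: "(q, q') \<in> T" "(q', r) \<in> T" "\<beta> = f q' r g" "\<beta> \<in> Fix r" by blast
      have qr: "(q, r) \<in> T" using T_trans[OF r(1,2)] .
      have "\<beta> = g"
      proof (rule ccontr)
        assume "\<beta> \<noteq> g"
        then have lt: "mem g \<beta>" using f_ge[OF r(2) g] r(3) by blast
        from stabilizes[OF T_trans[OF q qr] g] obtain r' where
          r': "(r, r') \<in> T" "f r r' g \<in> Fix r'" by blast
        have "mem (f r r' g) (f r r' \<beta>)"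
          using f_mono[OF r'(1) g _ lt] f_in[OF r(2) g] r(3) by simp
        moreover have "f r r' \<beta> = \<beta>" using r(4) r'(1) by (simp add: Fix_def)
        ultimately have "mem (f r r' g) \<beta>" by simp
        from min[OF this] show False using qr r' by blast
      qed
      then show ?thesis using r(4) qr by blast
    qed
    define E where "E \<xi> = {r. (p, r) \<in> T \<and> \<xi> \<in> W \<and> \<xi> \<in> Fix r}" for \<xi>
    show ?thesis
    proof (rule that[OF T_refl[OF p]])
      fix \<xi> s t assume s: "s \<in> E \<xi>" and st: "(s, t) \<in> T"
      then have *: "(p, s) \<in> T" "\<xi> \<in> W" "\<And>u. (s, u) \<in> T \<Longrightarrow> f s u \<xi> = \<xi>"
        by (auto simp: E_def Fix_def)
      have "f t u \<xi> = \<xi>" if "(t, u) \<in> T" for u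
        using f_comp[OF st that *(2)] *(3)[OF st] *(3)[OF T_trans[OF st that]] by simp
      then show "t \<in> E \<xi>" using T_trans[OF *(1) st] *(2) by (simp add: E_def Fix_def)
    next
      fix r assume r: "(p, r) \<in> T"
      from moved[OF r] obtain t a where ta: "(r, t) \<in> T" "a \<in> W" "f r t a \<noteq> a" by blast
      from dense[OF r ta(2)] obtain s where "(r, s) \<in> T" "a \<in> Fix s" by blast
      then have "s \<in> E a" "r \<notin> E a" using ta T_trans[OF r] by (simp_all add: E_def Fix_def) blast
      then show "\<exists>\<xi>\<in>W. \<exists>s. (r, s) \<in> T \<and> s \<in> E \<xi> \<and> r \<notin> E \<xi>"
        using ta(2) \<open>(r, s) \<in> T\<close> by blast
    qed
  qed
qed

end

section \<open>The forcing relation\<close>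

locale forcing_order =
  fixes r :: "'p rel"
  assumes order_refl: "p \<in> Field r \<Longrightarrow> (p, p) \<in> r"
    and order_trans: "(p, q) \<in> r \<Longrightarrow> (q, t) \<in> r \<Longrightarrow> (p, t) \<in> r"
begin

lemma order_refl1: "(p, q) \<in> r \<Longrightarrow> (p, p) \<in> r"
  using order_refl by (auto simp: Field_def)

lemma dense_belowI: "(\<And>q. (q, p) \<in> r \<Longrightarrow> \<exists>q'. (q', q) \<in> r \<and> D q') \<Longrightarrow> dense_below r p D"
  by (simp add: dense_below_def)

lemma dense_belowE:
  assumes "dense_below r p D" "(q, p) \<in> r"
  obtains q' where "(q', q) \<in> r" "(q', p) \<in> r" "D q'"
  using assms order_trans unfolding dense_below_def by blast

lemma dense_below_mono: "dense_below r p D \<Longrightarrow> (q, p) \<in> r \<Longrightarrow> dense_below r q D"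
  using order_trans unfolding dense_below_def by blast

lemma dense_below_all: "(\<And>q. (q, p) \<in> r \<Longrightarrow> D q) \<Longrightarrow> dense_below r p D"
  using order_refl1 unfolding dense_below_def by blast

lemma dense_below_weaken:
  "dense_below r p D \<Longrightarrow> (\<And>q. (q, p) \<in> r \<Longrightarrow> D q \<Longrightarrow> D' q) \<Longrightarrow> dense_below r p D'"
  using order_trans unfolding dense_below_def by metis

text \<open>Density composes: it is enough to reach \<open>D'\<close> densely below each condition
  of a dense set. Nested density arguments below go through this rule.\<close>

lemma dense_below_bind:
  assumes "dense_below r p D" "\<And>q. (q, p) \<in> r \<Longrightarrow> D q \<Longrightarrow> dense_below r q D'"
  shows "dense_below r p D'"
proof (rule dense_belowI)
  fix q assume "(q, p) \<in> r"
  from dense_belowE[OF assms(1) this] obtain q' where q': "(q', q) \<in> r" "(q', p) \<in> r" "D q'" .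
  from dense_belowE[OF assms(2)[OF q'(2,3)] order_refl1[OF q'(1)]] obtain q'' where
    "(q'', q') \<in> r" "D' q''" .
  then show "\<exists>q'. (q', q) \<in> r \<and> D' q'" using order_trans q'(1) by blast
qed

lemma forces_eq_iff:
  "forces_eq r p x y \<longleftrightarrow>
     (\<forall>c s. (c, s) \<in> elts x \<longrightarrow> (\<forall>q. (q, p) \<in> r \<and> (q, s) \<in> r \<longrightarrow>
        dense_below r q (\<lambda>q'. \<exists>d t. (d, t) \<in> elts y \<and> (q', t) \<in> r \<and> forces_eq r q' c d))) \<and>
     (\<forall>d t. (d, t) \<in> elts y \<longrightarrow> (\<forall>q. (q, p) \<in> r \<and> (q, t) \<in> r \<longrightarrow>
        dense_below r q (\<lambda>q'. \<exists>c s. (c, s) \<in> elts x \<and> (q', s) \<in> r \<and> forces_eq r q' c d)))"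
  by (subst forces_eq.simps) (simp add: Ball_def Bex_def)

lemma forces_mem_iff:
  "forces_mem r p x y \<longleftrightarrow>
     dense_below r p (\<lambda>q. \<exists>d t. (d, t) \<in> elts y \<and> (q, t) \<in> r \<and> forces_eq r q x d)"
  unfolding forces_mem_def by (simp add: Bex_def)

lemma forces_eq_left:
  "forces_eq r p x y \<Longrightarrow> (c, s) \<in> elts x \<Longrightarrow> (q, p) \<in> r \<Longrightarrow> (q, s) \<in> r \<Longrightarrow> forces_mem r q c y"
  unfolding forces_mem_iff by (subst (asm) forces_eq_iff) blast

lemma forces_eq_mono: "forces_eq r p x y \<Longrightarrow> (q, p) \<in> r \<Longrightarrow> forces_eq r q x y"
  unfolding forces_eq_iff[of p] forces_eq_iff[of q] using order_trans by meson

lemma forces_mem_mono: "forces_mem r p x y \<Longrightarrow> (q, p) \<in> r \<Longrightarrow> forces_mem r q x y"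
  unfolding forces_mem_iff by (rule dense_below_mono)

lemma forces_mono: "forces r p s \<phi> \<Longrightarrow> (q, p) \<in> r \<Longrightarrow> forces r q s \<phi>"
proof (induction \<phi> arbitrary: s p q)
  case (Mem i j)
  then show ?case using forces_mem_mono[of p _ _ q] by simp
next
  case (Eq i j)
  then show ?case using forces_eq_mono[of p _ _ q] by simp
next
  case (Neg \<phi>)
  then show ?case using order_trans[of _ q p] unfolding forces.simps by metis
next
  case (And \<phi> \<psi>)
  from And.IH(1)[of p s q] And.IH(2)[of p s q] And.prems show ?case by simp
next
  case (Forall n \<phi>)
  from Forall.IH[of p _ q] Forall.prems show ?case unfolding forces.simps by blast
qed

lemma name_induct:
  assumes "\<And>x. (\<And>c s. (c, s) \<in> elts x \<Longrightarrow> P c) \<Longrightarrow> P x"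
  shows "P (x :: ('i, 'p) pname)"
  using wf_name_rel
proof (induction x rule: wf_induct_rule)
  case (less x)
  show ?case by (rule assms, rule less) (auto simp: name_rel_def)
qed

lemma forces_eq_refl: "forces_eq r p x x"
proof (induction x arbitrary: p rule: name_induct)
  case (1 x)
  have "dense_below r q (\<lambda>q'. \<exists>d t. (d, t) \<in> elts x \<and> (q', t) \<in> r \<and> forces_eq r q' c d)"
    "dense_below r q (\<lambda>q'. \<exists>d t. (d, t) \<in> elts x \<and> (q', t) \<in> r \<and> forces_eq r q' d c)"
    if "(c, s) \<in> elts x" "(q, s) \<in> r" for c s q
    by (rule dense_below_all, use that 1 order_trans in blast)+
  then show ?case unfolding forces_eq_iff[of p x x] by blast
qed

lemma forces_mem_elt: "(c, s) \<in> elts x \<Longrightarrow> (p, s) \<in> r \<Longrightarrow> forces_mem r p c x"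
  unfolding forces_mem_iff by (rule dense_below_all) (use forces_eq_refl order_trans in blast)

text \<open>Exchanging the two names swaps the clauses of the definition but also the arguments of
  the recursive calls, hence the induction.\<close>

lemma forces_eq_sym: "forces_eq r p x y \<Longrightarrow> forces_eq r p y x"
proof (induction x arbitrary: y p rule: name_induct)
  case (1 x)
  have "dense_below r q (\<lambda>q'. \<exists>d t. (d, t) \<in> elts x \<and> (q', t) \<in> r \<and> forces_eq r q' c d)"
    if "(c, s) \<in> elts y" "(q, p) \<in> r" "(q, s) \<in> r" for c s q
  proof (rule dense_below_weaken)
    show "dense_below r q (\<lambda>q'. \<exists>d t. (d, t) \<in> elts x \<and> (q', t) \<in> r \<and> forces_eq r q' d c)"
      using 1(2) that unfolding forces_eq_iff[of p x y] by blast
  qed (use 1(1) in blast)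
  moreover have "dense_below r q (\<lambda>q'. \<exists>c s. (c, s) \<in> elts y \<and> (q', s) \<in> r \<and> forces_eq r q' c d)"
    if "(d, t) \<in> elts x" "(q, p) \<in> r" "(q, t) \<in> r" for d t q
  proof (rule dense_below_weaken)
    show "dense_below r q (\<lambda>q'. \<exists>c s. (c, s) \<in> elts y \<and> (q', s) \<in> r \<and> forces_eq r q' d c)"
      using 1(2) that unfolding forces_eq_iff[of p x y] by blast
  qed (use 1(1)[OF that(1)] in blast)
  ultimately show ?case unfolding forces_eq_iff[of p y x] by blast
qed

lemma forces_eq_right:
  assumes "forces_eq r p x y" "(d, t) \<in> elts y" "(q, p) \<in> r" "(q, t) \<in> r"
  shows "forces_mem r q d x"
  using forces_eq_left[OF forces_eq_sym[OF assms(1)] assms(2-4)] .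

lemma forces_eqI:
  assumes "\<And>c s q. (c, s) \<in> elts x \<Longrightarrow> (q, p) \<in> r \<Longrightarrow> (q, s) \<in> r \<Longrightarrow> forces_mem r q c y"
    and "\<And>d t q. (d, t) \<in> elts y \<Longrightarrow> (q, p) \<in> r \<Longrightarrow> (q, t) \<in> r \<Longrightarrow> forces_mem r q d x"
  shows "forces_eq r p x y"
proof -
  have "dense_below r q (\<lambda>q'. \<exists>c s. (c, s) \<in> elts x \<and> (q', s) \<in> r \<and> forces_eq r q' c d)"
    if "(d, t) \<in> elts y" "(q, p) \<in> r" "(q, t) \<in> r" for d t q
    by (rule dense_below_weaken[OF assms(2)[OF that, unfolded forces_mem_iff]])
      (use forces_eq_sym in blast)
  then show ?thesis
    unfolding forces_eq_iff[of p x y] using assms(1)[unfolded forces_mem_iff] by blast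
qed

text \<open>Induction on the first name alone suffices. For an element \<open>e\<close> of
  \<open>z\<close>, one finds \<open>d\<close> in \<open>y\<close> and then \<open>c\<close> in
  \<open>x\<close>; symmetry turns the equalities around so that the hypothesis for \<open>c\<close>
  applies.\<close>

lemma forces_eq_trans:
  "forces_eq r p x y \<Longrightarrow> forces_eq r p y z \<Longrightarrow> forces_eq r p x z"
proof (induction x arbitrary: y z p rule: name_induct)
  case (1 x)
  have *: "forces_mem r q c z" if c: "(c, s) \<in> elts x" "(q, p) \<in> r" "(q, s) \<in> r" for c s q
    unfolding forces_mem_iff
  proof (rule dense_below_bind)
    show "dense_below r q (\<lambda>q. \<exists>d t. (d, t) \<in> elts y \<and> (q, t) \<in> r \<and> forces_eq r q c d)"
      using forces_eq_left[OF 1(2) c] unfolding forces_mem_iff .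
    fix q' assume q': "(q', q) \<in> r" "\<exists>d t. (d, t) \<in> elts y \<and> (q', t) \<in> r \<and> forces_eq r q' c d"
    then obtain d t where d: "(d, t) \<in> elts y" "(q', t) \<in> r" "forces_eq r q' c d" by blast
    have "(q', p) \<in> r" using order_trans q'(1) c(2) by blast
    from forces_eq_left[OF 1(3) d(1) this d(2)]
    have "dense_below r q' (\<lambda>q. \<exists>e u. (e, u) \<in> elts z \<and> (q, u) \<in> r \<and> forces_eq r q d e)"
      unfolding forces_mem_iff .
    then show "dense_below r q' (\<lambda>q. \<exists>d t. (d, t) \<in> elts z \<and> (q, t) \<in> r \<and> forces_eq r q c d)"
    proof (rule dense_below_weaken)
      fix v assume v: "(v, q') \<in> r" "\<exists>e u. (e, u) \<in> elts z \<and> (v, u) \<in> r \<and> forces_eq r v d e"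
      then show "\<exists>e u. (e, u) \<in> elts z \<and> (v, u) \<in> r \<and> forces_eq r v c e"
        using 1(1)[OF c(1) forces_eq_mono[OF d(3) v(1)]] by blast
    qed
  qed
  have "forces_mem r q e x" if e: "(e, u) \<in> elts z" "(q, p) \<in> r" "(q, u) \<in> r" for e u q
    unfolding forces_mem_iff
  proof (rule dense_below_bind)
    show "dense_below r q (\<lambda>q. \<exists>d t. (d, t) \<in> elts y \<and> (q, t) \<in> r \<and> forces_eq r q e d)"
      using forces_eq_right[OF 1(3) e] unfolding forces_mem_iff .
    fix q' assume q': "(q', q) \<in> r" "\<exists>d t. (d, t) \<in> elts y \<and> (q', t) \<in> r \<and> forces_eq r q' e d"
    then obtain d t where d: "(d, t) \<in> elts y" "(q', t) \<in> r" "forces_eq r q' d e"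
      using forces_eq_sym by blast
    have "(q', p) \<in> r" using order_trans q'(1) e(2) by blast
    from forces_eq_right[OF 1(2) d(1) this d(2)]
    have "dense_below r q' (\<lambda>q. \<exists>c s. (c, s) \<in> elts x \<and> (q, s) \<in> r \<and> forces_eq r q d c)"
      unfolding forces_mem_iff .
    then show "dense_below r q' (\<lambda>q. \<exists>c s. (c, s) \<in> elts x \<and> (q, s) \<in> r \<and> forces_eq r q e c)"
    proof (rule dense_below_weaken)
      fix v assume v: "(v, q') \<in> r" "\<exists>c s. (c, s) \<in> elts x \<and> (v, s) \<in> r \<and> forces_eq r v d c"
      then obtain c s where c: "(c, s) \<in> elts x" "(v, s) \<in> r" "forces_eq r v d c" by blast
      have "forces_eq r v c e"
        using 1(1)[OF c(1) forces_eq_sym[OF c(3)] forces_eq_mono[OF d(3) v(1)]] .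
      then show "\<exists>c s. (c, s) \<in> elts x \<and> (v, s) \<in> r \<and> forces_eq r v e c"
        using c forces_eq_sym by blast
    qed
  qed
  with * show ?case by (intro forces_eqI) blast+
qed

lemma forces_mem_cong_left:
  assumes "forces_eq r p x x'" "forces_mem r p x y"
  shows "forces_mem r p x' y"
  unfolding forces_mem_iff
proof (rule dense_below_weaken[OF assms(2)[unfolded forces_mem_iff]])
  fix q assume q: "(q, p) \<in> r" "\<exists>d t. (d, t) \<in> elts y \<and> (q, t) \<in> r \<and> forces_eq r q x d"
  then show "\<exists>d t. (d, t) \<in> elts y \<and> (q, t) \<in> r \<and> forces_eq r q x' d"
    using forces_eq_trans[OF forces_eq_sym[OF forces_eq_mono[OF assms(1) q(1)]]] by blast
qed

lemma forces_mem_cong_right: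
  assumes "forces_eq r p y y'" "forces_mem r p x y"
  shows "forces_mem r p x y'"
  unfolding forces_mem_iff
proof (rule dense_below_bind[OF assms(2)[unfolded forces_mem_iff]])
  fix q assume q: "(q, p) \<in> r" "\<exists>d t. (d, t) \<in> elts y \<and> (q, t) \<in> r \<and> forces_eq r q x d"
  then obtain d t where d: "(d, t) \<in> elts y" "(q, t) \<in> r" "forces_eq r q x d" by blast
  show "dense_below r q (\<lambda>q. \<exists>d t. (d, t) \<in> elts y' \<and> (q, t) \<in> r \<and> forces_eq r q x d)"
    using forces_mem_cong_left[OF forces_eq_sym[OF d(3)] forces_eq_left[OF assms(1) d(1) q(1) d(2)]]
    unfolding forces_mem_iff .
qed

lemma forces_mem_dense: "dense_below r p (\<lambda>q. forces_mem r q x y) \<Longrightarrow> forces_mem r p x y"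
  unfolding forces_mem_iff by (rule dense_below_bind)

lemma forces_eq_dense:
  assumes "dense_below r p (\<lambda>q. forces_eq r q x y)"
  shows "forces_eq r p x y"
proof (rule forces_eqI)
  fix c s q assume c: "(c, s) \<in> elts x" "(q, p) \<in> r" "(q, s) \<in> r"
  show "forces_mem r q c y"
  proof (rule forces_mem_dense, rule dense_below_weaken[OF dense_below_mono[OF assms c(2)]])
    fix v assume v: "(v, q) \<in> r" "forces_eq r v x y"
    then show "forces_mem r v c y"
      using forces_eq_left[OF v(2) c(1) order_refl1[OF v(1)]] order_trans c(3) by blast
  qed
next
  fix c s q assume c: "(c, s) \<in> elts y" "(q, p) \<in> r" "(q, s) \<in> r"
  show "forces_mem r q c x"
  proof (rule forces_mem_dense, rule dense_below_weaken[OF dense_below_mono[OF assms c(2)]])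
    fix v assume v: "(v, q) \<in> r" "forces_eq r v x y"
    then show "forces_mem r v c x"
      using forces_eq_right[OF v(2) c(1) order_refl1[OF v(1)]] order_trans c(3) by blast
  qed
qed

text \<open>Together with \<open>forces_mono\<close> this makes forcing a local property. In the
  case of \<open>Neg\<close>, a condition forcing the formula would have an extension that forces
  its negation.\<close>

lemma forces_dense: "dense_below r p (\<lambda>q. forces r q s \<phi>) \<Longrightarrow> forces r p s \<phi>"
proof (induction \<phi> arbitrary: s p)
  case (Neg \<phi>)
  have False if q: "(q, p) \<in> r" "forces r q s \<phi>" for q
  proof -
    from dense_belowE[OF Neg.prems q(1)] obtain v where v: "(v, q) \<in> r" "forces r v s (Neg \<phi>)" .
    then show False using forces_mono[OF q(2) v(1)] order_refl1[OF v(1)] by simp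
  qed
  then show ?case by auto
next
  case (And \<phi> \<psi>)
  then show ?case using dense_below_weaken[OF And.prems] by simp
next
  case (Forall n \<phi>)
  have "forces r p (s(n := x)) \<phi>" for x
    by (rule Forall.IH, rule dense_below_weaken[OF Forall.prems]) (unfold forces.simps, blast)
  then show ?case by simp
next
  case (Mem i j)
  then show ?case using forces_mem_dense by simp
next
  case (Eq i j)
  then show ?case using forces_eq_dense by simp
qed

section \<open>Forcing clauses of the derived connectives\<close>

lemma forces_Or:
  "forces r p s (Or \<phi> \<psi>) \<longleftrightarrow> dense_below r p (\<lambda>q. forces r q s \<phi> \<or> forces r q s \<psi>)"
  unfolding dense_below_def forces.simps by blast

lemma forces_Exists:
  "forces r p s (Exists n \<phi>) \<longleftrightarrow> dense_below r p (\<lambda>q. \<exists>x. forces r q (s(n := x)) \<phi>)"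
  unfolding dense_below_def forces.simps by blast

text \<open>The encoding by \<open>Neg\<close> and \<open>And\<close> only yields the conclusion
  densely below \<open>q\<close>; \<open>forces_dense\<close> removes the density.\<close>

lemma forces_Imp:
  "forces r p s (Imp \<phi> \<psi>) \<longleftrightarrow> (\<forall>q. (q, p) \<in> r \<longrightarrow> forces r q s \<phi> \<longrightarrow> forces r q s \<psi>)"
proof
  assume *: "forces r p s (Imp \<phi> \<psi>)"
  show "\<forall>q. (q, p) \<in> r \<longrightarrow> forces r q s \<phi> \<longrightarrow> forces r q s \<psi>"
  proof (intro allI impI)
    fix q assume q: "(q, p) \<in> r" "forces r q s \<phi>"
    show "forces r q s \<psi>"
    proof (rule forces_dense, rule dense_belowI)
      fix v assume v: "(v, q) \<in> r"
      have "forces r v s \<phi>" "(v, p) \<in> r" using forces_mono[OF q(2) v] order_trans[OF v q(1)] .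
      then show "\<exists>q'. (q', v) \<in> r \<and> forces r q' s \<psi>" using * by auto
    qed
  qed
next
  assume *: "\<forall>q. (q, p) \<in> r \<longrightarrow> forces r q s \<phi> \<longrightarrow> forces r q s \<psi>"
  have False if "(q, p) \<in> r" "forces r q s \<phi>" "\<forall>q'. (q', q) \<in> r \<longrightarrow> \<not> forces r q' s \<psi>" for q
    using * that order_refl1 by blast
  then show "forces r p s (Imp \<phi> \<psi>)" by auto
qed

lemma forces_Iff:
  "forces r p s (Iff \<phi> \<psi>) \<longleftrightarrow> (\<forall>q. (q, p) \<in> r \<longrightarrow> (forces r q s \<phi> \<longleftrightarrow> forces r q s \<psi>))"
  by (subst forces.simps(4)) (simp only: forces_Imp, blast)

end

section \<open>Forcing a surjection\<close>

context forcing_order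
begin

text \<open>Extensionality for the forcing relation. It turns a forced description of the members of
  a set into equality with an explicit name.\<close>

lemma forces_mem_all_iff_eq:
  assumes "\<And>q z. (q, p) \<in> r \<Longrightarrow> forces_mem r q z x \<longleftrightarrow> forces_mem r q z y"
  shows "forces_eq r p x y"
proof (rule forces_eqI)
  fix c s q assume c: "(c, s) \<in> elts x" "(q, p) \<in> r" "(q, s) \<in> r"
  show "forces_mem r q c y" using forces_mem_elt[OF c(1,3)] assms[OF c(2)] by simp
next
  fix c s q assume c: "(c, s) \<in> elts y" "(q, p) \<in> r" "(q, s) \<in> r"
  show "forces_mem r q c x" using forces_mem_elt[OF c(1,3)] assms[OF c(2)] by simp
qed

lemma forces_mem_cong:
  assumes "forces_eq r p x y" "(q, p) \<in> r"
  shows "forces_mem r q z x \<longleftrightarrow> forces_mem r q z y"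
  using forces_mem_cong_right[OF forces_eq_mono[OF assms]]
    forces_mem_cong_right[OF forces_eq_sym[OF forces_eq_mono[OF assms]]] by (rule iffI)

lemma dense_below_cong_on:
  "(\<And>q. (q, p) \<in> r \<Longrightarrow> D q \<longleftrightarrow> D' q) \<Longrightarrow> dense_below r p D \<longleftrightarrow> dense_below r p D'"
  using dense_below_weaken[of p D D'] dense_below_weaken[of p D' D] by blast

text \<open>Two different indices are needed for the two elements; \<open>i\<close> is one of them.\<close>

definition upair_name :: "'i \<Rightarrow> ('i, 'p) pname \<Rightarrow> ('i, 'p) pname \<Rightarrow> ('i, 'p) pname" where
  "upair_name i x y = Name (\<lambda>(k, p). if p \<in> Field r then Some (if k = i then x else y, p) else None)"

definition pair_name :: "'i \<Rightarrow> ('i, 'p) pname \<Rightarrow> ('i, 'p) pname \<Rightarrow> ('i, 'p) pname" where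
  "pair_name i x y = upair_name i (upair_name i x x) (upair_name i x y)"

context
  fixes i i' :: 'i
  assumes index: "i' \<noteq> i"
begin

lemma elts_upair_name: "(z, p) \<in> elts (upair_name i x y) \<longleftrightarrow> p \<in> Field r \<and> (z = x \<or> z = y)"
proof
  assume "(z, p) \<in> elts (upair_name i x y)"
  then show "p \<in> Field r \<and> (z = x \<or> z = y)"
    by (auto simp: upair_name_def ran_def split: if_splits)
next
  assume *: "p \<in> Field r \<and> (z = x \<or> z = y)"
  \<comment> \<open>Both elements must really occur as entries: index \<open>i\<close> carries
    \<open>x\<close>, and any other index, such as \<open>i'\<close>, carries
    \<open>y\<close>.\<close>
  define k where "k = (if z = x then i else i')"
  have "(\<lambda>(k, p). if p \<in> Field r then Some (if k = i then x else y, p) else None) (k, p) = Some (z, p)"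
    using * index by (auto simp: k_def)
  then show "(z, p) \<in> elts (upair_name i x y)"
    unfolding upair_name_def elts.simps by (rule ranI)
qed

lemma forces_mem_upair_name:
  "forces_mem r p z (upair_name i x y) \<longleftrightarrow> dense_below r p (\<lambda>q. forces_eq r q z x \<or> forces_eq r q z y)"
  unfolding forces_mem_iff elts_upair_name
proof (rule dense_below_cong_on)
  fix q assume "(q, p) \<in> r"
  then have "q \<in> Field r" "(q, q) \<in> r" using order_refl1 by (auto simp: Field_def)
  then show "(\<exists>d t. (t \<in> Field r \<and> (d = x \<or> d = y)) \<and> (q, t) \<in> r \<and> forces_eq r q z d) \<longleftrightarrow>
      forces_eq r q z x \<or> forces_eq r q z y"
    by blast
qed

text \<open>The formula becomes an equality with a concrete name, after which pairs can be treated
  by \<open>forces_eq\<close> alone.\<close>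

lemma forces_upair_fm:
  assumes "7 \<notin> {w, x, y}"
  shows "forces r p s (upair_fm w x y) \<longleftrightarrow> forces_eq r p (s w) (upair_name i (s x) (s y))"
proof -
  have "forces r p s (upair_fm w x y) \<longleftrightarrow> (\<forall>z q. (q, p) \<in> r \<longrightarrow>
      (forces_mem r q z (s w) \<longleftrightarrow> forces_mem r q z (upair_name i (s x) (s y))))"
    using assms unfolding upair_fm_def forces.simps(5) forces_Iff forces_Or forces_mem_upair_name
    by simp
  also have "\<dots> \<longleftrightarrow> forces_eq r p (s w) (upair_name i (s x) (s y))"
    using forces_mem_all_iff_eq[of p "s w"] forces_mem_cong[of p "s w"] by blast
  finally show ?thesis .
qed

lemma forces_pair_fm:
  assumes "6 \<notin> {z, x, y}" "7 \<notin> {z, x, y}"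
  shows "forces r p s (pair_fm z x y) \<longleftrightarrow> forces_eq r p (s z) (pair_name i (s x) (s y))"
proof -
  have "forces r p s (pair_fm z x y) \<longleftrightarrow> (\<forall>u q. (q, p) \<in> r \<longrightarrow>
      (forces_mem r q u (s z) \<longleftrightarrow> forces_mem r q u (pair_name i (s x) (s y))))"
    using assms unfolding pair_fm_def pair_name_def forces.simps(5) forces_Iff forces_Or
      forces_mem_upair_name
    by (simp add: forces_upair_fm)
  also have "\<dots> \<longleftrightarrow> forces_eq r p (s z) (pair_name i (s x) (s y))"
    using forces_mem_all_iff_eq[of p "s z"] forces_mem_cong[of p "s z"] by blast
  finally show ?thesis .
qed

lemma upair_name_cong:
  assumes "forces_eq r p x x'" "forces_eq r p y y'"
  shows "forces_eq r p (upair_name i x y) (upair_name i x' y')"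
proof (rule forces_mem_all_iff_eq)
  fix q z assume q: "(q, p) \<in> r"
  show "forces_mem r q z (upair_name i x y) \<longleftrightarrow> forces_mem r q z (upair_name i x' y')"
    unfolding forces_mem_upair_name
  proof (rule dense_below_cong_on)
    fix v assume "(v, q) \<in> r"
    then have "(v, p) \<in> r" using order_trans q by blast
    note eq = forces_eq_mono[OF assms(1) this] forces_eq_mono[OF assms(2) this]
    show "forces_eq r v z x \<or> forces_eq r v z y \<longleftrightarrow> forces_eq r v z x' \<or> forces_eq r v z y'"
      using forces_eq_trans[OF _ eq(1)] forces_eq_trans[OF _ eq(2)]
        forces_eq_trans[OF _ forces_eq_sym[OF eq(1)]] forces_eq_trans[OF _ forces_eq_sym[OF eq(2)]]
      by blast
  qed
qed

lemma pair_name_cong: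
  assumes "forces_eq r p x x'" "forces_eq r p y y'"
  shows "forces_eq r p (pair_name i x y) (pair_name i x' y')"
  unfolding pair_name_def by (intro upair_name_cong assms)

lemma upair_name_memD:
  assumes "forces_eq r p w (upair_name i x y)"
  shows "forces_mem r p x w" "forces_mem r p y w"
proof -
  have "forces_mem r p x (upair_name i x y)" "forces_mem r p y (upair_name i x y)"
    unfolding forces_mem_upair_name using forces_eq_refl by (auto intro: dense_below_all)
  then show "forces_mem r p x w" "forces_mem r p y w"
    using forces_mem_cong_right[OF forces_eq_sym[OF assms]] by blast+
qed

lemma singleton_name_eqD:
  assumes "forces_eq r p (upair_name i x x) (upair_name i a b)"
  shows "forces_eq r p x a"
proof (rule forces_eq_sym, rule forces_eq_dense)
  show "dense_below r p (\<lambda>q. forces_eq r q a x)"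
    using upair_name_memD(1)[OF assms] unfolding forces_mem_upair_name by simp
qed

lemma pair_name_fst:
  assumes "forces_eq r p (pair_name i x y) (pair_name i x' y')"
  shows "forces_eq r p x x'"
proof -
  have "forces_mem r p (upair_name i x x) (pair_name i x' y')"
    using upair_name_memD(1)[OF forces_eq_sym[OF assms, unfolded pair_name_def[of i x y]]] .
  then have "dense_below r p (\<lambda>q. forces_eq r q x x')"
    unfolding pair_name_def forces_mem_upair_name
    by (rule dense_below_weaken) (use singleton_name_eqD in blast)
  then show ?thesis by (rule forces_eq_dense)
qed

lemma pair_name_second:
  assumes "forces_eq r p (pair_name i x y) (pair_name i x' y')"
  shows "dense_below r p (\<lambda>q. forces_eq r q y x' \<or> forces_eq r q y y')"
proof -
  have "forces_mem r p (upair_name i x y) (pair_name i x' y')"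
    using upair_name_memD(2)[OF forces_eq_sym[OF assms, unfolded pair_name_def[of i x y]]] .
  then show ?thesis
    unfolding pair_name_def[of i x' y'] forces_mem_upair_name[of p "upair_name i x y"]
  proof (rule dense_below_bind)
    fix q assume "(q, p) \<in> r" "forces_eq r q (upair_name i x y) (upair_name i x' x') \<or>
      forces_eq r q (upair_name i x y) (upair_name i x' y')"
    then consider "forces_eq r q (upair_name i x' x') (upair_name i x y)"
      | "forces_eq r q (upair_name i x' y') (upair_name i x y)" using forces_eq_sym by blast
    then show "dense_below r q (\<lambda>q. forces_eq r q y x' \<or> forces_eq r q y y')"
    proof cases
      case 1
      from upair_name_memD(2)[OF 1] show ?thesis
        unfolding forces_mem_upair_name by (rule dense_below_weaken) blast
    next
      case 2
      from upair_name_memD(2)[OF 2] show ?thesis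
        unfolding forces_mem_upair_name .
    qed
  qed
qed

text \<open>Comparing the second components in both directions leaves one crossed case,
  \<open>y = x'\<close> and \<open>y' = x\<close>; equality of the first components settles
  it.\<close>

lemma pair_name_snd:
  assumes "forces_eq r p (pair_name i x y) (pair_name i x' y')"
  shows "forces_eq r p y y'"
proof (rule forces_eq_dense, rule dense_below_bind[OF pair_name_second[OF assms]])
  fix q assume q: "(q, p) \<in> r" "forces_eq r q y x' \<or> forces_eq r q y y'"
  show "dense_below r q (\<lambda>q. forces_eq r q y y')"
    using dense_below_mono[OF pair_name_second[OF forces_eq_sym[OF assms]] q(1)]
  proof (rule dense_below_weaken)
    fix v assume v: "(v, q) \<in> r" "forces_eq r v y' x \<or> forces_eq r v y' y"
    have x: "forces_eq r v x x'" using forces_eq_mono[OF pair_name_fst[OF assms]] order_trans v q by blast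
    from q(2) forces_eq_mono[OF _ v(1)] have "forces_eq r v y x' \<or> forces_eq r v y y'" by blast
    then show "forces_eq r v y y'"
    proof
      assume y: "forces_eq r v y x'"
      from v(2) show ?thesis
      proof
        assume "forces_eq r v y' x"
        then show ?thesis using y x forces_eq_sym forces_eq_trans by metis
      qed (erule forces_eq_sym)
    qed
  qed
qed

lemma forces_app_fm:
  assumes "f \<notin> {5, 6, 7}" "x \<notin> {5, 6, 7}" "y \<notin> {5, 6, 7}"
  shows "forces r p s (app_fm f x y) \<longleftrightarrow> forces_mem r p (pair_name i (s x) (s y)) (s f)"
proof -
  have "forces r p s (app_fm f x y) \<longleftrightarrow>
      dense_below r p (\<lambda>q. \<exists>w. forces_mem r q w (s f) \<and> forces_eq r q w (pair_name i (s x) (s y)))"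
    using assms unfolding app_fm_def forces_Exists by (simp add: forces_pair_fm)
  also have "\<dots> \<longleftrightarrow> forces_mem r p (pair_name i (s x) (s y)) (s f)"
  proof
    assume *: "dense_below r p (\<lambda>q. \<exists>w. forces_mem r q w (s f) \<and> forces_eq r q w (pair_name i (s x) (s y)))"
    show "forces_mem r p (pair_name i (s x) (s y)) (s f)"
      by (rule forces_mem_dense, rule dense_below_weaken[OF *]) (use forces_mem_cong_left in blast)
  next
    assume "forces_mem r p (pair_name i (s x) (s y)) (s f)"
    then show "dense_below r p (\<lambda>q. \<exists>w. forces_mem r q w (s f) \<and> forces_eq r q w (pair_name i (s x) (s y)))"
      using forces_mem_mono forces_eq_refl by (intro dense_below_all) blast
  qed
  finally show ?thesis .
qed

end

context
  fixes \<kappa> :: "'k rel"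
  assumes \<kappa>: "Well_order \<kappa>"
begin

section \<open>Canonical names of ordinals, and the name of the surjection\<close>

lemma elts_check_elt:
  "(z, p) \<in> elts (check_elt r \<kappa> \<alpha>) \<longleftrightarrow>
    (\<exists>\<beta>. (\<beta>, \<alpha>) \<in> \<kappa> - Id \<and> p \<in> Field r \<and> z = check_elt r \<kappa> \<beta>)"
  by (subst check_elt_unfold[OF \<kappa>]) (auto simp: ran_def split: if_splits)

lemma forces_mem_check_elt:
  "forces_mem r p z (check_elt r \<kappa> \<alpha>) \<longleftrightarrow>
    dense_below r p (\<lambda>q. \<exists>\<beta>. (\<beta>, \<alpha>) \<in> \<kappa> - Id \<and> forces_eq r q z (check_elt r \<kappa> \<beta>))"
  unfolding forces_mem_iff elts_check_elt
proof (rule dense_below_cong_on)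
  fix q assume "(q, p) \<in> r"
  then have "q \<in> Field r" "(q, q) \<in> r" using order_refl1 by (auto simp: Field_def)
  then show "(\<exists>d t. (\<exists>\<beta>. (\<beta>, \<alpha>) \<in> \<kappa> - Id \<and> t \<in> Field r \<and> d = check_elt r \<kappa> \<beta>) \<and> (q, t) \<in> r \<and> forces_eq r q z d)
    \<longleftrightarrow> (\<exists>\<beta>. (\<beta>, \<alpha>) \<in> \<kappa> - Id \<and> forces_eq r q z (check_elt r \<kappa> \<beta>))"
    by blast
qed

lemma elts_check_ord:
  "(z, p) \<in> elts (check_ord r \<kappa>) \<longleftrightarrow> (\<exists>\<beta>\<in>Field \<kappa>. p \<in> Field r \<and> z = check_elt r \<kappa> \<beta>)"
  by (auto simp: check_ord_def ran_def split: if_splits)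

lemma forces_mem_check_ord:
  "forces_mem r p z (check_ord r \<kappa>) \<longleftrightarrow>
    dense_below r p (\<lambda>q. \<exists>\<beta>\<in>Field \<kappa>. forces_eq r q z (check_elt r \<kappa> \<beta>))"
  unfolding forces_mem_iff elts_check_ord
proof (rule dense_below_cong_on)
  fix q assume "(q, p) \<in> r"
  then have "q \<in> Field r" "(q, q) \<in> r" using order_refl1 by (auto simp: Field_def)
  then show "(\<exists>d t. (\<exists>\<beta>\<in>Field \<kappa>. t \<in> Field r \<and> d = check_elt r \<kappa> \<beta>) \<and> (q, t) \<in> r \<and> forces_eq r q z d)
    \<longleftrightarrow> (\<exists>\<beta>\<in>Field \<kappa>. forces_eq r q z (check_elt r \<kappa> \<beta>))"
    by blast
qed

text \<open>If the names were equal, the name of \<open>\<alpha>\<close> would be forced to be an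
  element of itself. Some extension would then force it equal to the name of an ordinal below
  \<open>\<alpha>\<close>, against the induction hypothesis.\<close>

lemma check_elt_strict:
  "p \<in> Field r \<Longrightarrow> (\<alpha>, \<beta>) \<in> \<kappa> - Id \<Longrightarrow> \<not> forces_eq r p (check_elt r \<kappa> \<alpha>) (check_elt r \<kappa> \<beta>)"
proof -
  have "wf (\<kappa> - Id)" using \<kappa> by (simp add: well_order_on_def)
  then show "p \<in> Field r \<Longrightarrow> (\<alpha>, \<beta>) \<in> \<kappa> - Id \<Longrightarrow> \<not> forces_eq r p (check_elt r \<kappa> \<alpha>) (check_elt r \<kappa> \<beta>)"
  proof (induction \<alpha> arbitrary: p \<beta> rule: wf_induct_rule)
    case (less \<alpha>)
    show ?case
    proof
      assume eq: "forces_eq r p (check_elt r \<kappa> \<alpha>) (check_elt r \<kappa> \<beta>)"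
      have "forces_mem r p (check_elt r \<kappa> \<alpha>) (check_elt r \<kappa> \<beta>)"
        unfolding forces_mem_check_elt[of p _ \<beta>]
        by (rule dense_below_all) (use less.prems(2) forces_eq_refl in blast)
      then have "forces_mem r p (check_elt r \<kappa> \<alpha>) (check_elt r \<kappa> \<alpha>)"
        by (rule forces_mem_cong_right[OF forces_eq_sym[OF eq]])
      from dense_belowE[OF this[unfolded forces_mem_check_elt[of p _ \<alpha>]] order_refl[OF less.prems(1)]]
      obtain q \<gamma> where q: "(q, p) \<in> r" "(\<gamma>, \<alpha>) \<in> \<kappa> - Id"
        "forces_eq r q (check_elt r \<kappa> \<alpha>) (check_elt r \<kappa> \<gamma>)" by blast
      have "q \<in> Field r" using q(1) by (auto simp: Field_def)
      from less.IH[OF q(2) this q(2)] show False using forces_eq_sym[OF q(3)] by blast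
    qed
  qed
qed

lemma check_elt_inject:
  assumes "p \<in> Field r" "\<alpha> \<in> Field \<kappa>" "\<beta> \<in> Field \<kappa>"
    and eq: "forces_eq r p (check_elt r \<kappa> \<alpha>) (check_elt r \<kappa> \<beta>)"
  shows "\<alpha> = \<beta>"
proof (rule ccontr)
  assume ne: "\<alpha> \<noteq> \<beta>"
  then have "(\<alpha>, \<beta>) \<in> \<kappa> \<or> (\<beta>, \<alpha>) \<in> \<kappa>"
    using \<kappa> assms(2,3) by (auto simp: well_order_on_def linear_order_on_def total_on_def)
  then show False
    using check_elt_strict[OF assms(1)] eq forces_eq_sym[OF eq] ne by blast
qed

text \<open>\<open>R a \<beta> q\<close> says that \<open>q\<close> decides the value at \<open>a\<close> of the generic surjection from \<open>\<alpha>\<close>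
  onto \<open>\<kappa>\<close> to be \<open>\<beta>\<close>.\<close>

theorem forces_not_cardinal_fm:
  fixes s :: "nat \<Rightarrow> ('k, 'p) pname"
  assumes \<alpha>: "\<alpha> \<in> Field \<kappa>" and p: "p \<in> Field r"
    and s: "s 0 = check_ord r \<kappa>"
    and two: "i' \<noteq> (i :: 'k)"
    and R_dom: "\<And>a \<beta> q. R a \<beta> q \<Longrightarrow> (a, \<alpha>) \<in> \<kappa> - Id \<and> \<beta> \<in> Field \<kappa>"
    and R_mono: "\<And>a \<beta> q t. R a \<beta> q \<Longrightarrow> (t, q) \<in> r \<Longrightarrow> R a \<beta> t"
    and R_fun: "\<And>a \<beta> \<beta>' q. R a \<beta> q \<Longrightarrow> R a \<beta>' q \<Longrightarrow> \<beta> = \<beta>'"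
    and R_total: "\<And>a q. (a, \<alpha>) \<in> \<kappa> - Id \<Longrightarrow> (q, p) \<in> r \<Longrightarrow> \<exists>t \<beta>. (t, q) \<in> r \<and> R a \<beta> t"
    and R_onto: "\<And>\<beta> q. \<beta> \<in> Field \<kappa> \<Longrightarrow> (q, p) \<in> r \<Longrightarrow> \<exists>t a. (t, q) \<in> r \<and> R a \<beta> t"
  shows "forces r p s not_cardinal_fm"
proof -
  let ?c = "check_elt r \<kappa>"
  \<comment> \<open>By \<open>R_fun\<close> there is at most one value for each \<open>a\<close> and
    \<open>t\<close>, so the entries of the name can be indexed by exactly these pairs, as the type
    of names requires.\<close>
  define F :: "('k, 'p) pname" where
    "F = Name (\<lambda>(a, t). if t \<in> Field r \<and> (\<exists>\<beta>. R a \<beta> t)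
      then Some (pair_name i (?c a) (?c (THE \<beta>. R a \<beta> t)), t) else None)"
  have the: "(THE \<beta>. R a \<beta> t) = \<beta>" if "R a \<beta> t" for a \<beta> t
    using that R_fun by blast
  have elts_F: "(z, t) \<in> elts F \<longleftrightarrow> t \<in> Field r \<and> (\<exists>a \<beta>. R a \<beta> t \<and> z = pair_name i (?c a) (?c \<beta>))" for z t
  proof
    assume "(z, t) \<in> elts F"
    then show "t \<in> Field r \<and> (\<exists>a \<beta>. R a \<beta> t \<and> z = pair_name i (?c a) (?c \<beta>))"
      unfolding F_def using the by (auto simp: ran_def split: if_splits) blast
  next
    assume "t \<in> Field r \<and> (\<exists>a \<beta>. R a \<beta> t \<and> z = pair_name i (?c a) (?c \<beta>))"
    then obtain a \<beta> where *: "t \<in> Field r" "R a \<beta> t" "z = pair_name i (?c a) (?c \<beta>)" by blast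
    then show "(z, t) \<in> elts F"
      unfolding F_def elts.simps using the[OF *(2)] by (intro ranI[where a = "(a, t)"]) auto
  qed
  \<comment> \<open>Since \<open>R\<close> persists to stronger conditions, the condition attached
    to an entry can be replaced by the condition \<open>v\<close> at hand.\<close>
  have mem_F: "forces_mem r q z F \<longleftrightarrow>
      dense_below r q (\<lambda>v. \<exists>a \<beta>. R a \<beta> v \<and> forces_eq r v z (pair_name i (?c a) (?c \<beta>)))" for q z
    unfolding forces_mem_iff elts_F
  proof (rule dense_below_cong_on)
    fix v assume "(v, q) \<in> r"
    then have "v \<in> Field r" "(v, v) \<in> r" using order_refl1 by (auto simp: Field_def)
    then show "(\<exists>d t. (t \<in> Field r \<and> (\<exists>a \<beta>. R a \<beta> t \<and> d = pair_name i (?c a) (?c \<beta>))) \<and> (v, t) \<in> r \<and> forces_eq r v z d)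
      \<longleftrightarrow> (\<exists>a \<beta>. R a \<beta> v \<and> forces_eq r v z (pair_name i (?c a) (?c \<beta>)))"
      using R_mono by blast
  qed
  have app_F: "forces_mem r q (pair_name i x y) F \<longleftrightarrow>
      dense_below r q (\<lambda>v. \<exists>a \<beta>. R a \<beta> v \<and> forces_eq r v x (?c a) \<and> forces_eq r v y (?c \<beta>))" for q x y
    unfolding mem_F
    by (rule dense_below_cong_on)
      (use pair_name_fst[OF two] pair_name_snd[OF two] pair_name_cong[OF two] in blast)
  define s' where "s' = s(1 := ?c \<alpha>, 2 := F)"
  have s': "s' 0 = check_ord r \<kappa>" "s' 1 = ?c \<alpha>" "s' 2 = F" using s by (auto simp: s'_def)
  have part1: "forces r p s' (Forall 5 (Imp (Mem 5 2)
           (Exists 3 (And (Mem 3 1) (Exists 4 (And (Mem 4 0) (pair_fm 5 3 4)))))))"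
  proof -
    have "dense_below r q (\<lambda>q. \<exists>x. forces_mem r q x (?c \<alpha>) \<and>
        dense_below r q (\<lambda>q. \<exists>y. forces_mem r q y (check_ord r \<kappa>) \<and> forces_eq r q z (pair_name i x y)))"
      if "(q, p) \<in> r" "forces_mem r q z F" for z q
      using that(2)[unfolded mem_F]
    proof (rule dense_below_weaken)
      fix v assume v: "(v, q) \<in> r" "\<exists>a \<beta>. R a \<beta> v \<and> forces_eq r v z (pair_name i (?c a) (?c \<beta>))"
      then obtain a \<beta> where *: "R a \<beta> v" "forces_eq r v z (pair_name i (?c a) (?c \<beta>))" by blast
      have a: "forces_mem r v (?c a) (?c \<alpha>)"
        unfolding forces_mem_check_elt[of v _ \<alpha>]
        by (rule dense_below_all) (use R_dom[OF *(1)] forces_eq_refl in blast)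
      have \<beta>: "forces_mem r t (?c \<beta>) (check_ord r \<kappa>)" for t
        unfolding forces_mem_check_ord
        by (rule dense_below_all) (use R_dom[OF *(1)] forces_eq_refl in blast)
      have "dense_below r v (\<lambda>q. \<exists>y. forces_mem r q y (check_ord r \<kappa>) \<and> forces_eq r q z (pair_name i (?c a) y))"
        by (rule dense_below_all) (use \<beta> forces_eq_mono[OF *(2)] in blast)
      then show "\<exists>x. forces_mem r v x (?c \<alpha>) \<and>
        dense_below r v (\<lambda>q. \<exists>y. forces_mem r q y (check_ord r \<kappa>) \<and> forces_eq r q z (pair_name i x y))"
        using a by blast
    qed
    then show ?thesis
      unfolding forces.simps(5) forces_Imp forces_Exists
      using s' by (simp add: forces_Exists forces_pair_fm[OF two] del: forces.simps(3))
  qed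
  have c_\<alpha>: "forces_mem r v (?c a) (?c \<alpha>)" if "R a \<beta> q" for a \<beta> q v
    unfolding forces_mem_check_elt[of v _ \<alpha>]
    by (rule dense_below_all) (use R_dom[OF that] forces_eq_refl in blast)
  have part2: "forces r p s' (Forall 3 (Imp (Mem 3 1)
           (Exists 4 (And (app_fm 2 3 4) (Forall 8 (Imp (app_fm 2 3 8) (Eq 8 4)))))))"
  proof -
    have "dense_below r q (\<lambda>q. \<exists>y. forces_mem r q (pair_name i z y) F \<and>
        (\<forall>w t. (t, q) \<in> r \<longrightarrow> forces_mem r t (pair_name i z w) F \<longrightarrow> forces_eq r t w y))"
      if q: "(q, p) \<in> r" "forces_mem r q z (?c \<alpha>)" for z q
    proof (rule dense_belowI)
      fix v assume v: "(v, q) \<in> r"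
      from dense_belowE[OF q(2)[unfolded forces_mem_check_elt] v] obtain u a where
        u: "(u, v) \<in> r" "(u, q) \<in> r" "(a, \<alpha>) \<in> \<kappa> - Id" "forces_eq r u z (?c a)" by blast
      from R_total[OF u(3) order_trans[OF u(2) q(1)]] obtain t \<beta> where t: "(t, u) \<in> r" "R a \<beta> t" by blast
      have za: "forces_eq r t z (?c a)" using forces_eq_mono[OF u(4) t(1)] .
      have "forces_mem r t (pair_name i z (?c \<beta>)) F"
        unfolding app_F
        by (rule dense_below_all) (use R_mono[OF t(2)] forces_eq_mono[OF za] forces_eq_refl in blast)
      \<comment> \<open>Uniqueness of the value: densely below \<open>x\<close>, the value
        \<open>w\<close> comes from a decision of \<open>R\<close> at some \<open>a'\<close>. Names
        of distinct ordinals are never forced equal, so \<open>a' = a\<close>, and functionality of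
        \<open>R\<close> applies.\<close>
      moreover have "forces_eq r x w (?c \<beta>)"
        if x: "(x, t) \<in> r" "forces_mem r x (pair_name i z w) F" for w x
      proof (rule forces_eq_dense, rule dense_below_weaken[OF x(2)[unfolded app_F]])
        fix y assume y: "(y, x) \<in> r" "\<exists>a \<beta>. R a \<beta> y \<and> forces_eq r y z (?c a) \<and> forces_eq r y w (?c \<beta>)"
        then obtain a' \<beta>' where *: "R a' \<beta>' y" "forces_eq r y z (?c a')" "forces_eq r y w (?c \<beta>')" by blast
        have yt: "(y, t) \<in> r" using order_trans[OF y(1) x(1)] .
        have "forces_eq r y (?c a) (?c a')"
          using forces_eq_trans[OF forces_eq_sym[OF forces_eq_mono[OF za yt]] *(2)] .
        then have "a = a'"
          using R_dom[OF t(2)] R_dom[OF *(1)] yt by (intro check_elt_inject[of y a a']) (auto simp: Field_def)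
        then have "\<beta>' = \<beta>" using R_fun R_mono[OF t(2) yt] *(1) by blast
        then show "forces_eq r y w (?c \<beta>)" using *(3) by simp
      qed
      ultimately show "\<exists>t. (t, v) \<in> r \<and> (\<exists>y. forces_mem r t (pair_name i z y) F \<and>
        (\<forall>w x. (x, t) \<in> r \<longrightarrow> forces_mem r x (pair_name i z w) F \<longrightarrow> forces_eq r x w y))"
        using order_trans[OF t(1) u(1)] by blast
    qed
    then show ?thesis
      unfolding forces.simps(5) forces_Imp forces_Exists
      using s' by (simp add: forces_Imp forces_app_fm[OF two] del: forces.simps(3))
  qed
  have part3: "forces r p s' (Forall 4 (Imp (Mem 4 0) (Exists 3 (And (Mem 3 1) (app_fm 2 3 4)))))"
  proof -
    have "dense_below r q (\<lambda>q. \<exists>x. forces_mem r q x (?c \<alpha>) \<and> forces_mem r q (pair_name i x z) F)"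
      if q: "(q, p) \<in> r" "forces_mem r q z (check_ord r \<kappa>)" for z q
    proof (rule dense_belowI)
      fix v assume v: "(v, q) \<in> r"
      from dense_belowE[OF q(2)[unfolded forces_mem_check_ord] v] obtain u \<beta> where
        u: "(u, v) \<in> r" "(u, q) \<in> r" "\<beta> \<in> Field \<kappa>" "forces_eq r u z (?c \<beta>)" by blast
      from R_onto[OF u(3) order_trans[OF u(2) q(1)]] obtain t a where t: "(t, u) \<in> r" "R a \<beta> t" by blast
      have "forces_mem r t (pair_name i (?c a) z) F"
        unfolding app_F
        by (rule dense_below_all)
          (use R_mono[OF t(2)] forces_eq_mono[OF forces_eq_mono[OF u(4) t(1)]] forces_eq_refl in blast)
      then show "\<exists>t. (t, v) \<in> r \<and> (\<exists>x. forces_mem r t x (?c \<alpha>) \<and> forces_mem r t (pair_name i x z) F)"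
        using c_\<alpha>[OF t(2)] order_trans[OF t(1) u(1)] by blast
    qed
    then show ?thesis
      unfolding forces.simps(5) forces_Imp forces_Exists
      using s' by (simp add: forces_app_fm[OF two] del: forces.simps(3))
  qed
  have *: "forces r q s' surjection_fm" if "(q, p) \<in> r" for q
    using part1 part2 part3 forces_mono[OF _ that] unfolding surjection_fm_def forces.simps(4) by blast
  have \<alpha>_mem: "forces_mem r q (?c \<alpha>) (s 0)" for q
    unfolding s forces_mem_check_ord by (rule dense_below_all) (use \<alpha> forces_eq_refl in blast)
  show ?thesis
    unfolding not_cardinal_fm_def forces_Exists
  proof (rule dense_below_all)
    fix q assume q: "(q, p) \<in> r"
    have "dense_below r q (\<lambda>q. \<exists>x. forces r q (s(1 := ?c \<alpha>, 2 := x)) surjection_fm)"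
    proof (rule dense_below_all)
      fix t assume "(t, q) \<in> r"
      then have "forces r t s' surjection_fm" using * order_trans q by blast
      then show "\<exists>x. forces r t (s(1 := ?c \<alpha>, 2 := x)) surjection_fm"
        unfolding s'_def by blast
    qed
    then have "forces r q (s(1 := ?c \<alpha>)) (And (Mem 1 0) (Exists 2 surjection_fm))"
      unfolding forces.simps(4) forces_Exists using \<alpha>_mem by simp
    then show "\<exists>x. forces r q (s(1 := x)) (And (Mem 1 0) (Exists 2 surjection_fm))" ..
  qed
qed

end

end

section \<open>Subcategories isomorphic to a partial order\<close>

lemma succ_card_well_order: "Well_order (succ_card \<delta>)"
  and succ_card_card_order: "Card_order (succ_card \<delta>)"
proof -
  show *: "Card_order (succ_card \<delta>)"
    unfolding succ_card_def by (intro cardSuc_Card_order card_of_Card_order)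
  then show "Well_order (succ_card \<delta>)" unfolding card_order_on_def by blast
qed

lemma card_less_succ_card: "(card_of (Field \<delta>), succ_card \<delta>) \<in> ordLess"
  unfolding succ_card_def by (intro cardSuc_greater card_of_Card_order)

lemma infinite_Field_succ_card:
  assumes "infinite (Field \<delta>)"
  shows "infinite (Field (succ_card \<delta>))"
  unfolding succ_card_def cardSuc_finite[OF card_of_Card_order] Field_card_of using assms .

context set_univ
begin

lemma zmodel_of: "transitive_ZFC_model mem \<delta> M \<Longrightarrow> zmodel M"
  by (simp add: transitive_ZFC_model_def zmodel_def)

lemma Field_height: "Field (height mem M) = M \<inter> ordinals mem"
  unfolding height_def Field_def by auto

text \<open>The least ordinal of \<open>N\<close> outside \<open>M\<close> would have precisely the
  ordinals of \<open>M\<close> as elements, so the height of \<open>M\<close> would be that of a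
  proper initial segment of the height of \<open>N\<close>.\<close>

lemma height_ordIso_subset:
  assumes M: "zmodel M" and N: "zmodel N" and iso: "(height mem M, height mem N) \<in> ordIso"
  shows "N \<inter> ordinals mem \<subseteq> M"
proof (rule ccontr)
  assume "\<not> ?thesis"
  then obtain b0 where b0: "b0 \<in> N \<and> b0 \<in> ordinals mem \<and> b0 \<notin> M" by blast
  from mem_minimal[of "\<lambda>b. b \<in> N \<and> b \<in> ordinals mem \<and> b \<notin> M", OF b0] obtain b where
    b: "b \<in> N" "b \<in> ordinals mem" "b \<notin> M"
    and min: "\<forall>a. mem a b \<longrightarrow> \<not> (a \<in> N \<and> a \<in> ordinals mem \<and> a \<notin> M)" by blast
  have below: "mem a b \<longleftrightarrow> a \<in> M \<and> a \<in> ordinals mem" for a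
  proof
    assume a: "mem a b"
    then show "a \<in> M \<and> a \<in> ordinals mem"
      using min zmodel_trans[OF N b(1) a] ordinal_mem[OF b(2) a] by blast
  next
    assume a: "a \<in> M \<and> a \<in> ordinals mem"
    then show "mem a b"
      using ordinal_trichotomy[of a b] b zmodel_trans[OF M, of a b] by blast
  qed
  have WN: "Well_order (height mem N)" using iso by (simp add: ordIso_def)
  have "underS (height mem N) b = M \<inter> ordinals mem"
    unfolding underS_def height_def using below b zmodel_trans[OF N b(1)] mem_irrefl by auto
  then have "Restr (height mem N) (underS (height mem N) b) = height mem M"
    unfolding height_def using below zmodel_trans[OF N b(1)] by auto
  moreover have "(Restr (height mem N) (underS (height mem N) b), height mem N) \<in> ordLess"
    using underS_Restr_ordLess[OF WN] Field_height[of N] b by auto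
  ultimately show False using iso not_ordLess_ordIso by auto
qed

text \<open>Isomorphism of heights is sharpened to equality, so that all embeddings act on one
  common set of ordinals.\<close>

lemma same_height_ordinals:
  assumes M: "transitive_ZFC_model mem \<delta> M" and N: "transitive_ZFC_model mem \<delta> N"
  shows "M \<inter> ordinals mem = N \<inter> ordinals mem"
proof -
  have "(height mem M, height mem N) \<in> ordIso" "(height mem N, height mem M) \<in> ordIso"
    using assms ordIso_transitive ordIso_symmetric unfolding transitive_ZFC_model_def by blast+
  then show ?thesis using height_ordIso_subset zmodel_of[OF M] zmodel_of[OF N] by blast
qed

lemma card_ordinals:
  assumes "transitive_ZFC_model mem \<delta> M"
  shows "(card_of (M \<inter> ordinals mem), card_of (Field \<delta>)) \<in> ordIso"
  using card_of_cong[of "height mem M" \<delta>] assms Field_height[of M]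
  unfolding transitive_ZFC_model_def by simp

text \<open>The inverse of the isomorphism labels models by nodes and embeddings by edges.
  Composites match because an edge is determined by its ends, and injectivity of \<open>M\<close> is
  what separates the models of different nodes.\<close>

lemma subcategory_system:
  assumes S: "subcategory S (elementary_cat mem \<delta>)" and iso: "isomorphic_cat S (poset_cat T)"
    and T: "Partial_order T"
  obtains M j where "\<And>x. x \<in> Field T \<Longrightarrow> transitive_ZFC_model mem \<delta> (M x)"
    and "\<And>x y. (x, y) \<in> T \<Longrightarrow> elementary_embedding mem (M x) (M y) (j x y)"
    and "\<And>x y z. (x, y) \<in> T \<Longrightarrow> (y, z) \<in> T \<Longrightarrow> j x z = compose (M x) (j y z) (j x y)"
    and "inj_on M (Field T)"
proof -
  let ?E = "elementary_cat mem \<delta>"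
  obtain F G where F: "bij_betw F (Obj S) (Field T)" and G: "bij_betw G (Arr S) T"
    and dom_cod: "\<And>f. f \<in> Arr S \<Longrightarrow> fst (G f) = F (Dom S f) \<and> snd (G f) = F (Cod S f)"
    and comp: "\<And>f g. f \<in> Arr S \<Longrightarrow> g \<in> Arr S \<Longrightarrow> Cod S f = Dom S g \<Longrightarrow>
      G (Comp S g f) = (fst (G f), snd (G g))"
    using iso unfolding isomorphic_cat_def poset_cat_def by auto
  define M where "M = inv_into (Obj S) F"
  define A where "A = inv_into (Arr S) G"
  define j where "j x y = fst (snd (A (x, y)))" for x y
  have A: "A e \<in> Arr S" "G (A e) = e" if "e \<in> T" for e
    using that G unfolding A_def by (auto simp: bij_betw_def inv_into_into f_inv_into_f)
  have M: "M x \<in> Obj S" "F (M x) = x" if "x \<in> Field T" for x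
    using that F unfolding M_def by (auto simp: bij_betw_def inv_into_into f_inv_into_f)
  have M_F: "M (F X) = X" if "X \<in> Obj S" for X
    using that F unfolding M_def by (simp add: bij_betw_def)
  have cat: "category S" and sub: "Obj S \<subseteq> Obj ?E" "Arr S \<subseteq> Arr ?E"
    and DC: "\<And>f. f \<in> Arr S \<Longrightarrow> Dom S f = Dom ?E f \<and> Cod S f = Cod ?E f"
    and CC: "\<And>f g. f \<in> Arr S \<Longrightarrow> g \<in> Arr S \<Longrightarrow> Cod S f = Dom S g \<Longrightarrow> Comp S g f = Comp ?E g f"
    using S unfolding subcategory_def by auto
  have objs: "Dom S f \<in> Obj S \<and> Cod S f \<in> Obj S" if "f \<in> Arr S" for f
    using cat[unfolded category_def, THEN conjunct1] that by blast
  have compS: "Comp S g f \<in> Arr S" if "f \<in> Arr S" "g \<in> Arr S" "Cod S f = Dom S g" for f g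
    using cat[unfolded category_def, THEN conjunct2, THEN conjunct2, THEN conjunct1] that by blast
  have ends: "Dom S (A (x, y)) = M x \<and> Cod S (A (x, y)) = M y" if "(x, y) \<in> T" for x y
    using dom_cod[OF A(1)[OF that]] A(2)[OF that] M_F objs[OF A(1)[OF that]] by (metis fst_conv snd_conv)
  have arr: "A (x, y) = (M x, j x y, M y) \<and> elementary_embedding mem (M x) (M y) (j x y)"
    if "(x, y) \<in> T" for x y
  proof -
    have "A (x, y) \<in> Arr ?E" using A(1)[OF that] sub(2) by blast
    then obtain X k Y where *: "A (x, y) = (X, k, Y)" "elementary_embedding mem X Y k"
      unfolding elementary_cat_def by auto
    then have "Dom ?E (A (x, y)) = X" "Cod ?E (A (x, y)) = Y"
      unfolding elementary_cat_def by auto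
    then have "M x = X" "M y = Y" using ends[OF that] DC[OF A(1)[OF that]] by auto
    moreover have "k = j x y" unfolding j_def * by simp
    ultimately show ?thesis using * by simp
  qed
  show ?thesis
  proof
    show "transitive_ZFC_model mem \<delta> (M x)" if "x \<in> Field T" for x
      using M(1)[OF that] sub(1) unfolding elementary_cat_def by auto
    show "elementary_embedding mem (M x) (M y) (j x y)" if "(x, y) \<in> T" for x y
      using arr[OF that] by blast
    show "inj_on M (Field T)"
      by (rule inj_on_inverseI[where g = F]) (rule M(2))
    show "j x z = compose (M x) (j y z) (j x y)" if xy: "(x, y) \<in> T" and yz: "(y, z) \<in> T" for x y z
    proof -
      have xz: "(x, z) \<in> T"
        using T xy yz unfolding partial_order_on_def preorder_on_def by (meson transD)
      have eq: "Cod S (A (x, y)) = Dom S (A (y, z))" using ends[OF xy] ends[OF yz] by simp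
      have "G (Comp S (A (y, z)) (A (x, y))) = (x, z)"
        using comp[OF A(1)[OF xy] A(1)[OF yz] eq] A(2)[OF xy] A(2)[OF yz] by simp
      moreover have "Comp S (A (y, z)) (A (x, y)) \<in> Arr S"
        using compS[OF A(1)[OF xy] A(1)[OF yz] eq] .
      ultimately have "Comp S (A (y, z)) (A (x, y)) = A (x, z)"
        using A[OF xz] G unfolding bij_betw_def by (metis inj_onD)
      then have "A (x, z) = Comp ?E (A (y, z)) (A (x, y))"
        using CC[OF A(1)[OF xy] A(1)[OF yz] eq] by simp
      also have "\<dots> = (M x, compose (M x) (j y z) (j x y), M z)"
        using arr[OF xy] arr[OF yz] unfolding elementary_cat_def by simp
      finally show ?thesis using arr[OF xz] by simp
    qed
  qed
qed

text \<open>A proper extension carries a different model, so the embedding leading there cannot fix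
  every ordinal. This is how \<open>extend\<close> supplies the hypothesis \<open>moved\<close> of
  \<open>drifting_system\<close>.\<close>

lemma subcategory_drift:
  assumes S: "subcategory S (elementary_cat mem \<delta>)" and iso: "isomorphic_cat S (poset_cat T)"
    and T: "Partial_order T" and p: "p \<in> Field T"
    and extend: "\<And>q. (p, q) \<in> T \<Longrightarrow> \<exists>r. (q, r) \<in> T \<and> r \<noteq> q"
  obtains W :: "'v set" and q E where "(card_of W, card_of (Field \<delta>)) \<in> ordIso" "infinite W" "(p, q) \<in> T"
    and "\<And>\<xi> s t. s \<in> E \<xi> \<Longrightarrow> (s, t) \<in> T \<Longrightarrow> t \<in> E \<xi>"
    and "\<And>r. (q, r) \<in> T \<Longrightarrow> \<exists>\<xi>\<in>W. \<exists>s. (r, s) \<in> T \<and> s \<in> E \<xi> \<and> r \<notin> E \<xi>"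
proof -
  from subcategory_system[OF S iso T] obtain M j where
    M: "\<And>x. x \<in> Field T \<Longrightarrow> transitive_ZFC_model mem \<delta> (M x)"
    and j: "\<And>x y. (x, y) \<in> T \<Longrightarrow> elementary_embedding mem (M x) (M y) (j x y)"
    and j_comp: "\<And>x y z. (x, y) \<in> T \<Longrightarrow> (y, z) \<in> T \<Longrightarrow> j x z = compose (M x) (j y z) (j x y)"
    and inj: "inj_on M (Field T)" by blast
  define W where "W = M p \<inter> ordinals mem"
  have W: "M x \<inter> ordinals mem = W" if "x \<in> Field T" for x
    unfolding W_def using same_height_ordinals M p that by blast
  have fields: "x \<in> Field T" "y \<in> Field T" if "(x, y) \<in> T" for x y
    using that by (auto simp: Field_def)
  have zm: "zmodel (M x)" if "x \<in> Field T" for x using zmodel_of M that by blast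
  have j_in: "j x y a \<in> W" if xy: "(x, y) \<in> T" and a: "a \<in> W" for x y a
  proof -
    have aM: "a \<in> M x" "a \<in> ordinals mem" using a W[OF fields(1)[OF xy]] by auto
    have "j x y a \<in> ordinals mem"
      using dfn_elementary[OF dfn_ordinal[of 0] zm[OF fields(1)[OF xy]] zm[OF fields(2)[OF xy]] j[OF xy]
          const_env[OF aM(1)]] aM(2) by simp
    moreover have "j x y a \<in> M y" using j[OF xy] aM(1) by (auto simp: elementary_embedding_def)
    ultimately show ?thesis using W[OF fields(2)[OF xy]] by blast
  qed
  have j_mono: "mem (j x y a) (j x y b)" if xy: "(x, y) \<in> T" and a: "a \<in> W" "b \<in> W" "mem a b" for x y a b
  proof -
    have aM: "a \<in> M x" "b \<in> M x" using a W[OF fields(1)[OF xy]] by auto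
    then have "range (case_nat a (\<lambda>_. b)) \<subseteq> M x"
      by (auto simp: image_subset_iff split: nat.splits)
    from dfn_elementary[OF dfn_mem[of 0 "Suc 0"] zm[OF fields(1)[OF xy]] zm[OF fields(2)[OF xy]] j[OF xy] this]
    show ?thesis using a(3) by simp
  qed
  have j_comp': "j y z (j x y a) = j x z a" if "(x, y) \<in> T" "(y, z) \<in> T" "a \<in> W" for x y z a
    using j_comp[OF that(1,2)] that(3) W[OF fields(1)[OF that(1)]] by (auto simp: compose_def)
  have moved: "\<exists>r. (q, r) \<in> T \<and> (\<exists>a\<in>W. j q r a \<noteq> a)" if q: "(p, q) \<in> T" for q
  proof -
    from extend[OF q] obtain r where r: "(q, r) \<in> T" "r \<noteq> q" by blast
    have "M q \<noteq> M r" using inj r(2) fields[OF r(1)] by (auto dest: inj_onD)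
    then have "\<exists>a\<in>W. j q r a \<noteq> a"
      using elementary_embedding_fix_ordinals[OF zm[OF fields(1)[OF r(1)]] zm[OF fields(2)[OF r(1)]] j[OF r(1)]]
        W[OF fields(1)[OF r(1)]] W[OF fields(2)[OF r(1)]] by blast
    then show ?thesis using r(1) by blast
  qed
  have "W \<subseteq> ordinals mem" by (simp add: W_def)
  from drifting_system[OF this T p j_in j_mono j_comp' moved] obtain q E where
    "(p, q) \<in> T" "\<And>\<xi> s t. s \<in> E \<xi> \<Longrightarrow> (s, t) \<in> T \<Longrightarrow> t \<in> E \<xi>"
    "\<And>r. (q, r) \<in> T \<Longrightarrow> \<exists>\<xi>\<in>W. \<exists>s. (r, s) \<in> T \<and> s \<in> E \<xi> \<and> r \<notin> E \<xi>" by blast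
  moreover have "(card_of W, card_of (Field \<delta>)) \<in> ordIso" unfolding W_def by (rule card_ordinals[OF M[OF p]])
  moreover have "infinite W" unfolding W_def by (rule infinite_ordinals[OF zm[OF p]])
  ultimately show ?thesis using that by blast
qed

lemma infinite_Field_if_card_eq:
  fixes W :: "'v set"
  assumes "(card_of W, card_of (Field \<delta>)) \<in> ordIso" "infinite W"
  shows "infinite (Field \<delta>)"
  using card_of_ordIso_finite[OF assms(1)] assms(2) by blast

theorem no_succ_card_chain:
  assumes S: "subcategory S (elementary_cat mem \<delta>)"
  shows "\<not> isomorphic_cat S (poset_cat (succ_card \<delta>))"
proof
  let ?\<kappa> = "succ_card \<delta>"
  assume iso: "isomorphic_cat S (poset_cat ?\<kappa>)"
  have lin: "Linear_order ?\<kappa>" using succ_card_well_order[of \<delta>] by (simp add: well_order_on_def)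
  then have po: "Partial_order ?\<kappa>" by (simp add: linear_order_on_def)
  have "Field ?\<kappa> \<noteq> {}" unfolding succ_card_def using Field_cardSuc_not_empty card_of_Card_order by blast
  then obtain p where p: "p \<in> Field ?\<kappa>" by blast
  from subcategory_system[OF S iso po] obtain M where M: "transitive_ZFC_model mem \<delta> (M p)"
    using p by metis
  have inf: "infinite (Field \<delta>)"
    using infinite_Field_if_card_eq[OF card_ordinals[OF M] infinite_ordinals[OF zmodel_of[OF M]]] .
  note infk = infinite_Field_succ_card[OF inf]
  have ext: "\<exists>r. (q, r) \<in> ?\<kappa> \<and> r \<noteq> q" if "(p, q) \<in> ?\<kappa>" for q
    using infinite_Card_order_limit[OF succ_card_card_order infk, of q] that by (auto simp: Field_def)
  obtain W :: "'v set" and q E where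
    W: "(card_of W, card_of (Field \<delta>)) \<in> ordIso" "infinite W" and q: "(p, q) \<in> ?\<kappa>"
    and up: "\<And>\<xi> s t. s \<in> E \<xi> \<Longrightarrow> (s, t) \<in> ?\<kappa> \<Longrightarrow> t \<in> E \<xi>"
    and new: "\<And>r. (q, r) \<in> ?\<kappa> \<Longrightarrow> \<exists>\<xi>\<in>W. \<exists>s. (r, s) \<in> ?\<kappa> \<and> s \<in> E \<xi> \<and> r \<notin> E \<xi>"
    by (rule subcategory_drift[OF S iso po p ext], assumption, erule (2) that; assumption?; blast)
  have k_trans: "(x, z) \<in> ?\<kappa>" if "(x, y) \<in> ?\<kappa>" "(y, z) \<in> ?\<kappa>" for x y z
    using po that unfolding partial_order_on_def preorder_on_def by (meson transD)
  have k_refl: "(x, x) \<in> ?\<kappa>" if "x \<in> Field ?\<kappa>" for x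
    using po that by (simp add: partial_order_on_def preorder_on_def refl_on_def)
  have k_total: "(x, y) \<in> ?\<kappa> \<or> (y, x) \<in> ?\<kappa>" if "x \<in> Field ?\<kappa>" "y \<in> Field ?\<kappa>" for x y
    using lin that k_refl[OF that(1)] unfolding linear_order_on_def total_on_def by metis
  \<comment> \<open>A point of each \<open>E \<xi>\<close> that meets the field; \<open>p\<close> is
    only a filler that keeps \<open>g\<close> inside the field.\<close>
  define g where "g \<xi> = (if E \<xi> \<inter> Field ?\<kappa> = {} then p else SOME s. s \<in> E \<xi> \<inter> Field ?\<kappa>)" for \<xi>
  have g: "g \<xi> \<in> E \<xi> \<inter> Field ?\<kappa>" if "s \<in> E \<xi> \<inter> Field ?\<kappa>" for s \<xi>
    using that someI[of "\<lambda>s. s \<in> E \<xi> \<inter> Field ?\<kappa>", OF that] unfolding g_def by auto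
  have g_Field: "g \<xi> \<in> Field ?\<kappa>" for \<xi>
    using g[of _ \<xi>] p unfolding g_def by (cases "E \<xi> \<inter> Field ?\<kappa> = {}") auto
  have "cofinal (g ` W) ?\<kappa>"
    unfolding cofinal_def
  proof
    fix r assume r: "r \<in> Field ?\<kappa>"
    have qF: "q \<in> Field ?\<kappa>" using q by (auto simp: Field_def)
    \<comment> \<open>The larger of \<open>r\<close> and \<open>q\<close>, because new entries are
      guaranteed only above \<open>q\<close>.\<close>
    obtain r' where r': "(q, r') \<in> ?\<kappa>" "(r, r') \<in> ?\<kappa>"
      using k_total[OF r qF] k_refl r qF by blast
    have r'F: "r' \<in> Field ?\<kappa>" using r'(1) by (auto simp: Field_def)
    from new[OF r'(1)] obtain \<xi> s where s: "\<xi> \<in> W" "(r', s) \<in> ?\<kappa>" "s \<in> E \<xi>" "r' \<notin> E \<xi>" by blast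
    have "s \<in> Field ?\<kappa>" using s(2) by (auto simp: Field_def)
    then have g\<xi>: "g \<xi> \<in> E \<xi>" "g \<xi> \<in> Field ?\<kappa>" using g[of s \<xi>] s(3) by auto
    \<comment> \<open>A point of \<open>E \<xi>\<close> below \<open>r'\<close> would put
      \<open>r'\<close> into this upward closed set. The order is total, so \<open>g \<xi>\<close>
      lies strictly above \<open>r'\<close>.\<close>
    have "(g \<xi>, r') \<notin> ?\<kappa>" using up[OF g\<xi>(1)] s(4) by blast
    then have lt: "r' \<noteq> g \<xi> \<and> (r', g \<xi>) \<in> ?\<kappa>"
      using k_total[OF r'F g\<xi>(2)] k_refl[OF r'F] by auto
    have "(r, g \<xi>) \<in> ?\<kappa>" using k_trans[OF r'(2)] lt by blast
    moreover have "r \<noteq> g \<xi>"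
    proof
      assume "r = g \<xi>"
      then have "(g \<xi>, r') \<in> ?\<kappa>" using r'(2) by simp
      then show False using lt po unfolding partial_order_on_def by (meson antisymD)
    qed
    ultimately show "\<exists>b\<in>g ` W. r \<noteq> b \<and> (r, b) \<in> ?\<kappa>" using s(1) by blast
  qed
  moreover have "g ` W \<subseteq> Field ?\<kappa>" using g_Field by blast
  moreover have "regularCard ?\<kappa>"
    unfolding succ_card_def
    by (rule infinite_cardSuc_regularCard[OF _ card_of_Card_order]) (unfold Field_card_of, rule inf)
  ultimately have "(card_of (g ` W), ?\<kappa>) \<in> ordIso" unfolding regularCard_def by blast
  moreover have "(card_of (g ` W), ?\<kappa>) \<in> ordLess"
    using ordLeq_ordLess_trans[OF ordLeq_ordIso_trans[OF card_of_image W(1)] card_less_succ_card] .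
  ultimately show False using not_ordLess_ordIso by blast
qed

end

section \<open>Trees\<close>

lemma tree_comparable:
  assumes T: "is_tree T" and x: "(x, t) \<in> T" and y: "(y, t) \<in> T"
  shows "(x, y) \<in> T \<or> (y, x) \<in> T"
proof (cases "x = t \<or> y = t \<or> x = y")
  case True
  have "(x, x) \<in> T"
    using T x unfolding is_tree_def partial_order_on_def preorder_on_def refl_on_def
    by (auto simp: Field_def)
  then show ?thesis using True x y by auto
next
  case False
  have "t \<in> Field T" using x by (auto simp: Field_def)
  then have "Well_order (Restr T (underS T t))" using T by (simp add: is_tree_def)
  then have lin: "Total (Restr T (underS T t))"
    by (simp add: well_order_on_def linear_order_on_def)
  have refl: "(x, x) \<in> T" "(y, y) \<in> T"
    using T x y unfolding is_tree_def partial_order_on_def preorder_on_def refl_on_def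
    by (auto simp: Field_def)
  have "x \<in> underS T t" "y \<in> underS T t" using x y False by (auto simp: underS_def)
  then have "(x, x) \<in> Restr T (underS T t)" "(y, y) \<in> Restr T (underS T t)"
    using refl by auto
  then have "x \<in> Field (Restr T (underS T t))" "y \<in> Field (Restr T (underS T t))"
    by (auto simp: Field_def)
  then show ?thesis using lin False unfolding total_on_def by blast
qed

text \<open>It locates the node at which the branch leading to \<open>t\<close> enters a set. The
  definition of a tree well-orders only the strict predecessors, so \<open>t\<close> itself is a
  separate case.\<close>

lemma tree_least_predecessor:
  assumes T: "is_tree T" and t: "t \<in> Field T" "P t"
  obtains u where "(u, t) \<in> T" "P u" "\<And>v. (v, t) \<in> T \<Longrightarrow> P v \<Longrightarrow> (u, v) \<in> T"
proof -
  have refl: "(x, x) \<in> T" if "x \<in> Field T" for x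
    using T that unfolding is_tree_def partial_order_on_def preorder_on_def refl_on_def by blast
  let ?A = "{u \<in> underS T t. P u}"
  show ?thesis
  proof (cases "?A = {}")
    case True
    then have "v = t" if "(v, t) \<in> T" "P v" for v using that by (auto simp: underS_def)
    then show ?thesis using that[of t] t refl[OF t(1)] by blast
  next
    case False
    then obtain a where a: "a \<in> ?A" by blast
    have "wf (Restr T (underS T t) - Id)"
      using T t(1) by (simp add: is_tree_def well_order_on_def)
    then obtain u where u: "u \<in> ?A" and min: "\<And>v. (v, u) \<in> Restr T (underS T t) - Id \<Longrightarrow> v \<notin> ?A"
      using wfE_min[OF _ a] by metis
    have ut: "(u, t) \<in> T" using u by (auto simp: underS_def)
    have "(u, v) \<in> T" if v: "(v, t) \<in> T" "P v" for v
    proof (cases "v = t")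
      case False
      then have "v \<in> ?A" using v by (auto simp: underS_def)
      then have "(v, u) \<in> T \<Longrightarrow> v = u" using min[of v] u by auto
      then show ?thesis using tree_comparable[OF T ut v(1)] by blast
    qed (use ut in simp)
    then show ?thesis using that[of u] ut u by blast
  qed
qed

text \<open>The predecessors of \<open>x\<close> form an initial segment of those of
  \<open>y\<close>, so their order types compare. Were the levels in the reverse strict order, the
  segments of \<open>\<kappa>\<close> would compare strictly the other way.\<close>

lemma tree_level_mono:
  assumes T: "is_tree T" and \<kappa>: "Well_order \<kappa>"
    and \<alpha>: "\<alpha> \<in> Field \<kappa>" "x \<in> tree_level T \<kappa> \<alpha>"
    and \<beta>: "\<beta> \<in> Field \<kappa>" "y \<in> tree_level T \<kappa> \<beta>" and xy: "(x, y) \<in> T"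
  shows "(\<alpha>, \<beta>) \<in> \<kappa>"
proof (rule ccontr)
  assume not: "(\<alpha>, \<beta>) \<notin> \<kappa>"
  have k: "wo_rel \<kappa>" using \<kappa> by (simp add: wo_rel_def)
  have refl: "Refl \<kappa>" and tot: "Total \<kappa>" and trans: "trans \<kappa>" and anti: "antisym \<kappa>"
    using \<kappa> by (simp_all add: well_order_on_def linear_order_on_def partial_order_on_def preorder_on_def)
  have \<beta>\<alpha>: "(\<beta>, \<alpha>) \<in> \<kappa>" "\<beta> \<noteq> \<alpha>"
    using not tot refl \<alpha>(1) \<beta>(1) unfolding total_on_def refl_on_def by metis+
  have "underS \<kappa> \<beta> \<subset> underS \<kappa> \<alpha>"
  proof
    show "underS \<kappa> \<beta> \<subseteq> underS \<kappa> \<alpha>"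
      using \<beta>\<alpha> transD[OF trans] antisymD[OF anti] unfolding underS_def by blast
    show "underS \<kappa> \<beta> \<noteq> underS \<kappa> \<alpha>"
      using \<beta>\<alpha> unfolding underS_def by blast
  qed
  then have less: "(Restr \<kappa> (underS \<kappa> \<beta>), Restr \<kappa> (underS \<kappa> \<alpha>)) \<in> ordLess"
    using ofilter_subset_ordLess[OF \<kappa> wo_rel.underS_ofilter[OF k] wo_rel.underS_ofilter[OF k]] by blast
  have T': "Partial_order T" using T by (simp add: is_tree_def)
  have T_trans: "(a, c) \<in> T" if "(a, b) \<in> T" "(b, c) \<in> T" for a b c
    using T' that unfolding partial_order_on_def preorder_on_def by (meson transD)
  have T_anti: "a = b" if "(a, b) \<in> T" "(b, a) \<in> T" for a b
    using T' that unfolding partial_order_on_def by (meson antisymD)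
  have T_refl: "(a, a) \<in> T" if "a \<in> Field T" for a
    using T' that unfolding partial_order_on_def preorder_on_def refl_on_def by blast
  let ?r = "Restr T (underS T y)"
  have "y \<in> Field T" using xy by (auto simp: Field_def)
  then have W: "Well_order ?r" using T by (simp add: is_tree_def)
  have sub: "underS T x \<subseteq> underS T y"
    unfolding underS_def using T_trans[OF _ xy] T_anti xy by blast
  have Field_r: "Field ?r = underS T y"
  proof
    show "underS T y \<subseteq> Field ?r"
    proof
      fix a assume a: "a \<in> underS T y"
      then have "(a, a) \<in> T" using T_refl by (auto simp: underS_def Field_def)
      then show "a \<in> Field ?r" using a by (auto simp: Field_def)
    qed
  qed (auto simp: Field_def)
  have "wo_rel.ofilter ?r (underS T x)"
    unfolding wo_rel.ofilter_def[OF W[folded wo_rel_def]] Field_r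
  proof (intro conjI ballI sub subsetI)
    fix a b assume "a \<in> underS T x" "b \<in> under ?r a"
    then show "b \<in> underS T x"
      unfolding under_def underS_def using T_trans T_anti by blast
  qed
  moreover have "wo_rel.ofilter ?r (Field ?r)"
    using wo_rel.Field_ofilter W unfolding wo_rel_def by blast
  ultimately have "(Restr ?r (underS T x), Restr ?r (Field ?r)) \<in> ordLeq"
    using ofilter_subset_ordLeq[OF W] sub Field_r by blast
  moreover have "Restr ?r (Field ?r) = ?r" unfolding Field_r by blast
  moreover have "Restr ?r (underS T x) = Restr T (underS T x)" using sub by blast
  ultimately have "(Restr T (underS T x), ?r) \<in> ordLeq" by simp
  moreover have "(Restr T (underS T x), Restr \<kappa> (underS \<kappa> \<alpha>)) \<in> ordIso"
    "(?r, Restr \<kappa> (underS \<kappa> \<beta>)) \<in> ordIso"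
    using \<alpha>(2) \<beta>(2) by (auto simp: tree_level_def)
  ultimately have "(Restr \<kappa> (underS \<kappa> \<alpha>), Restr \<kappa> (underS \<kappa> \<beta>)) \<in> ordLeq"
    using ordIso_ordLeq_trans[OF ordIso_symmetric] ordLeq_ordIso_trans by blast
  then show False using less not_ordLess_ordLeq by blast
qed

text \<open>A proper initial segment of delta^+ has at most delta elements. Only a covering is
  claimed: \<open>e\<close> may also take values outside the segment.\<close>

lemma succ_card_underS_enum:
  assumes \<gamma>: "\<gamma> \<in> Field (succ_card \<delta>)" and W: "(card_of W, card_of (Field \<delta>)) \<in> ordIso"
  shows "\<exists>e. underS (succ_card \<delta>) \<gamma> \<subseteq> e ` W"
proof -
  have "(card_of (underS (succ_card \<delta>) \<gamma>), succ_card \<delta>) \<in> ordLess"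
    using card_of_underS[OF succ_card_card_order \<gamma>] .
  then have "(card_of (underS (succ_card \<delta>) \<gamma>), card_of (Field \<delta>)) \<in> ordLeq"
    unfolding succ_card_def using cardSuc_ordLeq_ordLess[OF card_of_Card_order card_of_Card_order] by blast
  then have "(card_of (underS (succ_card \<delta>) \<gamma>), card_of W) \<in> ordLeq"
    using ordLeq_ordIso_trans ordIso_symmetric[OF W] by blast
  from card_of_ordLeq[THEN iffD2, OF this]
  obtain f where f: "inj_on f (underS (succ_card \<delta>) \<gamma>)" "f ` underS (succ_card \<delta>) \<gamma> \<subseteq> W"
    by auto
  have "underS (succ_card \<delta>) \<gamma> \<subseteq> inv_into (underS (succ_card \<delta>) \<gamma>) f ` W"
  proof
    fix x assume "x \<in> underS (succ_card \<delta>) \<gamma>"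
    then have "inv_into (underS (succ_card \<delta>) \<gamma>) f (f x) = x" "f x \<in> W" using f by auto
    then show "x \<in> inv_into (underS (succ_card \<delta>) \<gamma>) f ` W" by (metis imageI)
  qed
  then show ?thesis by blast
qed

text \<open>The collapsing map must be defined on an ordinal below delta^+. As \<open>W\<close> is
  infinite, its square has cardinality delta, and a well-order of the square has such an order
  type.\<close>

lemma succ_card_underS_pairs:
  assumes W: "(card_of W, card_of (Field \<delta>)) \<in> ordIso" and inf: "infinite W"
  shows "\<exists>\<alpha>\<in>Field (succ_card \<delta>). \<exists>h. bij_betw h (underS (succ_card \<delta>) \<alpha>) (W \<times> W)"
proof -
  have "(card_of (W \<times> W), card_of (Field \<delta>)) \<in> ordIso"
    using ordIso_transitive[OF card_of_Times_same_infinite[OF inf] W] .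
  then have "(card_of (W \<times> W), succ_card \<delta>) \<in> ordLess"
    using ordIso_ordLess_trans card_less_succ_card by blast
  then obtain \<alpha> where \<alpha>: "\<alpha> \<in> Field (succ_card \<delta>)"
    "(card_of (W \<times> W), Restr (succ_card \<delta>) (underS (succ_card \<delta>) \<alpha>)) \<in> ordIso"
    using ordLess_iff_ordIso_Restr[OF succ_card_well_order card_of_Well_order] by blast
  have "Field (Restr (succ_card \<delta>) (underS (succ_card \<delta>) \<alpha>)) = underS (succ_card \<delta>) \<alpha>"
    by (rule Field_Restr_ofilter[OF succ_card_well_order
          wo_rel.underS_ofilter[OF succ_card_well_order[folded wo_rel_def]]])
  then have "(card_of (W \<times> W), card_of (underS (succ_card \<delta>) \<alpha>)) \<in> ordIso"
    using card_of_cong[OF \<alpha>(2)] unfolding Field_card_of by simp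
  from card_of_ordIso[THEN iffD2, OF ordIso_symmetric[OF this]] show ?thesis
    using \<alpha>(1) by (rule bexI)
qed

context set_univ
begin

theorem succ_card_tree_collapse:
  assumes S: "subcategory S (elementary_cat mem \<delta>)" and iso: "isomorphic_cat S (poset_cat T)"
    and tree: "succ_card_tree \<delta> T" and p: "p \<in> Field T" "pruned_above T (succ_card \<delta>) p"
  shows "tree_forces_collapse T p (succ_card \<delta>)"
proof -
  let ?\<kappa> = "succ_card \<delta>"
  note \<kappa> = succ_card_well_order[of \<delta>]
  have T: "is_tree T" and levels: "\<And>x. x \<in> Field T \<Longrightarrow> \<exists>\<alpha>\<in>Field ?\<kappa>. x \<in> tree_level T ?\<kappa> \<alpha>"
    using tree unfolding succ_card_tree_def tree_of_height_def by auto
  have po: "Partial_order T" using T by (simp add: is_tree_def)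
  have T_trans: "(a, c) \<in> T" if "(a, b) \<in> T" "(b, c) \<in> T" for a b c
    using po that unfolding partial_order_on_def preorder_on_def by (meson transD)
  have T_anti: "a = b" if "(a, b) \<in> T" "(b, a) \<in> T" for a b
    using po that unfolding partial_order_on_def by (meson antisymD)
  have T_refl: "(a, a) \<in> T" if "a \<in> Field T" for a
    using po that unfolding partial_order_on_def preorder_on_def refl_on_def by blast
  have fields: "a \<in> Field T" "b \<in> Field T" if "(a, b) \<in> T" for a b
    using that by (auto simp: Field_def)
  have \<kappa>_anti: "a = b" if "(a, b) \<in> ?\<kappa>" "(b, a) \<in> ?\<kappa>" for a b
    using \<kappa> that unfolding well_order_on_def linear_order_on_def partial_order_on_def
    by (meson antisymD)
  have \<kappa>_trans: "(a, c) \<in> ?\<kappa>" if "(a, b) \<in> ?\<kappa>" "(b, c) \<in> ?\<kappa>" for a b c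
    using \<kappa> that unfolding well_order_on_def linear_order_on_def partial_order_on_def preorder_on_def
    by (meson transD)
  define lev where "lev x = (SOME \<alpha>. \<alpha> \<in> Field ?\<kappa> \<and> x \<in> tree_level T ?\<kappa> \<alpha>)" for x
  have lev: "lev x \<in> Field ?\<kappa> \<and> x \<in> tree_level T ?\<kappa> (lev x)" if "x \<in> Field T" for x
    unfolding lev_def by (rule someI_ex) (use levels[OF that] in blast)
  from subcategory_system[OF S iso po] obtain M where "transitive_ZFC_model mem \<delta> (M p)"
    using p(1) by metis
  then have inf: "infinite (Field \<delta>)"
    using infinite_Field_if_card_eq[OF card_ordinals infinite_ordinals[OF zmodel_of]] by blast
  note infk = infinite_Field_succ_card[OF inf]
  \<comment> \<open>Pruning only gives levels at least as high as a prescribed one. Prescribing a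
    larger \<open>\<alpha>'\<close>, which exists because an infinite cardinal has no last element,
    makes the inequality strict.\<close>
  have higher: "\<exists>x \<beta>. (q, x) \<in> T \<and> \<beta> \<in> Field ?\<kappa> \<and> x \<in> tree_level T ?\<kappa> \<beta> \<and> (\<alpha>, \<beta>) \<in> ?\<kappa> \<and> \<alpha> \<noteq> \<beta>"
    if q: "(p, q) \<in> T" and \<alpha>: "\<alpha> \<in> Field ?\<kappa>" for q \<alpha>
  proof -
    from infinite_Card_order_limit[OF succ_card_card_order infk \<alpha>] obtain \<alpha>' where
      \<alpha>': "\<alpha>' \<in> Field ?\<kappa>" "\<alpha> \<noteq> \<alpha>'" "(\<alpha>, \<alpha>') \<in> ?\<kappa>" by blast
    from p(2) q \<alpha>'(1) obtain \<beta> x where x: "(\<alpha>', \<beta>) \<in> ?\<kappa>" "x \<in> tree_level T ?\<kappa> \<beta>" "(q, x) \<in> T"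
      unfolding pruned_above_def by blast
    have "\<alpha> \<noteq> \<beta>" using \<alpha>'(2,3) x(1) \<kappa>_anti by blast
    moreover have "(\<alpha>, \<beta>) \<in> ?\<kappa>" using \<kappa>_trans[OF \<alpha>'(3) x(1)] .
    ultimately show ?thesis using x(2,3) by (auto simp: Field_def)
  qed
  \<comment> \<open>A node of strictly higher level is a proper extension, so no node above
    \<open>p\<close> is terminal.\<close>
  have extend: "\<exists>x. (q, x) \<in> T \<and> x \<noteq> q" if q: "(p, q) \<in> T" for q
  proof -
    from higher[OF q, of "lev q"] lev[OF fields(2)[OF q]] obtain x \<beta> where
      x: "(q, x) \<in> T" "\<beta> \<in> Field ?\<kappa>" "x \<in> tree_level T ?\<kappa> \<beta>" "(lev q, \<beta>) \<in> ?\<kappa>" "lev q \<noteq> \<beta>" by blast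
    have "x \<noteq> q"
    proof
      assume "x = q"
      then have "(\<beta>, lev q) \<in> ?\<kappa>"
        using tree_level_mono[OF T \<kappa> x(2,3), of "lev q" q] lev[OF fields(2)[OF q]]
          T_refl[OF fields(2)[OF q]] by blast
      then show False using x(4,5) \<kappa>_anti by blast
    qed
    then show ?thesis using x(1) by blast
  qed
  interpret forcing_order "T\<inverse>"
    by unfold_locales (use T_refl T_trans in auto)
  \<comment> \<open>The sets \<open>E\<close> are available only above some \<open>q\<close> that
    depends on \<open>p'\<close>; since \<open>p'\<close> is arbitrary above \<open>p\<close>,
    \<open>forces_dense\<close> recovers the statement at \<open>p\<close>.\<close>
  have dense: "\<exists>q. (p', q) \<in> T \<and> forces (T\<inverse>) q s not_cardinal_fm"
    if p': "(p, p') \<in> T" and s: "s = (\<lambda>_. check_ord (T\<inverse>) ?\<kappa>)" for p' s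
  proof -
    have ext': "\<exists>x. (q, x) \<in> T \<and> x \<noteq> q" if "(p', q) \<in> T" for q
      using extend[OF T_trans[OF p' that]] .
    obtain W :: "'v set" and q E where
      W: "(card_of W, card_of (Field \<delta>)) \<in> ordIso" "infinite W" and q: "(p', q) \<in> T"
      and up: "\<And>\<xi> s t. s \<in> E \<xi> \<Longrightarrow> (s, t) \<in> T \<Longrightarrow> t \<in> E \<xi>"
      and new: "\<And>r. (q, r) \<in> T \<Longrightarrow> \<exists>\<xi>\<in>W. \<exists>s. (r, s) \<in> T \<and> s \<in> E \<xi> \<and> r \<notin> E \<xi>"
      by (rule subcategory_drift[OF S iso po fields(2)[OF p'] ext'], assumption, erule (2) that; assumption?; blast)
    have pq: "(p, v) \<in> T" if "(q, v) \<in> T" for v using T_trans[OF T_trans[OF p' q] that] .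
    define e where "e \<gamma> = (SOME e. underS ?\<kappa> \<gamma> \<subseteq> e ` W)" for \<gamma>
    have e: "underS ?\<kappa> \<gamma> \<subseteq> e \<gamma> ` W" if "\<gamma> \<in> Field ?\<kappa>" for \<gamma>
      unfolding e_def by (rule someI_ex[OF succ_card_underS_enum[OF that W(1)]])
    from succ_card_underS_pairs[OF W] obtain \<alpha> h where \<alpha>: "\<alpha> \<in> Field ?\<kappa>"
      and h: "bij_betw h (underS ?\<kappa> \<alpha>) (W \<times> W)" by blast
    \<comment> \<open>The \<open>\<zeta>\<close>-th ordinal below the level of \<open>t\<close>. As
      \<open>e\<close> merely covers these ordinals, a value outside the field is replaced by
      \<open>\<alpha>\<close>.\<close>
    define val where "val t \<zeta> = (if e (lev t) \<zeta> \<in> Field ?\<kappa> then e (lev t) \<zeta> else \<alpha>)" for t \<zeta>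
    have val: "val t \<zeta> \<in> Field ?\<kappa>" for t \<zeta> using \<alpha> unfolding val_def by simp
    \<comment> \<open>Here \<open>u\<close> is the node at which the branch leading to
      \<open>t\<close> enters \<open>E \<xi>\<close>. Once it exists, it stays the same for all
      extensions of \<open>t\<close>.\<close>
    define first where "first \<xi> t u \<longleftrightarrow> (u, t) \<in> T \<and> u \<in> E \<xi> \<and>
      (\<forall>v. (v, t) \<in> T \<longrightarrow> v \<in> E \<xi> \<longrightarrow> (u, v) \<in> T)" for \<xi> t u
    \<comment> \<open>The ordinal \<open>a\<close> codes a pair of an index \<open>\<xi>\<close> and
      a position. Its value is decided once \<open>E \<xi>\<close> has been entered, or once it can
      no longer be entered, where the default is \<open>\<alpha>\<close>; every condition has an
      extension of one of these kinds.\<close>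
    define R where "R a \<beta> t \<longleftrightarrow> (a, \<alpha>) \<in> ?\<kappa> - Id \<and>
      ((\<exists>u. first (fst (h a)) t u \<and> \<beta> = val u (snd (h a))) \<or>
       ((\<forall>s. (t, s) \<in> T \<longrightarrow> s \<notin> E (fst (h a))) \<and> \<beta> = \<alpha>))" for a \<beta> t
    have first_mono: "first \<xi> s u" if "first \<xi> t u" "(t, s) \<in> T" for \<xi> t s u
    proof -
      have ut: "(u, t) \<in> T" "u \<in> E \<xi>" and min: "\<And>v. (v, t) \<in> T \<Longrightarrow> v \<in> E \<xi> \<Longrightarrow> (u, v) \<in> T"
        using that(1) unfolding first_def by auto
      have us: "(u, s) \<in> T" using T_trans[OF ut(1) that(2)] .
      have "(u, v) \<in> T" if v: "(v, s) \<in> T" "v \<in> E \<xi>" for v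
        using tree_comparable[OF T us v(1)] min[of v] v(2) T_trans[OF _ ut(1), of v] by blast
      then show ?thesis using us ut(2) unfolding first_def by blast
    qed
    have first_unique: "u = v" if "first \<xi> t u" "first \<xi> t v" for \<xi> t u v
      using that T_anti unfolding first_def by blast
    have first_E: "t \<in> E \<xi>" if "first \<xi> t u" for \<xi> t u
      using that up unfolding first_def by blast
    have first_ex: "\<exists>u. first \<xi> t u" if t: "t \<in> Field T" "t \<in> E \<xi>" for \<xi> t
    proof -
      obtain u where "(u, t) \<in> T" "u \<in> E \<xi>" "\<And>v. (v, t) \<in> T \<Longrightarrow> v \<in> E \<xi> \<Longrightarrow> (u, v) \<in> T"
        by (rule tree_least_predecessor[OF T t(1), of "\<lambda>u. u \<in> E \<xi>", OF t(2)]) blast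
      then show ?thesis unfolding first_def by blast
    qed
    have "q \<in> Field T" using fields(2)[OF q] .
    \<comment> \<open>The names of pairs need a second index different from
      \<open>\<alpha>\<close>.\<close>
    have "infinite (Field ?\<kappa> - {\<alpha>})" using infk by simp
    then have "Field ?\<kappa> - {\<alpha>} \<noteq> {}" by (rule infinite_imp_nonempty)
    then obtain i' where i': "i' \<noteq> \<alpha>" by blast
    have "forces (T\<inverse>) q s not_cardinal_fm"
    proof (rule forces_not_cardinal_fm[OF \<kappa> \<alpha>, where R = R and i = \<alpha> and i' = i'])
      show "q \<in> Field (T\<inverse>)" using \<open>q \<in> Field T\<close> by simp
      show "s 0 = check_ord (T\<inverse>) ?\<kappa>" using s by simp
      show "i' \<noteq> \<alpha>" by (rule i')
      show "(a, \<alpha>) \<in> ?\<kappa> - Id \<and> \<beta> \<in> Field ?\<kappa>" if "R a \<beta> t" for a \<beta> t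
        using that \<alpha> val unfolding R_def by blast
      show "R a \<beta> s" if R: "R a \<beta> t" and "(s, t) \<in> T\<inverse>" for a \<beta> t s
      proof -
        have ts: "(t, s) \<in> T" using that(2) by simp
        show ?thesis
          using R first_mono[OF _ ts] T_trans[OF ts] unfolding R_def by blast
      qed
      show "\<beta> = \<beta>'" if R: "R a \<beta> t" "R a \<beta>' t" for a \<beta> \<beta>' t
      proof -
        \<comment> \<open>The two alternatives of \<open>R\<close> exclude each other: an entry
          point below \<open>t\<close> puts \<open>t\<close> itself into
          \<open>E \<xi>\<close>.\<close>
        have clash: False if "first \<xi> t u" "\<forall>s. (t, s) \<in> T \<longrightarrow> s \<notin> E \<xi>" for \<xi> u
          using that first_E[OF that(1)] T_refl fields(2) unfolding first_def by blast
        show ?thesis using R first_unique clash unfolding R_def by blast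
      qed
      show "\<exists>t \<beta>. (t, v) \<in> T\<inverse> \<and> R a \<beta> t" if a: "(a, \<alpha>) \<in> ?\<kappa> - Id" and v: "(v, q) \<in> T\<inverse>" for a v
      proof (cases "\<exists>s. (v, s) \<in> T \<and> s \<in> E (fst (h a))")
        case True
        then obtain s where s: "(v, s) \<in> T" "s \<in> E (fst (h a))" by blast
        from first_ex[OF fields(2)[OF s(1)] s(2)] obtain u where "first (fst (h a)) s u" ..
        then have "R a (val u (snd (h a))) s" unfolding R_def using a by blast
        then show ?thesis using s(1) by blast
      next
        case False
        then have "R a \<alpha> v" unfolding R_def using a by blast
        moreover have "(v, v) \<in> T" using T_refl fields(2) v by blast
        ultimately show ?thesis by blast
      qed
      show "\<exists>t a. (t, v) \<in> T\<inverse> \<and> R a \<beta> t" if \<beta>: "\<beta> \<in> Field ?\<kappa>" and v: "(v, q) \<in> T\<inverse>" for \<beta> v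
      proof -
        have qv: "(q, v) \<in> T" using v by simp
        \<comment> \<open>Climbing past level \<open>\<beta>\<close> before asking for a new entry
          ensures that the entry point \<open>u\<close>, lying above \<open>x\<close>, has a level
          beyond \<open>\<beta>\<close>. Then \<open>\<beta>\<close> is among the ordinals listed by
          \<open>e (lev u)\<close>.\<close>
        from higher[OF pq[OF qv] \<beta>] obtain x \<gamma> where x: "(v, x) \<in> T" "\<gamma> \<in> Field ?\<kappa>"
          "x \<in> tree_level T ?\<kappa> \<gamma>" "(\<beta>, \<gamma>) \<in> ?\<kappa>" "\<beta> \<noteq> \<gamma>" by blast
        from new[OF T_trans[OF qv x(1)]] obtain \<xi> s where
          s: "\<xi> \<in> W" "(x, s) \<in> T" "s \<in> E \<xi>" "x \<notin> E \<xi>" by blast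
        from first_ex[OF fields(2)[OF s(2)] s(3)] obtain u where u: "first \<xi> s u" ..
        then have us: "(u, s) \<in> T" "u \<in> E \<xi>" unfolding first_def by blast+
        \<comment> \<open>Both nodes lie below \<open>s\<close>, so they are comparable;
          \<open>u\<close> below \<open>x\<close> would put \<open>x\<close> into
          \<open>E \<xi>\<close>.\<close>
        have xu: "(x, u) \<in> T"
          using tree_comparable[OF T s(2) us(1)] up[OF us(2), of x] s(4) by blast
        note l = lev[OF fields(2)[OF xu]]
        have "(\<gamma>, lev u) \<in> ?\<kappa>"
          by (rule tree_level_mono[OF T \<kappa> x(2,3) _ _ xu]) (use l in blast)+
        then have "\<beta> \<in> underS ?\<kappa> (lev u)"
          using x(4,5) \<kappa>_trans \<kappa>_anti unfolding underS_def by blast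
        then obtain \<zeta> where \<zeta>: "\<zeta> \<in> W" "e (lev u) \<zeta> = \<beta>" using e[of "lev u"] l by blast
        have "(\<xi>, \<zeta>) \<in> h ` underS ?\<kappa> \<alpha>"
          using s(1) \<zeta>(1) unfolding bij_betw_imp_surj_on[OF h] by simp
        then obtain a where a: "a \<in> underS ?\<kappa> \<alpha>" "h a = (\<xi>, \<zeta>)" by auto
        have "val u \<zeta> = \<beta>" unfolding val_def using \<zeta>(2) \<beta> by simp
        then have "R a \<beta> s" unfolding R_def using a u by (auto simp: underS_def)
        then show ?thesis using T_trans[OF x(1) s(2)] by blast
      qed
    qed
    then show ?thesis using q by blast
  qed
  show ?thesis
    unfolding tree_forces_collapse_def
    by (rule forces_dense, rule dense_belowI) (use dense in simp)
qed

end

theorem theorem4p6: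
  fixes mem :: "'v \<Rightarrow> 'v \<Rightarrow> bool" and \<delta> :: "'d rel"
  assumes "set_universe mem" and "Well_order \<delta>"
  shows "(\<nexists>S. subcategory S (elementary_cat mem \<delta>) \<and>
              isomorphic_cat S (poset_cat (succ_card \<delta>))) \<and>
         (\<forall>T :: 't rel.
            succ_card_tree \<delta> T \<and>
            (\<exists>S. subcategory S (elementary_cat mem \<delta>) \<and> isomorphic_cat S (poset_cat T)) \<longrightarrow>
            (\<forall>p\<in>Field T. pruned_above T (succ_card \<delta>) p \<longrightarrow>
               tree_forces_collapse T p (succ_card \<delta>)))"
proof -
  interpret set_univ mem by unfold_locales (rule assms(1))
  show ?thesis
  proof (intro conjI allI impI ballI)
    show "\<nexists>S. subcategory S (elementary_cat mem \<delta>) \<and>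
      isomorphic_cat S (poset_cat (succ_card \<delta>))"
      using no_succ_card_chain[of _ \<delta>] by auto
  next
    fix T :: "'t rel" and p
    assume T: "succ_card_tree \<delta> T \<and>
      (\<exists>S. subcategory S (elementary_cat mem \<delta>) \<and> isomorphic_cat S (poset_cat T))"
      and p: "p \<in> Field T" "pruned_above T (succ_card \<delta>) p"
    from T obtain S where "subcategory S (elementary_cat mem \<delta>)" "isomorphic_cat S (poset_cat T)"
      by auto
    from succ_card_tree_collapse[OF this conjunct1[OF T] p]
    show "tree_forces_collapse T p (succ_card \<delta>)" .
  qed
qed

end
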